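(* Let $n,k$ be integers with $2\leq k\leq n-1$, and let $\Pi\subset{\bf R}^n$ be the hyperbolicity domain of the family $P(x,a)=x^n+a_1x^{n-1}+\ldots+a_n$. Consider the stratification of $\Pi$ whose strata are the subsets of $\Pi$ consisting of all polynomials having a given configuration vector (describing the arrangement of the roots of $P$ and $P^{(k)}$). Then all strata of this stratification are smooth contractible real algebraic varieties.
   Context: A real monic polynomial in one real variable is called hyperbolic if all its roots are real. For $a=(a_1,\ldots,a_n)\in{\bf R}^n$ set $P(x,a)=x^n+a_1x^{n-1}+\ldots+a_n$ and identify the polynomial with the point $a$. The hyperbolicity domain is $\Pi=\{a\in{\bf R}^n \mid P(\cdot,a)\text{ is hyperbolic}\}$. If $P$ is hyperbolic, so are all its non-trivial derivatives; $P^{(k)}$ denotes the $k$-th derivative with respect to $x$. Let $x_1\leq\ldots\leq x_n$ be the roots of $P$ and $\xi_1\leq\ldots\leq\xi_{n-k}$ the roots of $P^{(k)}$. By Rolle's theorem $x_i\leq\xi_i\leq x_{i+k}$ for $i=1,\ldots,n-k$. A root of $P$ of multiplicity $<k$ (including multiplicity $0$, i.e. a non-root) which is also a root of $P^{(k)}$ is a simple root of $P^{(k)}$. Configuration vector (CV) of length $n$: a vector whose components are either positive integers (some of them possibly indexed by the letter $a$), with the sum of all integers equal to $n$, or the letter $a$. The CV of a hyperbolic polynomial $P$ lists, from left to right on the real line, the distinct points that are roots of $P$ or of $P^{(k)}$: a root of $P$ is represented by its multiplicity $m$; if $m<k$ and this root of $P$ is also a (necessarily simple) root of $P^{(k)}$,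 it is written $m_a$; a root of $P^{(k)}$ which is not a root of $P$ is represented by a component $a$. (Roots of $P$ of multiplicity $>k$ are automatically roots of $P^{(k)}$ and are not indexed by $a$; roots of multiplicity exactly $k$ are not roots of $P^{(k)}$.) Example: for $n=8$, $k=3$ the CV $(1,a,1,2_a,a,a,4)$ means $x_1<\xi_1<x_2<x_3=x_4=\xi_2<\xi_3<\xi_4<x_5=\ldots=x_8=\xi_5$. The stratum of $\Pi$ defined by a CV $\vec v$ is the subset of all polynomials in $\Pi$ whose CV (for the given $k$) equals $\vec v$; strata are the non-empty subsets of this form. "Smooth real algebraic variety" is meant in the local sense: a stratum is locally, near each of its points, a smooth real algebraic variety in ${\bf R}^n$ (it need not be closed in ${\bf R}^n$, as it is also subject to strict inequalities between roots). *)

theory Defs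
  imports "HOL-Analysis.Analysis" "HOL-Computational_Algebra.Polynomial"
begin

text \<open>The coordinates \<open>a\<^sub>1, \<dots>, a\<^sub>n\<close> of a point of \<open>real ^ 'n\<close>, with \<open>n = CARD('n)\<close>, are numbered
  along the linear order of the index type: index \<open>i\<close> is the \<open>coord_pos i\<close>-th coordinate,
  \<open>1 \<le> coord_pos i \<le> n\<close>.\<close>

definition coord_pos :: "'n::{finite,linorder} \<Rightarrow> nat" where
  "coord_pos i = card {j. j \<le> i}"

definition monic_poly_of :: "real ^ 'n::{finite,linorder} \<Rightarrow> real poly" where
  "monic_poly_of a =
     monom 1 CARD('n) + (\<Sum>i\<in>UNIV. monom (a $ i) (CARD('n) - coord_pos i))"

definition hyperbolic :: "real poly \<Rightarrow> bool" where
  "hyperbolic p \<longleftrightarrow> lead_coeff p = 1 \<and> (\<forall>z. poly (map_poly complex_of_real p) z = 0 \<longrightarrow> z \<in> \<real>)"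

definition hyperbolicity_domain :: "(real ^ 'n::{finite,linorder}) set" where
  "hyperbolicity_domain = {a. hyperbolic (monic_poly_of a)}"

text \<open>\<open>Root m\<close> stands for the component \<open>m\<close>, \<open>Marked_Root m\<close> for \<open>m\<^sub>a\<close> and \<open>Deriv_Root\<close> for \<open>a\<close>.\<close>

datatype cv_entry = Root nat | Marked_Root nat | Deriv_Root

fun cv_int :: "cv_entry \<Rightarrow> nat" where
  "cv_int (Root m) = m"
| "cv_int (Marked_Root m) = m"
| "cv_int Deriv_Root = 0"

definition config_vector :: "nat \<Rightarrow> cv_entry list \<Rightarrow> bool" where
  "config_vector n v \<longleftrightarrow>
     (\<forall>e\<in>set v. e \<noteq> Deriv_Root \<longrightarrow> cv_int e > 0) \<and> sum_list (map cv_int v) = n"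

definition cv_entry_at :: "nat \<Rightarrow> real poly \<Rightarrow> real \<Rightarrow> cv_entry" where
  "cv_entry_at k p x =
     (if poly p x \<noteq> 0 then Deriv_Root
      else if order x p < k \<and> poly ((pderiv ^^ k) p) x = 0 then Marked_Root (order x p)
      else Root (order x p))"

definition cv_of :: "nat \<Rightarrow> real poly \<Rightarrow> cv_entry list" where
  "cv_of k p = map (cv_entry_at k p)
     (sorted_list_of_set {x. poly p x = 0 \<or> poly ((pderiv ^^ k) p) x = 0})"

definition stratum :: "nat \<Rightarrow> cv_entry list \<Rightarrow> (real ^ 'n::{finite,linorder}) set" where
  "stratum k v = {a \<in> hyperbolicity_domain. cv_of k (monic_poly_of a) = v}"

definition strata :: "nat \<Rightarrow> (real ^ 'n::{finite,linorder}) set set" where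
  "strata k = {S. S \<noteq> {} \<and> (\<exists>v. config_vector CARD('n) v \<and> S = stratum k v)}"

text \<open>Near \<open>a\<close>, the set \<open>S\<close> is the zero set of \<open>r\<close> polynomials whose gradients at \<open>a\<close> are linearly
  independent (the Jacobian criterion for a nonsingular point of codimension \<open>r\<close>).\<close>

definition smooth_algebraic_at :: "nat \<Rightarrow> 'a::euclidean_space set \<Rightarrow> 'a \<Rightarrow> bool" where
  "smooth_algebraic_at r S a \<longleftrightarrow>
     (\<exists>U f g. open U \<and> a \<in> U
        \<and> (\<forall>i<r. real_polynomial_function (f i))
        \<and> S \<inter> U = {x \<in> U. \<forall>i<r. f i x = 0}
        \<and> (\<forall>i<r. GDERIV (f i) a :> g i)
        \<and> inj_on g {..<r} \<and> independent (g ` {..<r}))"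

text \<open>The notion is local: \<open>S\<close> need not be closed. The codimension is the same at all points.\<close>

definition smooth_real_algebraic_variety :: "'a::euclidean_space set \<Rightarrow> bool" where
  "smooth_real_algebraic_variety S \<longleftrightarrow> (\<exists>r. \<forall>a\<in>S. smooth_algebraic_at r S a)"

end

theory Submission
  imports Defs "HOL-Computational_Algebra.Fundamental_Theorem_Algebra"
begin

text \<open>Write the roots of a hyperbolic polynomial \<open>P\<close> of degree \<open>n\<close> in increasing order as
\<open>x 0 \<le> \<dots> \<le> x (n - 1)\<close> and those of its \<open>k\<close>-th derivative as \<open>\<xi> 0 \<le> \<dots> \<le> \<xi> (n - k - 1)\<close>.
Everything rests on one property of the \<open>\<xi> j\<close> as functions of \<open>x\<close>: they are topical, that is,
\<open>x' \<le> x + c\<close> (in every coordinate) implies \<open>\<xi> j x' \<le> \<xi> j x + c\<close>, and they are strictly so, since equality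
forces \<open>x' = x + c\<close> unless \<open>\<xi> j\<close> sits at a root of \<open>P\<close> of multiplicity greater than \<open>k\<close>
(\<open>deriv_root_topical\<close>).  For the first derivative this is a termwise comparison of logarithmic
derivatives, and higher derivatives follow by iteration.

\<^emph>\<open>Contractibility.\<close>  A configuration vector amounts to the list of all comparisons between the \<open>x i\<close>
and the \<open>\<xi> j\<close>.  Call \<open>\<xi> j\<close> a node if it does not sit at a root of \<open>P\<close> of multiplicity greater than \<open>k\<close>,
and call a root of \<open>P\<close> marked if it equals a node.  The unmarked roots strictly between two consecutive
nodes (the extreme roots of \<open>P\<close> serve as outermost nodes) have barycentric coordinates
\<open>0 < s < s' < \<dots> < 1\<close> with respect to these nodes; the extreme roots are recorded by their values and
the marked roots need no coordinate.  Conversely, for prescribed coordinates the configurations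
\<open>x\<close> are the fixed points of a self-map of a compact convex set.  Brouwer's theorem gives a fixed point,
strict topicality makes it unique (\<open>fixed_le\<close>), and every fixed point has the
prescribed pattern (\<open>fixed_imp_same_pattern\<close>): a value shared by roots or nodes that are distinct in
a given member of the stratum would contradict the strict inequalities between the coordinates or Rolle's
inequalities for that member.  So the stratum is homeomorphic to the convex set of admissible coordinates
(\<open>stratum_homeomorphism\<close>), which is open in a coordinate space of dimension \<open>m\<close>, the number of distinct
unmarked roots.

\<^emph>\<open>Smoothness.\<close>  By invariance of domain it suffices to find \<open>n - m\<close> polynomials that vanish on the
stratum and have independent gradients at the given point, that is, to show that the vectors orthogonal to
all gradients of polynomials vanishing on the stratum form a space of dimension at most \<open>m\<close>
(\<open>smooth_algebraic_at_tangent_space\<close>).  Such a tangent vector acts as a derivation on those functions on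
the stratum that are quotients of polynomials with denominator nonzero at the point.  Let \<open>H\<close> be the
product of the distinct linear factors of \<open>P\<close>, let \<open>E\<close> be the product of those that do not divide the
\<open>k\<close>-th derivative \<open>D\<close> of \<open>P\<close>, and let \<open>W\<close> and \<open>C\<close> be determined by \<open>P' H = P W\<close> and \<open>D E = H C\<close>.  The
coefficients of \<open>H\<close>, \<open>W\<close>, \<open>E\<close>, \<open>C\<close> are such functions, because they are the unique solutions of linear systems
(\<open>syzygy_regular\<close>).  Differentiating the two identities shows that a tangent vector is given by velocities of
the distinct roots, and that the velocity of a marked root is a mean of the velocities of all the roots with
positive weights; positivity comes from Laguerre's inequality (\<open>deriv_quotient_sign\<close>).  By the
maximum principle the velocities of the \<open>m\<close> unmarked roots determine all the others
(\<open>tangent_poly_eq_0\<close>).\<close>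

section \<open>Roots of the derivatives of a product of linear factors\<close>

definition root_poly :: "nat \<Rightarrow> (nat \<Rightarrow> real) \<Rightarrow> real poly" where
  "root_poly n x = (\<Prod>i<n. [:- x i, 1:])"

definition sorted_seq :: "nat \<Rightarrow> (nat \<Rightarrow> real) \<Rightarrow> bool" where
  "sorted_seq n x \<longleftrightarrow> (\<forall>i j. i \<le> j \<longrightarrow> j < n \<longrightarrow> x i \<le> x j)"

text \<open>The \<open>j\<close>-th critical point is chosen in the gap between the \<open>j\<close>-th root and the next one, so that
interlacing holds by construction; a gap of length zero contributes the repeated root itself.  That these
points are all the roots of the derivative, with multiplicities, is \<open>pderiv_root_poly\<close>.\<close>

definition crit :: "nat \<Rightarrow> (nat \<Rightarrow> real) \<Rightarrow> nat \<Rightarrow> real" where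
  "crit n x j = (if x j = x (Suc j) then x j
     else SOME z. x j < z \<and> z < x (Suc j) \<and> poly (pderiv (root_poly n x)) z = 0)"

fun deriv_root :: "nat \<Rightarrow> nat \<Rightarrow> (nat \<Rightarrow> real) \<Rightarrow> nat \<Rightarrow> real" where
  "deriv_root 0 n x = x"
| "deriv_root (Suc k) n x = crit (n - k) (deriv_root k n x)"

lemma sorted_seqD: "sorted_seq n x \<Longrightarrow> i \<le> j \<Longrightarrow> j < n \<Longrightarrow> x i \<le> x j"
  by (simp add: sorted_seq_def)

lemma sorted_seqI_Suc:
  assumes "\<And>j. Suc j < n \<Longrightarrow> x j \<le> x (Suc j)"
  shows "sorted_seq n x"
  unfolding sorted_seq_def
proof (intro allI impI)
  fix i j :: nat assume "i \<le> j" "j < n"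
  thus "x i \<le> x j"
    by (induction j rule: dec_induct) (use assms order_trans Suc_lessD in blast)+
qed

lemma root_poly_0 [simp]: "root_poly 0 x = 1"
  and root_poly_Suc: "root_poly (Suc n) x = root_poly n x * [:- x n, 1:]"
  by (simp_all add: root_poly_def)

lemma root_poly_cong: "(\<And>i. i < n \<Longrightarrow> x i = y i) \<Longrightarrow> root_poly n x = root_poly n y"
  by (auto simp: root_poly_def)

lemma poly_root_poly_eq_0_iff: "poly (root_poly n x) z = 0 \<longleftrightarrow> (\<exists>i<n. x i = z)"
  by (auto simp: root_poly_def poly_prod)

lemma root_poly_neq_0 [simp]: "root_poly n x \<noteq> 0"
  by (auto simp: root_poly_def)

lemma degree_root_poly [simp]: "degree (root_poly n x) = n"
  by (simp add: root_poly_def degree_prod_sum_eq)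

lemma lead_coeff_root_poly [simp]: "coeff (root_poly n x) n = 1"
proof -
  have "lead_coeff (root_poly n x) = 1"
    by (simp add: root_poly_def lead_coeff_prod)
  thus ?thesis by simp
qed

lemma order_linear: "order c [:- a, 1:] = (if a = c then 1 else (0::nat))" for a c :: real
  using order_power_n_n[of c 1] by (auto intro: order_0I)

lemma card_less_Suc_split:
  "card {i. i < Suc n \<and> P i} = card {i. i < n \<and> P i} + (if P n then 1 else 0)"
proof -
  have "{i. i < Suc n \<and> P i} = {i. i < n \<and> P i} \<union> (if P n then {n} else {})"
    by (auto simp: less_Suc_eq)
  thus ?thesis by (simp add: card_Un_disjoint)
qed

lemma order_root_poly: "order c (root_poly n x) = card {i. i < n \<and> x i = c}"
proof (induction n)
  case (Suc n)
  have "order c (root_poly (Suc n) x) = order c (root_poly n x) + order c [:- x n, 1:]"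
    unfolding root_poly_Suc by (rule order_mult) (simp del: mult_pCons_right)
  thus ?case using Suc by (simp only: order_linear card_less_Suc_split)
qed (auto simp: order_0I)

text \<open>The linear factors are split off one at a time; multiplicities keep track of what is left.\<close>

lemma root_poly_dvdI:
  assumes "q \<noteq> 0" "\<And>c. card {j. j < n \<and> y j = c} \<le> order c q"
  shows "root_poly n y dvd q"
  using assms
proof (induction n arbitrary: q)
  case (Suc n)
  have "1 \<le> order (y n) q"
    using Suc.prems(2)[of "y n"] by (simp add: card_less_Suc_split)
  hence "[:- y n, 1:] dvd q" 
    by (metis order_root poly_eq_0_iff_dvd not_one_le_zero)
  then obtain q' where q': "q = [:- y n, 1:] * q'" by (auto elim: dvdE)
  have "q' \<noteq> 0" using Suc.prems(1) q' by auto
  moreover have "card {j. j < n \<and> y j = c} \<le> order c q'" for c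
  proof -
    have "order c q = order c [:- y n, 1:] + order c q'"
      unfolding q' by (rule order_mult) (use Suc.prems(1) q' in auto)
    thus ?thesis using Suc.prems(2)[of c]
      by (simp only: card_less_Suc_split order_linear)
  qed
  ultimately have "root_poly n y dvd q'" by (rule Suc.IH)
  hence "[:- y n, 1:] * root_poly n y dvd [:- y n, 1:] * q'" by (rule mult_dvd_mono[OF dvd_refl])
  thus ?case by (simp only: q' root_poly_Suc mult.commute)
qed simp

lemma crit_in:
  assumes "x j < x (Suc j)" "Suc j < n"
  shows "x j < crit n x j" "crit n x j < x (Suc j)" "poly (pderiv (root_poly n x)) (crit n x j) = 0"
proof -
  obtain z where "z > x j" "z < x (Suc j)"
     "poly (root_poly n x) (x (Suc j)) - poly (root_poly n x) (x j) =
        (x (Suc j) - x j) * poly (pderiv (root_poly n x)) z"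
    using poly_MVT[OF assms(1)] by blast
  moreover have "poly (root_poly n x) (x (Suc j)) = 0" "poly (root_poly n x) (x j) = 0"
    unfolding poly_root_poly_eq_0_iff using assms(2) Suc_lessD by blast+
  ultimately have "\<exists>z. x j < z \<and> z < x (Suc j) \<and> poly (pderiv (root_poly n x)) z = 0"
    using assms(1) by auto
  from someI_ex[OF this] assms(1)
  show "x j < crit n x j" "crit n x j < x (Suc j)" "poly (pderiv (root_poly n x)) (crit n x j) = 0"
    by (auto simp: crit_def)
qed

lemma crit_eq: "x j = x (Suc j) \<Longrightarrow> crit n x j = x j"
  by (simp add: crit_def)

lemma crit_bounds:
  assumes "sorted_seq n x" "Suc j < n"
  shows "x j \<le> crit n x j" "crit n x j \<le> x (Suc j)"
proof -
  have "x j \<le> x (Suc j)" using assms by (simp add: sorted_seqD)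
  thus "x j \<le> crit n x j" "crit n x j \<le> x (Suc j)"
    using crit_in[of x j n] crit_eq[of x j n] assms(2) by (cases "x j = x (Suc j)"; force)+
qed

lemma sorted_crit: "sorted_seq n x \<Longrightarrow> sorted_seq (n - 1) (crit n x)"
proof (rule sorted_seqI_Suc)
  fix j assume s: "sorted_seq n x" and "Suc j < n - 1"
  hence j: "Suc j < n" "Suc (Suc j) < n" by auto
  show "crit n x j \<le> crit n x (Suc j)"
    using crit_bounds(2)[OF s j(1)] crit_bounds(1)[OF s j(2)] by simp
qed

lemma poly_pderiv_root_poly:
  assumes "\<And>i. i < n \<Longrightarrow> x i \<noteq> z"
  shows "poly (pderiv (root_poly n x)) z = poly (root_poly n x) z * (\<Sum>i<n. 1 / (z - x i))"
  using assms
proof (induction n)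
  case (Suc n)
  have "z - x n \<noteq> 0" using Suc.prems by auto
  thus ?case using Suc
    by (simp add: root_poly_Suc pderiv_mult pderiv_pCons field_simps del: mult_pCons_right)
qed simp

text \<open>No value occurs more often among the critical points than its multiplicity in the derivative allows: a
root of multiplicity \<open>m\<close> fills \<open>m - 1\<close> gaps of length zero, and any other value lies inside a single gap.
So the product over the critical points divides the derivative, and degrees leave only a constant.\<close>

lemma pderiv_root_poly:
  assumes "sorted_seq n x" "n > 0"
  shows "pderiv (root_poly n x) = smult (real n) (root_poly (n - 1) (crit n x))"
proof -
  let ?p = "root_poly n x" and ?y = "crit n x"
  have nz: "pderiv ?p \<noteq> 0" using assms(2) by (simp add: pderiv_eq_0_iff)
  have "card {j. j < n - 1 \<and> ?y j = c} \<le> order c (pderiv ?p)" for c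
  proof (cases "\<exists>i<n. x i = c")
    case True
    let ?I = "{i. i < n \<and> x i = c}"
    have "order c ?p = Suc (order c (pderiv ?p))"
      by (rule order_pderiv) (use True in \<open>auto simp: poly_root_poly_eq_0_iff\<close>)
    hence ord: "order c (pderiv ?p) = card ?I - 1" by (simp add: order_root_poly)
    have both: "x j = c \<and> x (Suc j) = c" if "j < n - 1" "?y j = c" for j
    proof (rule ccontr)
      assume neg: "\<not> ?thesis"
      have j: "Suc j < n" using that by simp
      have "x j \<noteq> x (Suc j)" using crit_eq[of x j n] that neg by auto
      moreover have "x j \<le> x (Suc j)" using assms(1) j by (simp add: sorted_seqD)
      ultimately have lt: "x j < c" "c < x (Suc j)" using crit_in[of x j n] j that by auto
      obtain i where i: "i < n" "x i = c" using True by auto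
      show False
      proof (cases "i \<le> j")
        case True thus False using sorted_seqD[OF assms(1), of i j] lt i j by simp
      next
        case False thus False using sorted_seqD[OF assms(1), of "Suc j" i] lt i j by simp
      qed
    qed
    \<comment> \<open>A gap of length zero at \<open>c\<close> is counted by its right end, which is never the first copy of \<open>c\<close>.\<close>
    have "Suc ` {j. j < n - 1 \<and> ?y j = c} \<subseteq> ?I - {Min ?I}"
    proof safe
      fix j assume j: "j < n - 1" "c = ?y j"
      show "Suc j < n" using j by simp
      show "x (Suc j) = ?y j" using both[of j] j by simp
      have "Min {i. i < n \<and> x i = ?y j} \<le> j" using both[of j] j by (intro Min_le) auto
      thus "Suc j = Min {i. i < n \<and> x i = ?y j} \<Longrightarrow> False" by simp
    qed
    hence "card (Suc ` {j. j < n - 1 \<and> ?y j = c}) \<le> card (?I - {Min ?I})"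
      by (intro card_mono) auto
    also have "\<dots> = card ?I - 1" using True by (intro card_Diff_singleton Min_in) auto
    finally show ?thesis by (simp add: ord card_image)
  next
    case False
    have ne: "x i \<noteq> c" if "i < n" for i using False that by auto
    show ?thesis
    proof (cases "\<exists>j<n-1. ?y j = c")
      case True
      then obtain j where j: "j < n - 1" "?y j = c" by auto
      have lt: "x j < c \<and> c < x (Suc j)" if "j < n - 1" "?y j = c" for j
      proof -
        have "Suc j < n" using that by simp
        thus ?thesis using crit_bounds[OF assms(1), of j] that ne[of j] ne[of "Suc j"] by force
      qed
      have "poly (pderiv ?p) c = 0"
        using crit_in(3)[of x j n] lt[OF j] j by auto
      hence "order c (pderiv ?p) \<ge> 1" using nz order_root[of "pderiv ?p" c] by auto
      moreover have "{j. j < n - 1 \<and> ?y j = c} \<subseteq> {j}"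
      proof safe
        fix i assume i: "i < n - 1" "c = ?y i"
        have "\<not> i < j" "\<not> j < i"
          using lt[OF j] lt[of i] i sorted_seqD[OF assms(1), of "Suc i" j]
             sorted_seqD[OF assms(1), of "Suc j" i] j by (fastforce simp: Suc_le_eq)+
        thus "i = j" by simp
      qed
      hence "card {j. j < n - 1 \<and> ?y j = c} \<le> 1" using card_mono[of "{j}"] by force
      ultimately show ?thesis by simp
    next
      case False
      hence "{j. j < n - 1 \<and> ?y j = c} = {}" by auto
      thus ?thesis by (simp only: card.empty)
    qed
  qed
  from root_poly_dvdI[OF nz this] obtain r where r: "pderiv ?p = root_poly (n - 1) ?y * r" 
    by (auto elim: dvdE)
  have deg: "degree (pderiv ?p) = n - 1" by (simp add: degree_pderiv)
  have "r \<noteq> 0" using nz r by auto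
  hence "degree r = 0" using deg unfolding r by (simp add: degree_mult_eq)
  then obtain c where c: "r = [:c:]" by (auto elim: degree_eq_zeroE)
  have "coeff (pderiv ?p) (n - 1) = real n"
    using assms(2) by (simp add: coeff_pderiv)
  hence "c = real n" unfolding r c by simp
  thus ?thesis unfolding r c by simp
qed

text \<open>At a critical point \<open>z\<close> inside a proper gap the sum of the \<open>1 / (z - x i)\<close> vanishes.  If \<open>z'\<close> is at least
\<open>z + c\<close>, then each \<open>z' - x' i\<close> is at least \<open>z - x i\<close> and has the same sign, so the vanishing sum for \<open>x'\<close> is
termwise at most the vanishing sum for \<open>x\<close>, and all differences agree.\<close>

lemma crit_topical:
  assumes "sorted_seq n x" "sorted_seq n x'" "\<And>i. i < n \<Longrightarrow> x' i \<le> x i + c" "Suc j < n"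
  shows "crit n x' j \<le> crit n x j + c"
    and "crit n x' j = crit n x j + c \<Longrightarrow> x j = x (Suc j) \<or> (\<forall>i<n. x' i = x i + c)"
proof -
  let ?z = "crit n x j" and ?z' = "crit n x' j"
  have "?z' < ?z + c \<or> (?z' \<le> ?z + c \<and> x j = x (Suc j)) \<or> (?z' = ?z + c \<and> (\<forall>i<n. x' i = x i + c))"
  proof (cases "x j = x (Suc j)")
    case True
    have "?z' \<le> x' (Suc j)" using crit_bounds assms by blast
    thus ?thesis using assms(3)[of "Suc j"] assms(4) crit_eq[of x j n] True by auto
  next
    case False
    hence lt: "x j < x (Suc j)" using sorted_seqD[OF assms(1), of j "Suc j"] assms(4) by simp
    note z = crit_in[OF lt assms(4)]
    show ?thesis
    proof (cases "x' j = x' (Suc j)")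
      case True
      thus ?thesis using z(1) assms(3)[of j] assms(4) crit_eq[of x' j n] by auto
    next
      case False
      hence lt': "x' j < x' (Suc j)" using sorted_seqD[OF assms(2), of j "Suc j"] assms(4) by simp
      note z' = crit_in[OF lt' assms(4)]
      have ne: "x i < ?z \<and> i \<le> j \<or> ?z < x i \<and> \<not> i \<le> j" "x' i < ?z' \<and> i \<le> j \<or> ?z' < x' i \<and> \<not> i \<le> j" if "i < n" for i
        using sorted_seqD[OF assms(1), of i j] sorted_seqD[OF assms(1), of "Suc j" i]
          sorted_seqD[OF assms(2), of i j] sorted_seqD[OF assms(2), of "Suc j" i]
          z z' that assms(4) by (cases "i \<le> j"; simp)+
      have sum0: "(\<Sum>i<n. 1 / (?z - x i)) = 0"
      proof -
        have ne': "\<And>i. i < n \<Longrightarrow> x i \<noteq> ?z" using ne(1) by fastforce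
        have "poly (root_poly n x) ?z \<noteq> 0" using ne' by (auto simp: poly_root_poly_eq_0_iff)
        thus ?thesis using poly_pderiv_root_poly[of n x ?z, OF ne'] z(3) by simp
      qed
      have sum0': "(\<Sum>i<n. 1 / (?z' - x' i)) = 0"
      proof -
        have ne': "\<And>i. i < n \<Longrightarrow> x' i \<noteq> ?z'" using ne(2) by fastforce
        have "poly (root_poly n x') ?z' \<noteq> 0" using ne' by (auto simp: poly_root_poly_eq_0_iff)
        thus ?thesis using poly_pderiv_root_poly[of n x' ?z', OF ne'] z'(3) by simp
      qed
      show ?thesis
      proof (cases "?z' < ?z + c")
        case False
        have le: "?z - x i \<le> ?z' - x' i" if "i < n" for i
          using assms(3)[OF that] False by simp
        have inv: "1 / (?z' - x' i) \<le> 1 / (?z - x i)" if "i < n" for i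
        proof (cases "i \<le> j")
          case True
          thus ?thesis using le[OF that] ne[OF that] by (intro divide_left_mono mult_pos_pos) auto
        next
          case False
          thus ?thesis using le[OF that] ne[OF that] by (intro divide_left_mono mult_neg_neg) auto
        qed
        have "1 / (?z' - x' i) = 1 / (?z - x i)" if "i < n" for i
        proof (rule ccontr)
          assume "1 / (?z' - x' i) \<noteq> 1 / (?z - x i)"
          with inv[OF that] have "1 / (?z' - x' i) < 1 / (?z - x i)" by (rule order_le_neq_trans)
          hence "(\<Sum>i<n. 1 / (?z' - x' i)) < (\<Sum>i<n. 1 / (?z - x i))"
            using inv that by (intro sum_strict_mono_ex1) auto
          thus False using sum0 sum0' by simp
        qed
        hence eq: "?z' - x' i = ?z - x i" if "i < n" for i
          using that by (metis div_by_1 divide_divide_eq_right mult_1)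
        have "?z' = ?z + c" using eq[of j] assms(3)[of j] assms(4) False by simp
        moreover have "x' i = x i + c" if "i < n" for i
          using eq[OF that] \<open>?z' = ?z + c\<close> by simp
        ultimately show ?thesis by blast
      qed simp
    qed
  qed
  thus "?z' \<le> ?z + c" "?z' = ?z + c \<Longrightarrow> x j = x (Suc j) \<or> (\<forall>i<n. x' i = x i + c)" by auto
qed

lemma sorted_deriv_root: "sorted_seq n x \<Longrightarrow> sorted_seq (n - k) (deriv_root k n x)"
proof (induction k)
  case (Suc k)
  thus ?case using sorted_crit[of "n - k" "deriv_root k n x"] by simp
qed simp

lemma deriv_root_mono: "sorted_seq n x \<Longrightarrow> i \<le> j \<Longrightarrow> j < n - k \<Longrightarrow> deriv_root k n x i \<le> deriv_root k n x j"
  using sorted_deriv_root sorted_seqD by blast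

lemma deriv_root_bounds:
  assumes "sorted_seq n x" "j < n - k"
  shows "x j \<le> deriv_root k n x j" "deriv_root k n x j \<le> x (j + k)"
proof -
  have "x j \<le> deriv_root k n x j \<and> deriv_root k n x j \<le> x (j + k)"
    using assms(2)
  proof (induction k arbitrary: j)
    case (Suc k)
    have j: "Suc j < n - k" "j < n - k" using Suc.prems by auto
    note b = crit_bounds[OF sorted_deriv_root[OF assms(1)] j(1)]
    thus ?case using Suc.IH[OF j(1)] Suc.IH[OF j(2)] by simp
  qed simp
  thus "x j \<le> deriv_root k n x j" "deriv_root k n x j \<le> x (j + k)" by auto
qed

lemma pderiv_pow_root_poly:
  assumes "sorted_seq n x" "k \<le> n"
  shows "(pderiv ^^ k) (root_poly n x) = smult (\<Prod>i<k. real (n - i)) (root_poly (n - k) (deriv_root k n x))"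
  using assms(2)
proof (induction k)
  case (Suc k)
  have "pderiv (root_poly (n - k) (deriv_root k n x)) =
     smult (real (n - k)) (root_poly (n - k - 1) (crit (n - k) (deriv_root k n x)))"
    by (rule pderiv_root_poly) (use Suc.prems sorted_deriv_root[OF assms(1)] in auto)
  thus ?case using Suc by (simp add: pderiv_smult mult.commute)
qed simp

text \<open>Critical points in a proper gap are strictly inside it, so two neighbouring critical points coincide only at
a triple root.  By iteration a double root of the \<open>k\<close>-th derivative is a root of multiplicity \<open>k + 2\<close>.\<close>

lemma deriv_root_double:
  assumes "sorted_seq n x" "Suc j < n - k" "deriv_root k n x j = deriv_root k n x (Suc j)"
  shows "x j = x (j + k + 1)"
  using assms(2,3)
proof (induction k arbitrary: j)
  case (Suc k)
  let ?w = "deriv_root k n x"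
  have j: "Suc j < n - k" "Suc (Suc j) < n - k" using Suc.prems by auto
  note s = sorted_deriv_root[OF assms(1), of k]
  have "crit (n - k) ?w j \<le> ?w (Suc j)" "?w (Suc j) \<le> crit (n - k) ?w (Suc j)"
    using crit_bounds s j by blast+
  hence e: "crit (n - k) ?w j = ?w (Suc j)" "crit (n - k) ?w (Suc j) = ?w (Suc j)"
    using Suc.prems by auto
  have "?w j = ?w (Suc j)"
    using crit_in[of ?w j "n - k"] e j sorted_seqD[OF s, of j "Suc j"] by fastforce
  moreover have "?w (Suc j) = ?w (Suc (Suc j))"
    using crit_in[of ?w "Suc j" "n - k"] e j sorted_seqD[OF s, of "Suc j" "Suc (Suc j)"] by fastforce
  ultimately have "x j = x (j + k + 1)" "x (Suc j) = x (Suc j + k + 1)" using Suc.IH j by blast+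
  moreover have "x j \<le> x (Suc j)" "x (Suc j) \<le> x (j + k + 1)"
    using assms(1) Suc.prems by (auto intro!: sorted_seqD)
  ultimately show ?case by simp
qed simp

text \<open>Together with its mirror image \<open>deriv_root_eq_right\<close> this is the strict form of Rolle's inequalities
\<open>deriv_root_bounds\<close>.\<close>

lemma deriv_root_eq_left:
  assumes "sorted_seq n x" "j < n - k" "deriv_root k n x j = x j"
  shows "x j = x (j + k)"
proof (cases k)
  case (Suc l)
  let ?w = "deriv_root l n x"
  have j: "Suc j < n - l" "j < n - l" using assms(2) Suc by auto
  have s: "sorted_seq (n - l) ?w" using sorted_deriv_root assms by blast
  have "x j \<le> ?w j" "?w j \<le> crit (n - l) ?w j" using deriv_root_bounds[OF assms(1) j(2)] crit_bounds[OF s j(1)] by auto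
  hence "?w j = crit (n - l) ?w j" using assms(3) Suc by simp
  hence "?w j = ?w (Suc j)" using crit_in[of ?w j "n - l"] j sorted_seqD[OF s, of j "Suc j"] by fastforce
  thus ?thesis using deriv_root_double[OF assms(1) j(1)] Suc by simp
qed simp

lemma deriv_root_eq_right:
  assumes "sorted_seq n x" "j < n - k" "deriv_root k n x j = x (j + k)"
  shows "x j = x (j + k)"
proof (cases k)
  case (Suc l)
  let ?w = "deriv_root l n x"
  have j: "Suc j < n - l" "j < n - l" using assms(2) Suc by auto
  have s: "sorted_seq (n - l) ?w" using sorted_deriv_root assms by blast
  have "?w (Suc j) \<le> x (Suc j + l)" "crit (n - l) ?w j \<le> ?w (Suc j)"
    using deriv_root_bounds(2)[OF assms(1) j(1)] crit_bounds[OF s j(1)] by auto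
  hence "?w (Suc j) = crit (n - l) ?w j" using assms(3) Suc by simp
  hence "?w j = ?w (Suc j)" using crit_in[of ?w j "n - l"] j sorted_seqD[OF s, of j "Suc j"] by fastforce
  thus ?thesis using deriv_root_double[OF assms(1) j(1)] Suc by simp
qed simp

text \<open>Iterates \<open>crit_topical\<close>.  Equality in the last step either spreads to all roots of the previous derivative,
where the induction hypothesis applies at two neighbouring indices, or merges two of them, which
\<open>deriv_root_double\<close> turns into an equality between roots of the original polynomial.\<close>

lemma deriv_root_topical:
  assumes "sorted_seq n x" "sorted_seq n x'" "\<And>i. i < n \<Longrightarrow> x' i \<le> x i + c" "j < n - k"
  shows "deriv_root k n x' j \<le> deriv_root k n x j + c"
    and "k > 0 \<Longrightarrow> deriv_root k n x' j = deriv_root k n x j + c \<Longrightarrow> x j = x (j + k) \<or> (\<forall>i<n. x' i = x i + c)"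
proof -
  have "deriv_root k n x' j \<le> deriv_root k n x j + c \<and> (k > 0 \<longrightarrow> deriv_root k n x' j = deriv_root k n x j + c
    \<longrightarrow> x j = x (j + k) \<or> (\<forall>i<n. x' i = x i + c))"
    using assms(4)
  proof (induction k arbitrary: j)
    case (Suc k)
    let ?w = "deriv_root k n x" and ?w' = "deriv_root k n x'"
    have j: "Suc j < n - k" using Suc.prems by auto
    note s = sorted_deriv_root[OF assms(1), of k] sorted_deriv_root[OF assms(2), of k]
    note t = crit_topical[OF s conjunct1[OF Suc.IH] j]
    have "x j = x (j + Suc k) \<or> (\<forall>i<n. x' i = x i + c)"
      if "deriv_root (Suc k) n x' j = deriv_root (Suc k) n x j + c"
    proof -
      have "?w j = ?w (Suc j) \<or> (\<forall>i<n-k. ?w' i = ?w i + c)" using t(2) that by simp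
      thus ?thesis
      proof
        assume "?w j = ?w (Suc j)"
        thus ?thesis using deriv_root_double[OF assms(1) j] by simp
      next
        assume *: "\<forall>i<n-k. ?w' i = ?w i + c"
        show ?thesis
        proof (cases "k = 0")
          case True thus ?thesis using * by simp
        next
          case False
          have "x j = x (j + k) \<or> (\<forall>i<n. x' i = x i + c)" "x (Suc j) = x (Suc j + k) \<or> (\<forall>i<n. x' i = x i + c)"
            using Suc.IH[of j] Suc.IH[of "Suc j"] False * j by auto
          moreover have "x j \<le> x (Suc j)" "x (Suc j) \<le> x (j + k)"
            using assms(1) j False by (auto intro!: sorted_seqD)
          ultimately show ?thesis by auto
        qed
      qed
    qed
    thus ?case using t(1) by simp
  qed (use assms in auto)
  thus "deriv_root k n x' j \<le> deriv_root k n x j + c"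
    "k > 0 \<Longrightarrow> deriv_root k n x' j = deriv_root k n x j + c \<Longrightarrow> x j = x (j + k) \<or> (\<forall>i<n. x' i = x i + c)"
    by auto
qed

section \<open>Hyperbolic polynomials and configuration vectors\<close>

lemma root_poly_inj:
  assumes "sorted_seq n x" "sorted_seq n y" "root_poly n x = root_poly n y" "i < n"
  shows "x i = y i"
  using assms
proof (induction n arbitrary: i)
  case (Suc n)
  have roots: "(\<exists>i<Suc n. x i = z) \<longleftrightarrow> (\<exists>i<Suc n. y i = z)" for z
    using Suc.prems(3) poly_root_poly_eq_0_iff by metis
  have "x n \<le> y n" using roots[of "x n"] Suc.prems(2) by (metis lessI less_Suc_eq_le sorted_seqD)
  moreover have "y n \<le> x n" using roots[of "y n"] Suc.prems(1) by (metis lessI less_Suc_eq_le sorted_seqD)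
  ultimately have eq: "x n = y n" by simp
  have "[:- x n, 1:] \<noteq> 0" by simp
  hence "root_poly n x = root_poly n y"
    using Suc.prems(3) unfolding root_poly_Suc eq by (metis mult_right_cancel)
  moreover have "sorted_seq n x" "sorted_seq n y" using Suc.prems by (auto simp: sorted_seq_def)
  ultimately show ?case using Suc.IH[of i] Suc.prems(4) eq by (cases "i = n") auto
qed simp

lemma root_poly_sort:
  obtains y where "sorted_seq n y" "root_poly n y = root_poly n x"
proof -
  define xs where "xs = sort (map x [0..<n])"
  have len: "length xs = n" by (simp add: xs_def)
  have "root_poly n (nth xs) = (\<Prod>a\<leftarrow>xs. [:- a, 1:])"
    using len by (simp add: root_poly_def prod.list_conv_set_nth atLeast0LessThan)
  also have "\<dots> = prod_mset (image_mset (\<lambda>a. [:- a, 1:]) (mset xs))"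
    by (simp flip: prod_mset_prod_list)
  also have "\<dots> = prod_mset (image_mset (\<lambda>a. [:- a, 1:]) (mset (map x [0..<n])))"
    by (simp add: xs_def)
  also have "\<dots> = prod_list (map (\<lambda>a. [:- a, 1:]) (map x [0..<n]))"
    by (simp only: mset_map[symmetric] prod_mset_prod_list)
  also have "\<dots> = root_poly n x"
    by (simp add: root_poly_def prod.list_conv_set_nth atLeast0LessThan)
  finally have "root_poly n (nth xs) = root_poly n x" .
  moreover have "sorted xs" by (simp add: xs_def)
  hence "sorted_seq n (nth xs)" using len by (auto simp: sorted_seq_def sorted_nth_mono)
  ultimately show ?thesis using that by blast
qed

text \<open>A complex root exists by the fundamental theorem of algebra, it is real by hyperbolicity, and its linear
factor can be split off over the reals.\<close>

lemma hyperbolic_splits: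
  assumes "hyperbolic p"
  shows "\<exists>x. p = root_poly (degree p) x"
  using assms
proof (induction "degree p" arbitrary: p)
  case 0
  hence "p = 1" unfolding hyperbolic_def by (metis degree_eq_zeroE lead_coeff_pCons(2) one_pCons)
  thus ?case by simp
next
  case (Suc n)
  let ?c = "map_poly complex_of_real"
  have deg: "degree (?c p) = Suc n" using Suc by (simp add: degree_map_poly)
  have "\<not> constant (poly (?c p))" using deg by (simp add: constant_degree)
  then obtain z where z: "poly (?c p) z = 0" using fundamental_theorem_of_algebra by blast
  hence "z \<in> \<real>" using Suc.prems by (simp add: hyperbolic_def)
  then obtain r where r: "z = of_real r" by (auto elim: Reals_cases)
  have "poly (?c p) (of_real r) = of_real (poly p r)"
    by (induction p) (simp_all add: map_poly_pCons)
  hence "poly p r = 0" using z r by simp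
  then obtain q where q: "p = [:- r, 1:] * q" by (metis dvdE poly_eq_0_iff_dvd)
  have "q \<noteq> 0" using q Suc.hyps(2) by auto
  hence degq: "degree q = n" using Suc.hyps(2) unfolding q by (subst (asm) degree_mult_eq) auto
  have "?c p = ?c [:- r, 1:] * ?c q"
    unfolding q by (intro poly_eqI) (simp add: coeff_map_poly coeff_mult del: mult_pCons_left)
  moreover have "lead_coeff q = 1" using Suc.prems unfolding hyperbolic_def q lead_coeff_mult by simp
  ultimately have "hyperbolic q" using Suc.prems unfolding hyperbolic_def by simp
  then obtain x where x: "q = root_poly n x" using Suc.hyps(1)[of q] degq by auto
  have "p = root_poly (Suc n) (x(n := r))"
    unfolding root_poly_Suc q x using root_poly_cong[of n x "x(n := r)"] 
    by (simp add: mult.commute del: mult_pCons_right mult_pCons_left)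
  thus ?case using Suc.hyps(2) by metis
qed

lemma hyperbolic_root_poly: "hyperbolic (root_poly n x)"
  unfolding hyperbolic_def
proof (intro conjI allI impI)
  show "lead_coeff (root_poly n x) = 1" by simp
  fix z assume "poly (map_poly complex_of_real (root_poly n x)) z = 0"
  moreover have "poly (map_poly complex_of_real (root_poly n x)) z = (\<Prod>i<n. z - of_real (x i))"
  proof (induction n)
    case (Suc n)
    have "map_poly complex_of_real (root_poly (Suc n) x) =
       map_poly complex_of_real (root_poly n x) * map_poly complex_of_real [:- x n, 1:]"
      unfolding root_poly_Suc 
      by (intro poly_eqI) (simp add: coeff_map_poly coeff_mult del: mult_pCons_right)
    thus ?case using Suc by (simp add: map_poly_pCons mult.commute del: mult_pCons_right)
  qed (simp add: map_poly_1)
  ultimately show "z \<in> \<real>" by auto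
qed

lemma hyperbolic_iff:
  assumes "degree p = n"
  shows "hyperbolic p \<longleftrightarrow> (\<exists>x. sorted_seq n x \<and> p = root_poly n x)"
  using hyperbolic_splits hyperbolic_root_poly root_poly_sort assms by metis

text \<open>The roots of \<open>P\<close> and of its \<open>k\<close>-th derivative are put into one sequence of length \<open>2 * n - k\<close>, so that a
single order relation on indices records all comparisons between them.\<close>

definition node :: "nat \<Rightarrow> nat \<Rightarrow> (nat \<Rightarrow> real) \<Rightarrow> nat \<Rightarrow> real" where
  "node k n x p = (if p < n then x p else deriv_root k n x (p - n))"

definition same_pattern :: "nat \<Rightarrow> nat \<Rightarrow> (nat \<Rightarrow> real) \<Rightarrow> (nat \<Rightarrow> real) \<Rightarrow> bool" where
  "same_pattern k n x y \<longleftrightarrow>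
     (\<forall>p<2*n-k. \<forall>q<2*n-k. node k n x p \<le> node k n x q \<longleftrightarrow> node k n y p \<le> node k n y q)"

text \<open>The degree bound excludes that the derivatives vanish identically before the multiplicity is used up.\<close>

lemma order_pderiv_pow:
  fixes p :: "real poly"
  assumes "p \<noteq> 0" "k \<le> order z p"
  shows "order z ((pderiv ^^ k) p) = order z p - k" 
  using assms
proof (induction k)
  case (Suc k)
  have ord: "order z ((pderiv ^^ k) p) = order z p - k" using Suc by simp
  hence "poly ((pderiv ^^ k) p) z = 0" using Suc.prems order_root by (metis Suc_le_lessD not_less_iff_gr_or_eq zero_less_diff)
  show ?case
  proof (cases "(pderiv ^^ k) p = 0")
    case True
    have "[:- z, 1:] ^ order z p dvd p" by (rule order_1)
    hence "order z p \<le> degree p" using Suc.prems(1) by (metis dvd_imp_degree_le degree_linear_power)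
    hence "k \<le> degree p" using Suc.prems by simp
    have "degree ((pderiv ^^ k) p) = degree p - k" "(pderiv ^^ k) p \<noteq> 0" if "k \<le> degree p" for k
      using that Suc.prems(1)
    proof (induction k)
      case (Suc k)
      { case 1 thus ?case using Suc by (subst funpow.simps) (simp only: o_def degree_pderiv, simp) }
      { case 2 thus ?case using Suc by (simp add: pderiv_eq_0_iff) }
    qed auto
    thus ?thesis using True \<open>k \<le> degree p\<close> by simp
  next
    case False
    thus ?thesis using order_pderiv[OF False \<open>poly ((pderiv ^^ k) p) z = 0\<close>] ord by simp
  qed
qed simp

text \<open>The multiplicity in the \<open>k\<close>-th derivative of the point that an entry stands for.  For a root of
multiplicity \<open>m < k\<close> that is not marked the truncated difference \<open>m - k\<close> is the correct value 0.\<close>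

fun cv_deriv_int :: "nat \<Rightarrow> cv_entry \<Rightarrow> nat" where
  "cv_deriv_int k (Root m) = m - k"
| "cv_deriv_int k (Marked_Root m) = 1"
| "cv_deriv_int k Deriv_Root = 1"

lemma le_iff_less_card:
  assumes "sorted_seq N w" "i < N"
  shows "w i \<le> c \<longleftrightarrow> i < card {l. l < N \<and> w l \<le> c}"
proof
  assume "w i \<le> c"
  hence "{..i} \<subseteq> {l. l < N \<and> w l \<le> c}" using assms sorted_seqD by (fastforce intro: order_trans)
  from card_mono[OF _ this] show "i < card {l. l < N \<and> w l \<le> c}" by simp
next
  assume "i < card {l. l < N \<and> w l \<le> c}"
  moreover have "card {l. l < N \<and> w l \<le> c} \<le> card {..<i}" if "\<not> w i \<le> c"
  proof (rule card_mono)
    show "{l. l < N \<and> w l \<le> c} \<subseteq> {..<i}"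
      using that sorted_seqD[OF assms(1)] by (force simp: not_le[symmetric])
  qed simp
  ultimately show "w i \<le> c" by force
qed

lemma card_le_eq_sum:
  fixes L :: "real list" and w :: "nat \<Rightarrow> real"
  assumes "sorted L" "distinct L" "\<And>l. l < N \<Longrightarrow> w l \<in> set L" "e < length L"
  shows "card {l. l < N \<and> w l \<le> L ! e} = (\<Sum>e'\<le>e. card {l. l < N \<and> w l = L ! e'})"
proof -
  have "{l. l < N \<and> w l \<le> L ! e} = (\<Union>e'\<in>{..e}. {l. l < N \<and> w l = L ! e'})"
  proof safe
    fix l assume l: "l < N" "w l \<le> L ! e"
    then obtain e' where e': "e' < length L" "L ! e' = w l" using assms(3) by (metis in_set_conv_nth)
    have "e' \<le> e"
    proof (rule ccontr)
      assume "\<not> e' \<le> e"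
      hence "L ! e \<le> L ! e'" "L ! e \<noteq> L ! e'"
        using assms(1,2,4) e'(1) by (auto simp: sorted_nth_mono nth_eq_iff_index_eq simp del: e'(2))
      thus False using l e' by simp
    qed
    thus "l \<in> (\<Union>e'\<in>{..e}. {l. l < N \<and> w l = L ! e'})" using e' l by (auto intro!: bexI[of _ e'])
  next
    fix l e' assume "e' \<le> e" "w l = L ! e'"
    thus "w l \<le> L ! e" using assms by (simp add: sorted_nth_mono)
  qed
  also have "card \<dots> = (\<Sum>e'\<le>e. card {l. l < N \<and> w l = L ! e'})"
  proof (intro card_UN_disjoint ballI impI)
    fix a b assume "a \<in> {..e}" "b \<in> {..e}" "a \<noteq> b"
    thus "{l. l < N \<and> w l = L ! a} \<inter> {l. l < N \<and> w l = L ! b} = {}"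
      using assms(2,4) by (auto simp: nth_eq_iff_index_eq)
  qed auto
  finally show ?thesis .
qed

text \<open>A configuration of roots, viewed as the base point of its stratum.\<close>

locale sorted_roots =
  fixes n k :: nat and x :: "nat \<Rightarrow> real"
  assumes sorted: "sorted_seq n x" and k: "0 < k" "k < n"
begin

abbreviation "\<xi> \<equiv> deriv_root k n x"
abbreviation "P \<equiv> root_poly n x"
abbreviation "Pk \<equiv> (pderiv ^^ k) P"

lemma Pk_eq: obtains c where "c \<noteq> 0" "Pk = smult c (root_poly (n - k) \<xi>)"
proof
  show "(\<Prod>i<k. real (n - i)) \<noteq> 0" using k by auto
  show "Pk = smult (\<Prod>i<k. real (n - i)) (root_poly (n - k) \<xi>)"
    using pderiv_pow_root_poly[OF sorted, of k] k by simp
qed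

lemma Pk_neq_0: "Pk \<noteq> 0"
  using Pk_eq by (metis root_poly_neq_0 smult_eq_0_iff)

lemma poly_Pk_eq_0_iff: "poly Pk z = 0 \<longleftrightarrow> (\<exists>j<n-k. \<xi> j = z)"
proof -
  obtain c where "c \<noteq> 0" "Pk = smult c (root_poly (n - k) \<xi>)" by (rule Pk_eq)
  thus ?thesis by (simp only: poly_smult mult_eq_0_iff poly_root_poly_eq_0_iff simp_thms)
qed

lemma order_Pk: "order z Pk = card {j. j < n - k \<and> \<xi> j = z}"
proof -
  obtain c where "c \<noteq> 0" "Pk = smult c (root_poly (n - k) \<xi>)" by (rule Pk_eq)
  thus ?thesis by (simp add: order_smult order_root_poly)
qed

lemma order_Pk_le_1:
  assumes "order z P \<le> k"
  shows "order z Pk \<le> 1"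
proof (rule ccontr)
  assume "\<not> order z Pk \<le> 1"
  hence "1 < card {j. j < n - k \<and> \<xi> j = z}" by (simp add: order_Pk)
  then obtain a b where ab: "a < n - k" "b < n - k" "\<xi> a = z" "\<xi> b = z" "a \<noteq> b"
    using card_le_Suc0_iff_eq[of "{j. j < n - k \<and> \<xi> j = z}"] by fastforce
  define i where "i = min a b"
  have i: "Suc i < n - k" "\<xi> i = z" using ab by (auto simp: i_def min_def)
  have "\<xi> i \<le> \<xi> (Suc i)" using i by (intro deriv_root_mono[OF sorted]) auto
  moreover have "\<xi> (Suc i) \<le> \<xi> (max a b)" using ab by (intro deriv_root_mono[OF sorted]) (auto simp: i_def)
  moreover have "\<xi> (max a b) = z" using ab by (auto simp: max_def)
  ultimately have "\<xi> i = \<xi> (Suc i)" using i by simp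
  hence eq: "x i = x (i + k + 1)" using deriv_root_double sorted i by blast
  have "x i \<le> \<xi> i" "\<xi> i \<le> x (i + k)" "x (i + k) \<le> x (i + k + 1)"
    using deriv_root_bounds[OF sorted, of i k] sorted_seqD[OF sorted] i by auto
  hence xi: "x i = z" using eq i by simp
  have "x l = z" if "i \<le> l" "l \<le> i + k + 1" for l
    using sorted_seqD[OF sorted, of i l] sorted_seqD[OF sorted, of l "i+k+1"] that i(1) eq xi by linarith
  hence "{i..i+k+1} \<subseteq> {l. l < n \<and> x l = z}" using i by auto
  hence "card {i..i+k+1} \<le> order z P" unfolding order_root_poly by (intro card_mono) auto
  thus False using assms by simp
qed

lemma points_eq: "{z. poly P z = 0 \<or> poly Pk z = 0} = node k n x ` {..<2*n-k}"
proof -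
  have "(\<exists>p<2*n-k. node k n x p = z) \<longleftrightarrow> (\<exists>i<n. x i = z) \<or> (\<exists>j<n-k. \<xi> j = z)" for z
  proof
    assume "(\<exists>i<n. x i = z) \<or> (\<exists>j<n-k. \<xi> j = z)"
    thus "\<exists>p<2*n-k. node k n x p = z"
    proof (elim disjE exE conjE)
      fix i assume "i < n" "x i = z"
      thus ?thesis using k by (intro exI[of _ i]) (simp add: node_def)
    next
      fix j assume "j < n - k" "\<xi> j = z"
      thus ?thesis using k by (intro exI[of _ "n + j"]) (simp add: node_def)
    qed
  next
    assume "\<exists>p<2*n-k. node k n x p = z"
    then obtain p where p: "p < 2*n-k" "node k n x p = z" by blast
    show "(\<exists>i<n. x i = z) \<or> (\<exists>j<n-k. \<xi> j = z)"
    proof (cases "p < n")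
      case False
      hence "p - n < n - k" using p(1) by simp
      thus ?thesis using p False by (auto simp: node_def)
    qed (use p in \<open>auto simp: node_def\<close>)
  qed
  moreover have "node k n x ` {..<2*n-k} = {z. \<exists>p<2*n-k. node k n x p = z}" by auto
  ultimately show ?thesis by (simp only: poly_root_poly_eq_0_iff poly_Pk_eq_0_iff)
qed

lemma cv_entry_counts:
  assumes "poly P z = 0 \<or> poly Pk z = 0"
  shows "cv_int (cv_entry_at k P z) = card {i. i < n \<and> x i = z}"
    and "cv_deriv_int k (cv_entry_at k P z) = card {j. j < n - k \<and> \<xi> j = z}"
proof -
  have o: "order z P = 0 \<longleftrightarrow> poly P z \<noteq> 0" "order z Pk = 0 \<longleftrightarrow> poly Pk z \<noteq> 0"
    using order_root[of P z] order_root[of Pk z] Pk_neq_0 by auto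
  show "cv_int (cv_entry_at k P z) = card {i. i < n \<and> x i = z}"
    unfolding order_root_poly[symmetric] using o by (auto simp: cv_entry_at_def)
  have "cv_deriv_int k (cv_entry_at k P z) = order z Pk"
  proof (cases "k \<le> order z P")
    case True
    thus ?thesis using o k order_pderiv_pow[of P k z] by (auto simp: cv_entry_at_def)
  next
    case False
    thus ?thesis using o order_Pk_le_1[of z] assms by (auto simp: cv_entry_at_def)
  qed
  thus "cv_deriv_int k (cv_entry_at k P z) = card {j. j < n - k \<and> \<xi> j = z}"
    by (simp add: order_Pk)
qed

text \<open>A root is at most the \<open>e\<close>-th listed point exactly if its index is less than the number of roots up to that
point, and this number is a partial sum of multiplicities that the configuration vector displays.\<close>

lemma node_le_iff:
  fixes L defines "L \<equiv> sorted_list_of_set {z. poly P z = 0 \<or> poly Pk z = 0}"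
  assumes "p < 2*n-k" "e < length L"
  shows "node k n x p \<le> L ! e \<longleftrightarrow>
     (if p < n then p < (\<Sum>e'\<le>e. cv_int (cv_of k P ! e')) 
      else p - n < (\<Sum>e'\<le>e. cv_deriv_int k (cv_of k P ! e')))"
proof -
  have fin: "finite {z. poly P z = 0 \<or> poly Pk z = 0}" unfolding points_eq by simp
  have L: "sorted L" "distinct L" "set L = {z. poly P z = 0 \<or> poly Pk z = 0}"
    using fin by (auto simp: L_def)
  have cv: "cv_of k P ! e' = cv_entry_at k P (L ! e')" "poly P (L ! e') = 0 \<or> poly Pk (L ! e') = 0" if "e' \<le> e" for e'
    using that assms(3) nth_mem[of e' L] unfolding L(3) by (auto simp: cv_of_def L_def simp del: nth_mem)
  show ?thesis
  proof (cases "p < n")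
    case True
    have mem: "x l \<in> set L" if "l < n" for l
      using that unfolding L(3) by (auto simp: poly_root_poly_eq_0_iff)
    have "node k n x p \<le> L ! e \<longleftrightarrow> p < card {l. l < n \<and> x l \<le> L ! e}"
      using le_iff_less_card[OF sorted True] True by (simp add: node_def)
    also have "card {l. l < n \<and> x l \<le> L ! e} = (\<Sum>e'\<le>e. card {l. l < n \<and> x l = L ! e'})"
      by (rule card_le_eq_sum[OF L(1,2)]) (use mem assms in auto)
    also have "\<dots> = (\<Sum>e'\<le>e. cv_int (cv_of k P ! e'))"
      by (intro sum.cong refl) (use cv cv_entry_counts in auto)
    finally show ?thesis using True by simp
  next
    case False
    have mem: "\<xi> l \<in> set L" if "l < n - k" for l
      using that unfolding L(3) by (auto simp: poly_Pk_eq_0_iff)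
    have p: "p - n < n - k" using False assms(2) by simp
    have "node k n x p \<le> L ! e \<longleftrightarrow> p - n < card {l. l < n - k \<and> \<xi> l \<le> L ! e}"
      using le_iff_less_card[OF sorted_deriv_root[OF sorted] p] False by (simp add: node_def)
    also have "card {l. l < n - k \<and> \<xi> l \<le> L ! e} = (\<Sum>e'\<le>e. card {l. l < n - k \<and> \<xi> l = L ! e'})"
      by (rule card_le_eq_sum[OF L(1,2)]) (use mem assms in auto)
    also have "\<dots> = (\<Sum>e'\<le>e. cv_deriv_int k (cv_of k P ! e'))"
      by (intro sum.cong refl) (use cv cv_entry_counts in auto)
    finally show ?thesis using False by simp
  qed
qed

end

text \<open>Every node occurs in the list of points, so two nodes are compared by testing both against all points of the
list, and \<open>node_le_iff\<close> expresses the tests by the configuration vector alone.\<close>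

lemma cv_eq_imp_same_pattern:
  assumes "sorted_seq n x" "sorted_seq n y" "0 < k" "k < n"
    and "cv_of k (root_poly n x) = cv_of k (root_poly n y)"
  shows "same_pattern k n x y"
proof -
  interpret X: sorted_roots n k x using assms by unfold_locales
  interpret Y: sorted_roots n k y using assms by unfold_locales
  define LX where "LX = sorted_list_of_set {z. poly X.P z = 0 \<or> poly X.Pk z = 0}"
  define LY where "LY = sorted_list_of_set {z. poly Y.P z = 0 \<or> poly Y.Pk z = 0}"
  have "length LX = length (cv_of k X.P)" "length LY = length (cv_of k Y.P)"
    by (auto simp: cv_of_def LX_def LY_def)
  hence len: "length LX = length LY" using assms by simp
  have le: "node k n x p \<le> LX ! e \<longleftrightarrow> node k n y p \<le> LY ! e" if "p < 2*n-k" "e < length LX" for p e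
    using X.node_le_iff[OF that(1)] Y.node_le_iff[OF that(1)] that(2) len assms(5)
    unfolding LX_def LY_def by simp
  have fin: "finite {z. poly X.P z = 0 \<or> poly X.Pk z = 0}" "finite {z. poly Y.P z = 0 \<or> poly Y.Pk z = 0}"
    unfolding X.points_eq Y.points_eq by auto
  have mem: "node k n x p \<in> set LX" "node k n y p \<in> set LY" if "p < 2*n-k" for p
    using fin that unfolding LX_def LY_def by (auto simp: X.points_eq Y.points_eq)
  have "node k n x p \<le> node k n x q \<longleftrightarrow> (\<forall>e<length LX. node k n x q \<le> LX ! e \<longrightarrow> node k n x p \<le> LX ! e)"
       "node k n y p \<le> node k n y q \<longleftrightarrow> (\<forall>e<length LX. node k n y q \<le> LY ! e \<longrightarrow> node k n y p \<le> LY ! e)"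
    if "p < 2*n-k" "q < 2*n-k" for p q
    using mem[OF that(2)] len unfolding in_set_conv_nth by (metis order_refl order_trans)+
  thus ?thesis unfolding same_pattern_def using le by simp
qed

text \<open>Equal patterns give an increasing bijection between the two sets of points.  It preserves the entries because
multiplicities are numbers of coinciding indices.\<close>

lemma same_pattern_imp_cv_eq:
  assumes "sorted_seq n x" "sorted_seq n y" "0 < k" "k < n" "same_pattern k n x y"
  shows "cv_of k (root_poly n x) = cv_of k (root_poly n y)"
proof -
  interpret X: sorted_roots n k x using assms by unfold_locales
  interpret Y: sorted_roots n k y using assms by unfold_locales
  let ?I = "{..<2*n-k}" and ?u = "node k n x" and ?v = "node k n y"
  have le: "?u p \<le> ?u q \<longleftrightarrow> ?v p \<le> ?v q" if "p \<in> ?I" "q \<in> ?I" for p q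
    using assms(5) that by (auto simp: same_pattern_def)
  have eq: "?u p = ?u q \<longleftrightarrow> ?v p = ?v q" if "p \<in> ?I" "q \<in> ?I" for p q
    using le[of p q] le[of q p] that by force
  define \<phi> where "\<phi> z = ?v (SOME p. p \<in> ?I \<and> ?u p = z)" for z
  have \<phi>: "\<phi> (?u p) = ?v p" if "p \<in> ?I" for p
  proof -
    have "\<exists>q. q \<in> ?I \<and> ?u q = ?u p" using that by auto
    from someI_ex[OF this] show ?thesis unfolding \<phi>_def using eq that by blast
  qed
  have sl: "sorted_list_of_set (?v ` ?I) = map \<phi> (sorted_list_of_set (?u ` ?I))"
  proof (rule sorted_list_of_set_unique[THEN iffD1, rotated, rotated])
    show "finite (?v ` ?I)" by simp
    have mono: "\<phi> a < \<phi> b" if "a \<in> ?u ` ?I" "b \<in> ?u ` ?I" "a < b" for a b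
    proof -
      obtain p q where pq: "p \<in> ?I" "q \<in> ?I" "a = ?u p" "b = ?u q" using \<open>a \<in> ?u ` ?I\<close> \<open>b \<in> ?u ` ?I\<close> by blast
      show ?thesis using le[OF pq(2,1)] \<open>a < b\<close> \<phi>[OF pq(1)] \<phi>[OF pq(2)] pq(3,4) by simp
    qed
    have s: "sorted_wrt (<) (sorted_list_of_set (?u ` ?I))" by simp
    have "sorted_wrt (\<lambda>a b. \<phi> a < \<phi> b) (sorted_list_of_set (?u ` ?I))"
      by (rule sorted_wrt_mono_rel[OF _ s]) (use mono in auto)
    hence st: "sorted_wrt (<) (map \<phi> (sorted_list_of_set (?u ` ?I)))" by (simp add: sorted_wrt_map)
    have im: "set (map \<phi> (sorted_list_of_set (?u ` ?I))) = ?v ` ?I"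
      using \<phi> by (simp add: image_image)
    show "sorted_wrt (<) (map \<phi> (sorted_list_of_set (?u ` ?I))) \<and> set (map \<phi> (sorted_list_of_set (?u ` ?I))) = ?v ` ?I \<and>
       length (map \<phi> (sorted_list_of_set (?u ` ?I))) = card (?v ` ?I)"
      using st im by (metis distinct_card strict_sorted_iff)
  qed
  have ent: "cv_entry_at k Y.P (?v p) = cv_entry_at k X.P (?u p)" if p: "p \<in> ?I" for p
  proof -
    have a: "{i. i < n \<and> y i = ?v p} = {i. i < n \<and> x i = ?u p}"
    proof -
      have "y i = ?v p \<longleftrightarrow> x i = ?u p" if "i < n" for i
        using eq[OF _ p, of i] that assms(4) by (simp add: node_def)
      thus ?thesis by blast
    qed
    have b: "(\<exists>j<n-k. deriv_root k n y j = ?v p) \<longleftrightarrow> (\<exists>j<n-k. deriv_root k n x j = ?u p)"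
    proof -
      have "deriv_root k n y j = ?v p \<longleftrightarrow> deriv_root k n x j = ?u p" if "j < n - k" for j
        using eq[OF _ p, of "n + j"] that by (simp add: node_def)
      thus ?thesis by blast
    qed
    have c: "(\<exists>i<n. y i = ?v p) \<longleftrightarrow> (\<exists>i<n. x i = ?u p)" using a by blast
    show ?thesis unfolding cv_entry_at_def order_root_poly a X.poly_Pk_eq_0_iff Y.poly_Pk_eq_0_iff
       poly_root_poly_eq_0_iff b c ..
  qed
  show ?thesis unfolding cv_of_def X.points_eq Y.points_eq sl
    using \<phi> ent by (simp add: o_def)
qed

text \<open>Comparisons among the roots of the \<open>k\<close>-th derivative follow from comparisons among the roots of the polynomial:
the neighbours with indices \<open>j\<close> and \<open>j + 1\<close> coincide exactly if \<open>x j = x (j + k + 1)\<close>.\<close>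

lemma same_patternI:
  assumes "sorted_seq n x" "sorted_seq n y" "0 < k" "k < n"
    and "\<And>i i'. i < n \<Longrightarrow> i' < n \<Longrightarrow> x i \<le> x i' \<longleftrightarrow> y i \<le> y i'"
    and "\<And>i j. i < n \<Longrightarrow> j < n - k \<Longrightarrow> x i \<le> deriv_root k n x j \<longleftrightarrow> y i \<le> deriv_root k n y j"
    and "\<And>i j. i < n \<Longrightarrow> j < n - k \<Longrightarrow> deriv_root k n x j \<le> x i \<longleftrightarrow> deriv_root k n y j \<le> y i"
  shows "same_pattern k n x y"
proof -
  have step1: "deriv_root k n x (Suc j) = deriv_root k n x j \<longleftrightarrow> x j = x (j + k + 1)"
    if "sorted_seq n x" "Suc j < n - k" for x j
    using deriv_root_double[OF that] deriv_root_bounds[OF that(1), of j k] deriv_root_bounds[OF that(1), of "Suc j" k]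
      deriv_root_mono[OF that(1), of j "Suc j" k] that(2) by auto
  have dd: "deriv_root k n x j' \<le> deriv_root k n x j \<longleftrightarrow> (\<forall>l. j \<le> l \<longrightarrow> l < j' \<longrightarrow> x l = x (l + k + 1))"
    if "sorted_seq n x" "j < n - k" "j' < n - k" for x j j'
  proof (cases "j' \<le> j")
    case True thus ?thesis using deriv_root_mono[OF that(1) True that(2)] by auto
  next
    case False
    hence "j \<le> j'" by simp
    thus ?thesis using that(3)
    proof (induction j' rule: dec_induct)
      case (step m)
      have m: "deriv_root k n x j \<le> deriv_root k n x m" "deriv_root k n x m \<le> deriv_root k n x (Suc m)"
        using deriv_root_mono[OF that(1)] step by auto
      have "deriv_root k n x (Suc m) \<le> deriv_root k n x j \<longleftrightarrow>
        deriv_root k n x m \<le> deriv_root k n x j \<and> deriv_root k n x (Suc m) = deriv_root k n x m"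
        using m by auto
      thus ?case using step step1[OF that(1) step.prems]
        by (auto simp: less_Suc_eq)
    qed auto
  qed
  have "deriv_root k n x j' \<le> deriv_root k n x j \<longleftrightarrow> deriv_root k n y j' \<le> deriv_root k n y j" if "j < n - k" "j' < n - k" for j j'
  proof -
    have "x l = x (l + k + 1) \<longleftrightarrow> y l = y (l + k + 1)" if "l < j'" for l
      using assms(5)[of l "l+k+1"] assms(5)[of "l+k+1" l] that \<open>j' < n - k\<close> by force
    thus ?thesis unfolding dd[OF assms(1) that] dd[OF assms(2) that] by blast
  qed
  thus ?thesis unfolding same_pattern_def node_def using assms(4-7) by auto
qed

section \<open>Barycentric coordinates with respect to the nodes\<close>

context sorted_roots
begin

text \<open>The indices of the nodes: \<open>\<xi> j\<close> sits at a root of multiplicity greater than \<open>k\<close> exactly if \<open>x j = x (j + k)\<close>.\<close>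

definition simple :: "nat set" where
  "simple = {j. j < n - k \<and> x j \<noteq> x (j + k)}"

text \<open>A block of equal roots is addressed by their common value \<open>c\<close> in the base configuration, and its parameter is
stored at the index of its first root.\<close>

definition lead :: "real \<Rightarrow> nat" where
  "lead c = (LEAST i. x i = c)"

definition is_end :: "real \<Rightarrow> bool" where
  "is_end c \<longleftrightarrow> c = x 0 \<or> c = x (n - 1)"

text \<open>The blocks that are placed by a barycentric coordinate.\<close>

definition free :: "real \<Rightarrow> bool" where
  "free c \<longleftrightarrow> c \<in> x ` {..<n} \<and> \<not> is_end c \<and> c \<notin> \<xi> ` simple"

text \<open>The nodes next to the block \<open>c\<close>, evaluated at another configuration \<open>y\<close>.  Which nodes lie on which side is
decided in the base configuration; taking the maximum over all nodes on the left, and in \<open>hi\<close> the minimum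
over all nodes on the right, makes both functions visibly topical in \<open>y\<close>.\<close>

definition lo :: "real \<Rightarrow> (nat \<Rightarrow> real) \<Rightarrow> real" where
  "lo c y = Max (insert (y 0) (deriv_root k n y ` {j \<in> simple. \<xi> j < c}))"

definition hi :: "real \<Rightarrow> (nat \<Rightarrow> real) \<Rightarrow> real" where
  "hi c y = Min (insert (y (n - 1)) (deriv_root k n y ` {j \<in> simple. c < \<xi> j}))"

text \<open>The position that the parameters \<open>s\<close> prescribe for the block \<open>c\<close> if the nodes are computed from \<open>y\<close>.  The
configurations with parameters \<open>s\<close> are the solutions of \<open>y i = place s y (x i)\<close>.\<close>

definition place :: "(nat \<Rightarrow> real) \<Rightarrow> (nat \<Rightarrow> real) \<Rightarrow> real \<Rightarrow> real" where
  "place s y c = (if is_end c then s (lead c)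
     else if c \<in> \<xi> ` simple then deriv_root k n y (THE j. j \<in> simple \<and> \<xi> j = c)
     else (1 - s (lead c)) * lo c y + s (lead c) * hi c y)"

text \<open>The inequalities between the coordinates of a configuration that has the pattern of \<open>x\<close>.\<close>

definition params :: "(nat \<Rightarrow> real) \<Rightarrow> bool" where
  "params s \<longleftrightarrow>
     (x 0 < x (n - 1) \<longrightarrow> s 0 < s (lead (x (n - 1)))) \<and>
     (\<forall>c. free c \<longrightarrow> 0 < s (lead c) \<and> s (lead c) < 1) \<and>
     (\<forall>c d. free c \<longrightarrow> free d \<longrightarrow> c < d \<longrightarrow> (\<forall>j\<in>simple. \<not> (c < \<xi> j \<and> \<xi> j < d))
        \<longrightarrow> s (lead c) < s (lead d))"

definition blockwise :: "(nat \<Rightarrow> real) \<Rightarrow> bool" where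
  "blockwise y \<longleftrightarrow> sorted_seq n y \<and> (\<forall>i<n. \<forall>i'<n. x i = x i' \<longrightarrow> y i = y i')"

definition fixed :: "(nat \<Rightarrow> real) \<Rightarrow> (nat \<Rightarrow> real) \<Rightarrow> bool" where
  "fixed s y \<longleftrightarrow> blockwise y \<and> (\<forall>i<n. y i = place s y (x i))"

lemma n_pos: "0 < n" using k by simp

lemma simple_less: "j \<in> simple \<Longrightarrow> j < n - k" by (simp add: simple_def)

lemma finite_simple [simp]: "finite simple" by (simp add: simple_def)

lemma lead_0 [simp]: "lead (x 0) = 0"
  by (simp add: lead_def)

lemma lead: "i < n \<Longrightarrow> lead (x i) \<le> i" "x (lead (x i)) = x i"
  unfolding lead_def by (auto intro: Least_le LeastI)

lemma x_bounds: "i < n \<Longrightarrow> x 0 \<le> x i" "i < n \<Longrightarrow> x i \<le> x (n - 1)"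
  using sorted_seqD[OF sorted] by auto

lemma bounds_gen:
  assumes "sorted_seq n y"
  shows "i < n \<Longrightarrow> y 0 \<le> y i" "i < n \<Longrightarrow> y i \<le> y (n - 1)"
    "j < n - k \<Longrightarrow> y 0 \<le> deriv_root k n y j" "j < n - k \<Longrightarrow> deriv_root k n y j \<le> y (n - 1)"
proof -
  show *: "i < n \<Longrightarrow> y 0 \<le> y i" "i < n \<Longrightarrow> y i \<le> y (n - 1)" for i
    using sorted_seqD[OF assms] by auto
  show "j < n - k \<Longrightarrow> y 0 \<le> deriv_root k n y j" "j < n - k \<Longrightarrow> deriv_root k n y j \<le> y (n - 1)"
    using deriv_root_bounds[OF assms, of j k] *(1)[of j] *(2)[of "j+k"] less_diff_conv[of j n k] by (smt (verit) add_lessD1)+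
qed

lemma double_step:
  assumes "sorted_seq n y" "j < j'" "j' < n - k" "deriv_root k n y j = deriv_root k n y j'"
  shows "y j = y (j + k + 1)" "y (j' - 1) = y (j' + k)"
proof -
  have "deriv_root k n y j \<le> deriv_root k n y (Suc j)" "deriv_root k n y (Suc j) \<le> deriv_root k n y j'"
    "deriv_root k n y j \<le> deriv_root k n y (j' - 1)" "deriv_root k n y (j' - 1) \<le> deriv_root k n y j'"
    using assms(2,3) by (intro deriv_root_mono[OF assms(1)]; simp)+
  hence "deriv_root k n y j = deriv_root k n y (Suc j)" "deriv_root k n y (j' - 1) = deriv_root k n y (Suc (j' - 1))"
    using assms by auto
  from deriv_root_double[OF assms(1) _ this(1)] deriv_root_double[OF assms(1) _ this(2)]
  show "y j = y (j + k + 1)" "y (j' - 1) = y (j' + k)" using assms by auto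
qed

text \<open>Coinciding roots of the \<open>k\<close>-th derivative sit at a root of high multiplicity, so neither is a node.\<close>

lemma simple_inj:
  assumes "j \<in> simple" "j' < n - k" "\<xi> j = \<xi> j'"
  shows "j = j'"
proof (rule ccontr)
  assume "j \<noteq> j'"
  have j: "j < n - k" "x j \<noteq> x (j + k)" using assms(1) by (auto simp: simple_def)
  have "x j \<le> x (j + k)" using sorted_seqD[OF sorted] j by auto
  hence lt: "x j < x (j + k)" using j by simp
  from \<open>j \<noteq> j'\<close> consider "j < j'" | "j' < j" by linarith
  thus False
  proof cases
    case 1
    hence "x j = x (j + k + 1)" using double_step[OF sorted] assms by auto
    moreover have "x (j + k) \<le> x (j + k + 1)" using sorted_seqD[OF sorted] 1 assms(2) by auto
    ultimately show False using lt by simp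
  next
    case 2
    hence "x (j - 1) = x (j + k)" using double_step(2)[OF sorted 2] assms j by auto
    moreover have "x (j - 1) \<le> x j" using sorted_seqD[OF sorted] j by auto
    ultimately show False using lt by simp
  qed
qed

lemma the_simple: "j \<in> simple \<Longrightarrow> (THE j'. j' \<in> simple \<and> \<xi> j' = \<xi> j) = j"
  using simple_inj simple_less by (intro the_equality) auto

lemma simple_strict:
  assumes "j \<in> simple"
  shows "x 0 < \<xi> j" "\<xi> j < x (n - 1)"
proof -
  have j: "j < n - k" "x j \<noteq> x (j + k)" using assms by (auto simp: simple_def)
  have b: "x 0 \<le> x j" "x (j + k) \<le> x (n - 1)" using j x_bounds by auto
  show "x 0 < \<xi> j"
    using deriv_root_bounds[OF sorted j(1)] deriv_root_eq_left[OF sorted j(1)] b j by force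
  show "\<xi> j < x (n - 1)"
    using deriv_root_bounds[OF sorted j(1)] deriv_root_eq_right[OF sorted j(1)] b j by force
qed

lemma place_end: "is_end c \<Longrightarrow> place s y c = s (lead c)"
  by (simp add: place_def)

lemma place_simple: "j \<in> simple \<Longrightarrow> place s y (\<xi> j) = deriv_root k n y j"
  using simple_strict[of j] by (auto simp: place_def is_end_def the_simple)

lemma place_free: "free c \<Longrightarrow> place s y c = (1 - s (lead c)) * lo c y + s (lead c) * hi c y"
  by (simp add: place_def free_def)

lemma value_cases:
  assumes "i < n"
  obtains "is_end (x i)" | j where "j \<in> simple" "\<xi> j = x i" | "free (x i)"
  using assms unfolding free_def by force

lemma lo_ge: "y 0 \<le> lo c y" "j \<in> simple \<Longrightarrow> \<xi> j < c \<Longrightarrow> deriv_root k n y j \<le> lo c y"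
  unfolding lo_def by (auto intro!: Max_ge)

lemma hi_le: "hi c y \<le> y (n - 1)" "j \<in> simple \<Longrightarrow> c < \<xi> j \<Longrightarrow> hi c y \<le> deriv_root k n y j"
  unfolding hi_def by (auto intro!: Min_le)

lemma lo_cases:
  obtains "lo c y = y 0" | j where "j \<in> simple" "\<xi> j < c" "lo c y = deriv_root k n y j"
proof -
  have "lo c y \<in> insert (y 0) (deriv_root k n y ` {j \<in> simple. \<xi> j < c})"
    unfolding lo_def by (rule Max_in) auto
  thus ?thesis using that by auto
qed

lemma hi_cases:
  obtains "hi c y = y (n - 1)" | j where "j \<in> simple" "c < \<xi> j" "hi c y = deriv_root k n y j"
proof -
  have "hi c y \<in> insert (y (n - 1)) (deriv_root k n y ` {j \<in> simple. c < \<xi> j})"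
    unfolding hi_def by (rule Min_in) auto
  thus ?thesis using that by auto
qed

lemma lo_le_hi:
  assumes "sorted_seq n y"
  shows "lo c y \<le> hi c y"
proof -
  note b = bounds_gen[OF assms]
  have mono: "deriv_root k n y j \<le> deriv_root k n y j'" if "j \<in> simple" "j' \<in> simple" "\<xi> j < c" "c < \<xi> j'" for j j'
  proof -
    have "j \<le> j'"
    proof (rule ccontr)
      assume "\<not> j \<le> j'"
      hence "\<xi> j' \<le> \<xi> j" using deriv_root_mono[OF sorted, of j' j k] simple_less that by auto
      thus False using that by simp
    qed
    thus ?thesis using deriv_root_mono[OF assms] simple_less that by auto
  qed
  show ?thesis
    by (rule lo_cases[of c y]; rule hi_cases[of c y])
      (use b simple_less mono n_pos in \<open>auto intro: order_trans\<close>)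
qed

lemma place_free_bounds:
  assumes "sorted_seq n y" "params s" "free c"
  shows "lo c y \<le> place s y c" "place s y c \<le> hi c y"
proof -
  have s: "0 < s (lead c)" "s (lead c) < 1" using assms by (auto simp: params_def)
  have le: "0 \<le> hi c y - lo c y" using lo_le_hi[OF assms(1)] by simp
  have e: "place s y c = lo c y + s (lead c) * (hi c y - lo c y)"
    "place s y c = hi c y - (1 - s (lead c)) * (hi c y - lo c y)"
    using assms(3) by (auto simp: place_free algebra_simps)
  show "lo c y \<le> place s y c" unfolding e(1) using s le by simp
  show "place s y c \<le> hi c y" unfolding e(2) using s le by simp
qed

definition ends_at :: "(nat \<Rightarrow> real) \<Rightarrow> (nat \<Rightarrow> real) \<Rightarrow> bool" where
  "ends_at s y \<longleftrightarrow> y 0 = s 0 \<and> y (n - 1) = s (lead (x (n - 1)))"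

text \<open>Blocks never cross nodes, whatever the argument \<open>y\<close> is.\<close>

lemma place_weak:
  assumes "sorted_seq n y" "params s" "ends_at s y" "i < n" "j \<in> simple"
  shows "x i \<le> \<xi> j \<Longrightarrow> place s y (x i) \<le> deriv_root k n y j"
    and "\<xi> j \<le> x i \<Longrightarrow> deriv_root k n y j \<le> place s y (x i)"
proof -
  note b = bounds_gen(3,4)[OF assms(1) simple_less[OF assms(5)]]
  have jm: "deriv_root k n y j1 \<le> deriv_root k n y j2" if "j1 \<in> simple" "j2 \<in> simple" "\<xi> j1 \<le> \<xi> j2" for j1 j2
  proof (cases "j1 \<le> j2")
    case True thus ?thesis using deriv_root_mono[OF assms(1)] simple_less that by auto
  next
    case False
    hence "\<xi> j2 \<le> \<xi> j1" using deriv_root_mono[OF sorted, of j2 j1 k] simple_less that by auto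
    hence "\<xi> j1 = \<xi> j2" using that(3) by (rule antisym[rotated])
    thus ?thesis using simple_inj[OF that(1) simple_less[OF that(2)]] by blast
  qed
  show "place s y (x i) \<le> deriv_root k n y j" if "x i \<le> \<xi> j"
  proof (rule value_cases[OF assms(4)])
    assume "is_end (x i)"
    hence "x i = x 0" using simple_strict[OF assms(5)] that by (auto simp: is_end_def)
    thus ?thesis using b assms(3) by (simp add: place_end is_end_def ends_at_def)
  next
    fix j' assume j': "j' \<in> simple" "\<xi> j' = x i"
    thus ?thesis using jm[OF j'(1) assms(5)] that place_simple[OF j'(1), of s y] by simp
  next
    assume f: "free (x i)"
    hence "x i \<noteq> \<xi> j" using assms(5) by (auto simp: free_def)
    hence "hi (x i) y \<le> deriv_root k n y j" using hi_le assms(5) that by auto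
    thus ?thesis using place_free_bounds[OF assms(1,2) f] by simp
  qed
  show "deriv_root k n y j \<le> place s y (x i)" if "\<xi> j \<le> x i"
  proof (rule value_cases[OF assms(4)])
    assume "is_end (x i)"
    hence "x i = x (n - 1)" using simple_strict[OF assms(5)] that by (auto simp: is_end_def)
    thus ?thesis using b assms(3) by (simp add: place_end is_end_def ends_at_def)
  next
    fix j' assume j': "j' \<in> simple" "\<xi> j' = x i"
    thus ?thesis using jm[OF assms(5) j'(1)] that place_simple[OF j'(1), of s y] by simp
  next
    assume f: "free (x i)"
    hence "x i \<noteq> \<xi> j" using assms(5) by (auto simp: free_def)
    hence "deriv_root k n y j \<le> lo (x i) y" using lo_ge assms(5) that by auto
    thus ?thesis using place_free_bounds[OF assms(1,2) f] by simp
  qed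
qed

lemma place_ends:
  assumes "ends_at s y"
  shows "place s y (x 0) = y 0" "place s y (x (n - 1)) = y (n - 1)"
  using assms by (auto simp: place_end is_end_def ends_at_def)

lemma place_between:
  assumes "sorted_seq n y" "params s" "ends_at s y" "i < n"
  shows "y 0 \<le> place s y (x i)" "place s y (x i) \<le> y (n - 1)"
proof -
  note b = bounds_gen[OF assms(1)]
  have "y 0 \<le> place s y (x i) \<and> place s y (x i) \<le> y (n - 1)"
  proof (rule value_cases[OF assms(4)])
    assume "is_end (x i)"
    thus ?thesis using place_ends[OF assms(3)] b n_pos by (auto simp: is_end_def)
  next
    fix j' assume j': "j' \<in> simple" "\<xi> j' = x i"
    thus ?thesis using b simple_less place_simple[of j'] by auto
  next
    assume f: "free (x i)"
    show ?thesis using place_free_bounds[OF assms(1,2) f] lo_ge(1)[of y "x i"] hi_le(1)[of "x i" y] by simp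
  qed
  thus "y 0 \<le> place s y (x i)" "place s y (x i) \<le> y (n - 1)" by auto
qed

lemma same_gap:
  assumes "free c" "free d" "c < d" "\<forall>j\<in>simple. \<not> (c < \<xi> j \<and> \<xi> j < d)"
  shows "lo c y = lo d y" "hi c y = hi d y"
proof -
  have "\<xi> j \<noteq> c" "\<xi> j \<noteq> d" if "j \<in> simple" for j using assms(1,2) imageI[OF that, of \<xi>] unfolding free_def by metis+
  hence "{j \<in> simple. \<xi> j < c} = {j \<in> simple. \<xi> j < d}" "{j \<in> simple. c < \<xi> j} = {j \<in> simple. d < \<xi> j}"
    using assms(3,4) by (auto; force)+
  thus "lo c y = lo d y" "hi c y = hi d y" by (simp_all add: lo_def hi_def)
qed

text \<open>Two blocks are separated by a node, or they lie in the same gap and are ordered by their parameters.\<close>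

lemma place_mono:
  assumes "sorted_seq n y" "params s" "ends_at s y" "i < n" "i' < n" "x i \<le> x i'"
  shows "place s y (x i) \<le> place s y (x i')"
proof (cases "x i = x i'")
  case False
  hence lt: "x i < x i'" using assms(6) by simp
  show ?thesis
  proof (cases "x i = x 0 \<or> x i' = x (n - 1)")
    case True
    thus ?thesis using place_between[OF assms(1-3)] assms(4,5) place_ends[OF assms(3)] by auto
  next
    case ne: False
    have ne': "x i \<noteq> x (n - 1)" "x i' \<noteq> x 0" using lt x_bounds[OF assms(4)] x_bounds[OF assms(5)] by auto
    show ?thesis
    proof (cases "\<exists>j\<in>simple. x i \<le> \<xi> j \<and> \<xi> j \<le> x i'")
      case True
      then obtain j where "j \<in> simple" "x i \<le> \<xi> j" "\<xi> j \<le> x i'" by auto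
      thus ?thesis using place_weak(1)[OF assms(1-4), of j] place_weak(2)[OF assms(1-3,5), of j] by simp
    next
      case no: False
      have f: "free (x i)" "free (x i')" using ne ne' no lt assms(4,5) by (auto simp: free_def is_end_def)
      have no': "\<forall>j\<in>simple. \<not> (x i < \<xi> j \<and> \<xi> j < x i')" using no by auto
      have s: "s (lead (x i)) < s (lead (x i'))" using assms(2) f lt no' by (auto simp: params_def)
      have "s (lead (x i)) * (hi (x i) y - lo (x i) y) \<le> s (lead (x i')) * (hi (x i) y - lo (x i) y)"
        using s lo_le_hi[OF assms(1)] by (intro mult_right_mono) auto
      thus ?thesis using same_gap[OF f lt no', of y] f by (simp add: place_free algebra_simps)
    qed
  qed
qed simp

lemma place_blockwise:
  assumes "blockwise y" "params s" "ends_at s y"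
  shows "blockwise (\<lambda>i. place s y (x i))" "ends_at s (\<lambda>i. place s y (x i))"
proof -
  have s: "sorted_seq n y" using assms(1) by (simp add: blockwise_def)
  show "blockwise (\<lambda>i. place s y (x i))"
    unfolding blockwise_def using place_mono[OF s assms(2,3)] sorted_seqD[OF sorted]
    by (auto simp: sorted_seq_def)
  show "ends_at s (\<lambda>i. place s y (x i))"
    using assms(3) by (simp add: ends_at_def place_end is_end_def)
qed

lemma fixed_ends_at: "fixed s y \<Longrightarrow> ends_at s y"
  using n_pos by (auto simp: fixed_def ends_at_def place_end is_end_def)

end

context sorted_roots
begin

section \<open>Fixed points are unique and have the prescribed pattern\<close>

lemma sorted_squeeze:
  assumes "sorted_seq n y" "a \<le> i" "i \<le> b" "b < n" "y a = y b"
  shows "y i = y a"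
  using sorted_seqD[OF assms(1), of a i] sorted_seqD[OF assms(1), of i b] assms by simp

text \<open>Each equality \<open>x j = x (j + k)\<close> identifies \<open>k + 1\<close> consecutive roots, and the resulting segments for
neighbouring \<open>j\<close> overlap because \<open>k > 0\<close>.\<close>

lemma non_simple_chain:
  assumes "a + k \<le> b" "b < n" "\<And>j. a \<le> j \<Longrightarrow> j + k \<le> b \<Longrightarrow> j \<notin> simple"
  shows "x a = x b"
proof -
  have "x a = x (a + m + k)" if "a + m + k \<le> b" for m
    using that
  proof (induction m)
    case 0
    have "a < n - k" using assms by simp
    thus ?case using assms(3)[of a] 0 by (simp add: simple_def)
  next
    case (Suc m)
    have e: "x a = x (a + m + k)" using Suc by simp
    have "x (a + m + 1) = x a"
      using sorted_squeeze[OF sorted, of a "a+m+1" "a+m+k"] e k Suc.prems assms(2) by simp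
    moreover have "a + Suc m < n - k" using Suc.prems assms(2) by simp
    hence "x (a + Suc m) = x (a + Suc m + k)"
      using assms(3)[of "a + Suc m"] Suc.prems by (auto simp: simple_def)
    ultimately show ?case by simp
  qed
  from this[of "b - a - k"] assms(1) show ?thesis by simp
qed

text \<open>A further root of the \<open>k\<close>-th derivative at \<open>c\<close> would be a double one next to the cluster, and
\<open>double_step\<close> would then enlarge the cluster.\<close>

lemma deriv_root_at_cluster:
  assumes "sorted_seq n y" "a + k \<le> b" "b < n" "y a = c" "y b = c"
    "\<And>i. i < a \<Longrightarrow> y i \<noteq> c" "\<And>i. b < i \<Longrightarrow> i < n \<Longrightarrow> y i \<noteq> c"
    and j: "j < n - k" "deriv_root k n y j = c"
  shows "a \<le> j" "j + k \<le> b"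
proof -
  have cl: "deriv_root k n y i = c" if "a \<le> i" "i + k \<le> b" for i
  proof -
    have "y i = c" "y (i + k) = c" using sorted_squeeze[OF assms(1), of a _ b] that assms by auto
    moreover have "i < n - k" using that assms(3) by linarith
    ultimately show ?thesis using deriv_root_bounds[OF assms(1), of i k] by simp
  qed
  show "a \<le> j"
  proof (rule ccontr)
    assume *: "\<not> a \<le> j"
    have "y j = y (j + k + 1)"
      using double_step(1)[OF assms(1), of j a] * cl[of a] assms(2,3) j by simp
    moreover have "y j \<le> c" "c \<le> y (j + k)" using deriv_root_bounds[OF assms(1) j(1)] j(2) by auto
    moreover have "y (j + k) \<le> y (j + k + 1)" using sorted_seqD[OF assms(1)] * assms(2,3) by simp
    ultimately have "y j = c" by simp
    thus False using assms(6) * by simp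
  qed
  show "j + k \<le> b"
  proof (rule ccontr)
    assume *: "\<not> j + k \<le> b"
    have "b - k < j" using * assms(2) by simp
    hence "y (j - 1) = y (j + k)"
      using double_step(2)[OF assms(1), of "b - k" j] cl[of "b - k"] assms(2,3) j by simp
    moreover have "y j \<le> c" "c \<le> y (j + k)" using deriv_root_bounds[OF assms(1) j(1)] j(2) by auto
    moreover have "y (j - 1) \<le> y j" using sorted_seqD[OF assms(1)] j by simp
    ultimately have "y (j + k) = c" by simp
    thus False using assms(7)[of "j + k"] * j by simp
  qed
qed

lemma fixed_value:
  assumes "fixed s y" "i < n"
  shows "y i = place s y (x i)"
  using assms by (simp add: fixed_def)

lemma fixed_sorted: "fixed s y \<Longrightarrow> sorted_seq n y"
  by (simp add: fixed_def blockwise_def)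

lemma fixed_block: "fixed s y \<Longrightarrow> x i = x i' \<Longrightarrow> i < n \<Longrightarrow> i' < n \<Longrightarrow> y i = y i'"
  unfolding fixed_def blockwise_def by blast

lemma fixed_weak:
  assumes "fixed s y" "params s" "i < n" "j \<in> simple"
  shows "x i \<le> \<xi> j \<Longrightarrow> y i \<le> deriv_root k n y j" "\<xi> j \<le> x i \<Longrightarrow> deriv_root k n y j \<le> y i"
  unfolding fixed_value[OF assms(1,3)]
  using place_weak[OF fixed_sorted[OF assms(1)] assms(2) fixed_ends_at[OF assms(1)] assms(3,4)] by blast+

lemma fixed_free_strict:
  assumes "fixed s y" "params s" "i < n" "free (x i)" "lo (x i) y < hi (x i) y"
  shows "lo (x i) y < y i" "y i < hi (x i) y"
proof -
  define t where "t = s (lead (x i))"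
  have t: "0 < t" "t < 1" using assms by (auto simp: params_def t_def)
  have e: "y i = (1 - t) * lo (x i) y + t * hi (x i) y"
    using fixed_value[OF assms(1,3)] assms(4) by (simp add: place_free t_def)
  have "0 < t * (hi (x i) y - lo (x i) y)" "0 < (1 - t) * (hi (x i) y - lo (x i) y)"
    using t assms(5) by auto
  thus "lo (x i) y < y i" "y i < hi (x i) y" unfolding e by (auto simp: algebra_simps)
qed

lemma fixed_free_weak:
  assumes "fixed s y" "params s" "i < n" "free (x i)"
  shows "lo (x i) y \<le> y i" "y i \<le> hi (x i) y"
  unfolding fixed_value[OF assms(1,3)]
  using place_free_bounds[OF fixed_sorted[OF assms(1)] assms(2,4)] by blast+

text \<open>Let \<open>y a, \<dots>, y b\<close> be all the roots equal to \<open>c\<close>.  Then the roots of the \<open>k\<close>-th derivative at \<open>c\<close> have exactly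
the indices \<open>a, \<dots>, b - k\<close>.  If \<open>c\<close> is not the leftmost root, consider the first block of the cluster.  In the base
configuration it does not exceed \<open>\<xi> a\<close>, so the node on its left has index less than \<open>a\<close> and stays strictly below
\<open>c\<close>.  As the block is placed at \<open>c\<close>, the node on its right must be strictly above \<open>c\<close>.  Hence none of the indices
\<open>a, \<dots>, b - k\<close> belongs to a node, and \<open>non_simple_chain\<close> shows that the cluster is one block.  If \<open>c\<close> is the leftmost root,
the last block of the cluster leads to a contradiction in the mirrored way.\<close>

lemma big_cluster:
  assumes "fixed s y" "params s" "a + k \<le> b" "b < n" "y a = c" "y b = c"
    "\<And>i. i < a \<Longrightarrow> y i \<noteq> c" "\<And>i. b < i \<Longrightarrow> i < n \<Longrightarrow> y i \<noteq> c"
  shows "x a = x b"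
proof (rule ccontr)
  assume ne: "x a \<noteq> x b"
  have y: "sorted_seq n y" by (rule fixed_sorted[OF assms(1)])
  have blk: "y i = y i'" if "x i = x i'" "i < n" "i' < n" for i i'
    by (rule fixed_block[OF assms(1) that])
  have "x a \<le> x b" using sorted_seqD[OF sorted, of a b] assms(3,4) by simp
  hence lt: "x a < x b" using ne by simp
  note cl = deriv_root_at_cluster[OF y assms(3-8)]
  note b = bounds_gen[OF y]
  have ends: "y 0 < y (n - 1)"
  proof -
    have "x 0 < x (n - 1)" using lt x_bounds(1)[of a] x_bounds(2)[of b] assms(3,4) by simp
    thus ?thesis using assms(2) fixed_ends_at[OF assms(1)] by (auto simp: params_def ends_at_def)
  qed
  show False
  proof (cases "c = y 0")
    case False
    have a: "a < n" "a < n - k" using assms(3,4) by auto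
    have c0: "y 0 < c" using b(1)[OF a(1)] False assms(5) by simp
    have "x a \<noteq> x 0" using blk[of a 0] a False assms(5) n_pos by auto
    moreover have "x a \<noteq> x (n - 1)" using lt x_bounds(2)[OF assms(4)] by simp
    ultimately have int: "\<not> is_end (x a)" by (simp add: is_end_def)
    have xa: "x a \<le> \<xi> a" using deriv_root_bounds(1)[OF sorted a(2)] .
    show False
    proof (rule value_cases[OF a(1)])
      assume "is_end (x a)" thus False using int by simp
    next
      fix j assume j: "j \<in> simple" "\<xi> j = x a"
      have "deriv_root k n y j = c"
        using fixed_value[OF assms(1) a(1)] j place_simple[OF j(1), of s y] assms(5) by simp
      hence "a \<le> j" using cl[of j] simple_less j by auto
      from deriv_root_mono[OF sorted this simple_less[OF j(1)]] have "\<xi> a \<le> \<xi> j" .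
      hence eq: "\<xi> a = \<xi> j" using xa j by simp
      hence "j = a" using simple_inj[OF j(1) a(2)] by simp
      moreover have "x a = x (a + k)" using deriv_root_eq_left[OF sorted a(2)] eq j by simp
      ultimately show False using j(1) by (simp add: simple_def)
    next
      assume f: "free (x a)"
      have lo: "lo (x a) y < c"
      proof (rule lo_cases[of "x a" y])
        fix j assume j: "j \<in> simple" "\<xi> j < x a" "lo (x a) y = deriv_root k n y j"
        have "\<not> a \<le> j" using deriv_root_mono[OF sorted, of a j k] simple_less[OF j(1)] j(2) xa by auto
        hence "deriv_root k n y j \<noteq> c" using cl[of j] simple_less[OF j(1)] by auto
        thus ?thesis using j fixed_free_weak(1)[OF assms(1,2) a(1) f] assms(5) by simp
      qed (use c0 in simp)
      have hi: "c < hi (x a) y"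
      proof (rule ccontr)
        assume "\<not> c < hi (x a) y"
        hence "hi (x a) y = c" using fixed_free_weak(2)[OF assms(1,2) a(1) f] assms(5) by simp
        thus False using fixed_free_strict(2)[OF assms(1,2) a(1) f] lo assms(5) by simp
      qed
      have "x a = x b"
      proof (rule non_simple_chain[OF assms(3,4)])
        fix j assume j: "a \<le> j" "j + k \<le> b"
        show "j \<notin> simple"
        proof
          assume js: "j \<in> simple"
          have "y j = c" "y (j + k) = c" using sorted_squeeze[OF y, of a _ b] j assms by auto
          hence "deriv_root k n y j = c" using deriv_root_bounds[OF y simple_less[OF js]] by simp
          hence "\<not> x a < \<xi> j" using hi hi_le(2)[OF js, of "x a" y] by auto
          moreover have "\<xi> a \<le> \<xi> j" using deriv_root_mono[OF sorted j(1) simple_less[OF js]] .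
          ultimately have "\<xi> j = x a" using xa by simp
          thus False using f js unfolding free_def by (metis imageI)
        qed
      qed
      thus False using ne by simp
    qed
  next
    case True
    have "b < n" using assms by simp
    have bk: "b - k < n - k" "b - k + k = b" using assms(3,4) k by auto
    have "x b \<noteq> x (n - 1)" using blk[of b "n - 1"] assms(4,6) ends True n_pos by auto
    moreover have "x b \<noteq> x 0" using lt x_bounds(1)[of a] assms(3,4) by simp
    ultimately have int: "\<not> is_end (x b)" by (simp add: is_end_def)
    have xb: "\<xi> (b - k) \<le> x b" using deriv_root_bounds(2)[OF sorted bk(1)] bk(2) by simp
    show False
    proof (rule value_cases[OF \<open>b < n\<close>])
      assume "is_end (x b)" thus False using int by simp
    next
      fix j assume j: "j \<in> simple" "\<xi> j = x b"
      have "deriv_root k n y j = c"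
        using fixed_value[OF assms(1) \<open>b < n\<close>] j place_simple[OF j(1), of s y] assms(6) by simp
      hence "j + k \<le> b" using cl[of j] simple_less j by auto
      hence "j \<le> b - k" by simp
      from deriv_root_mono[OF sorted this bk(1)] have "\<xi> j \<le> \<xi> (b - k)" .
      hence eq: "\<xi> (b - k) = \<xi> j" using xb j by simp
      hence "j = b - k" using simple_inj[OF j(1) bk(1)] by simp
      moreover have "x (b - k) = x (b - k + k)" using deriv_root_eq_right[OF sorted bk(1)] eq j bk by simp
      ultimately show False using j(1) by (simp add: simple_def)
    next
      assume f: "free (x b)"
      have hi: "c < hi (x b) y"
      proof (rule hi_cases[of "x b" y])
        fix j assume j: "j \<in> simple" "x b < \<xi> j" "hi (x b) y = deriv_root k n y j"
        have "\<not> j \<le> b - k" using deriv_root_mono[OF sorted, of j "b - k" k] bk j(2) xb by auto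
        hence "\<not> j + k \<le> b" by simp
        hence "deriv_root k n y j \<noteq> c" using cl[of j] simple_less[OF j(1)] by auto
        thus ?thesis using j fixed_free_weak(2)[OF assms(1,2) \<open>b < n\<close> f] assms(6) by simp
      qed (use ends True in simp)
      moreover have "lo (x b) y = c"
        using lo_ge(1)[of y "x b"] True fixed_free_weak(1)[OF assms(1,2) \<open>b < n\<close> f] assms(6) by simp
      ultimately show False using fixed_free_strict(1)[OF assms(1,2) \<open>b < n\<close> f] assms(6) by simp
    qed
  qed
qed

text \<open>A value \<open>c\<close> taken by at most \<open>k\<close> of the roots is at most a simple root of the \<open>k\<close>-th derivative, and not one at all if \<open>c\<close> is an
extreme root.  So a free block at \<open>c\<close> cannot have both its nodes at \<open>c\<close> and lies strictly between them.  Two such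
blocks would be separated by a node strictly between them, or have different barycentric coordinates in a gap
of positive length.\<close>

lemma small_cluster:
  assumes "fixed s y" "params s" "b < a + k" "a \<le> b" "b < n" "y a = c" "y b = c"
    "\<And>i. i < a \<Longrightarrow> y i \<noteq> c" "\<And>i. b < i \<Longrightarrow> i < n \<Longrightarrow> y i \<noteq> c"
  shows "\<And>i j. i < n \<Longrightarrow> y i = c \<Longrightarrow> j \<in> simple \<Longrightarrow> deriv_root k n y j = c \<Longrightarrow> x i = \<xi> j"
    and "\<And>i i'. i < n \<Longrightarrow> i' < n \<Longrightarrow> y i = c \<Longrightarrow> y i' = c \<Longrightarrow> x i = x i'"
proof -
  have y: "sorted_seq n y" by (rule fixed_sorted[OF assms(1)])
  have blk: "y i = y i'" if "x i = x i'" "i < n" "i' < n" for i i'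
    by (rule fixed_block[OF assms(1) that])
  note b = bounds_gen[OF y]
  have in_ab: "a \<le> i \<and> i \<le> b" if "i < n" "y i = c" for i
    using assms(8)[of i] assms(9)[of i] that by (meson not_le)
  have ends: "y 0 < y (n - 1)" if "x 0 < x (n - 1)"
    using assms(2) fixed_ends_at[OF assms(1)] that by (auto simp: params_def ends_at_def)
  have one: "j = j'" if "j < n - k" "j' < n - k" "deriv_root k n y j = c" "deriv_root k n y j' = c" for j j'
  proof -
    have *: False if "j < j'" "j' < n - k" "deriv_root k n y j = c" "deriv_root k n y j' = c" for j j'
    proof -
      have e: "y j = y (j + k + 1)" using double_step(1)[OF y] that by simp
      moreover have "y j \<le> c" "c \<le> y (j + k)" using deriv_root_bounds[OF y, of j k] that by auto
      moreover have "y (j + k) \<le> y (j + k + 1)" using sorted_seqD[OF y] that by auto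
      ultimately have "y j = c" "y (j + k + 1) = c" by auto
      moreover have "j < n" "j + k + 1 < n" using that by linarith+
      ultimately show False using in_ab[of j] in_ab[of "j + k + 1"] assms(3) by linarith
    qed
    show ?thesis using *[of j j'] *[of j' j] that by (meson linorder_neqE_nat)
  qed
  have int: "y 0 \<noteq> c \<and> y (n - 1) \<noteq> c" if "j < n - k" "deriv_root k n y j = c" for j
  proof -
    have bb: "y j \<le> c" "c \<le> y (j + k)" using deriv_root_bounds[OF y that(1)] that(2) by auto
    have no: "\<not> (y j = c \<and> y (j + k) = c)"
      using in_ab[of j] in_ab[of "j + k"] that(1) assms(3) less_diff_conv[of j n k] by linarith
    show ?thesis
    proof
      show "y 0 \<noteq> c"
        using no bb b(1)[of j] that(1) deriv_root_eq_left[OF y that(1)] that(2) by force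
      show "y (n - 1) \<noteq> c"
        using no bb b(2)[of "j + k"] that(1) deriv_root_eq_right[OF y that(1)] that(2) by force
    qed
  qed
  have star: "lo (x i) y < c \<and> c < hi (x i) y" if i: "i < n" "y i = c" "free (x i)" for i
  proof -
    have "x 0 < x (n - 1)" using i x_bounds[OF i(1)] by (auto simp: free_def is_end_def)
    note en = ends[OF this]
    have ne: "lo (x i) y \<noteq> c \<or> hi (x i) y \<noteq> c"
    proof (rule ccontr)
      assume "\<not> ?thesis"
      hence e: "lo (x i) y = c" "hi (x i) y = c" by auto
      show False
      proof (rule lo_cases[of "x i" y]; rule hi_cases[of "x i" y])
        fix j assume "j \<in> simple" "hi (x i) y = deriv_root k n y j" "lo (x i) y = y 0"
        thus False using e int[of j] simple_less[of j] by simp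
      next
        fix j assume "j \<in> simple" "hi (x i) y = y (n - 1)" "lo (x i) y = deriv_root k n y j"
        thus False using e int[of j] simple_less[of j] by simp
      next
        fix j j' assume j: "j \<in> simple" "j' \<in> simple" "\<xi> j < x i" "x i < \<xi> j'"
          "lo (x i) y = deriv_root k n y j" "hi (x i) y = deriv_root k n y j'"
        have "j = j'" using one[OF simple_less[OF j(1)] simple_less[OF j(2)]] e j(5,6) by metis
        thus False using j(3,4) by simp
      next
        assume "lo (x i) y = y 0" "hi (x i) y = y (n - 1)"
        thus False using e en by simp
      qed
    qed
    have "lo (x i) y \<le> c" "c \<le> hi (x i) y" using fixed_free_weak[OF assms(1,2) i(1,3)] i(2) by auto
    with ne have "lo (x i) y < hi (x i) y" by auto
    from fixed_free_strict[OF assms(1,2) i(1,3) this] i(2) show ?thesis by simp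
  qed
  have simp_val: "deriv_root k n y j = c" if "i < n" "y i = c" "j \<in> simple" "\<xi> j = x i" for i j
    using fixed_value[OF assms(1) that(1)] place_simple[OF that(3), of s y] that by simp
  show c2: "x i = \<xi> j" if i: "i < n" "y i = c" "j \<in> simple" "deriv_root k n y j = c" for i j
  proof (rule value_cases[OF i(1)])
    assume "is_end (x i)"
    hence "y i = y 0 \<or> y i = y (n - 1)" using blk[of i 0] blk[of i "n - 1"] i(1) n_pos by (auto simp: is_end_def)
    thus ?thesis using int[OF simple_less[OF i(3)] i(4)] i(2) by auto
  next
    fix j' assume j': "j' \<in> simple" "\<xi> j' = x i"
    hence "j' = j" using one simp_val[OF i(1,2) j'] i(3,4) simple_less by blast
    thus ?thesis using j' by simp
  next
    assume f: "free (x i)"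
    note st = star[OF i(1,2) f]
    have "\<not> \<xi> j < x i" using lo_ge(2)[OF i(3), of "x i" y] st i(4) by auto
    moreover have "\<not> x i < \<xi> j" using hi_le(2)[OF i(3), of "x i" y] st i(4) by auto
    ultimately show ?thesis by simp
  qed
  have lt: False if i: "i < n" "i' < n" "y i = c" "y i' = c" "x i < x i'" for i i'
  proof -
    have "x 0 < x (n - 1)" using x_bounds(1)[OF i(1)] x_bounds(2)[OF i(2)] i(5) by simp
    note en = ends[OF this]
    have first: "y 0 = c" if "x i = x 0" using blk[of i 0] that i n_pos by auto
    have last: "y (n - 1) = c" if "x i' = x (n - 1)" using blk[of i' "n - 1"] that i n_pos by auto
    have nf: "x i \<noteq> x (n - 1)" "x i' \<noteq> x 0" using i x_bounds[OF i(1)] x_bounds[OF i(2)] by auto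
    have m: False if "j \<in> simple" "\<xi> j = x i \<or> \<xi> j = x i'" for j
    proof -
      have "deriv_root k n y j = c" using simp_val[OF i(1,3) that(1)] simp_val[OF i(2,4) that(1)] that(2) by blast
      hence "x i = \<xi> j" "x i' = \<xi> j" using c2[OF i(1,3) that(1)] c2[OF i(2,4) that(1)] by blast+
      thus False using i(5) by simp
    qed
    show False
    proof (rule value_cases[OF i(1)]; rule value_cases[OF i(2)])
      assume "is_end (x i)" "is_end (x i')"
      thus False using first last nf en by (auto simp: is_end_def)
    next
      assume "is_end (x i)" "free (x i')"
      thus False using first nf star[OF i(2,4)] lo_ge(1)[of y "x i'"] by (auto simp: is_end_def)
    next
      assume "free (x i)" "is_end (x i')"
      thus False using last nf star[OF i(1,3)] hi_le(1)[of "x i" y] by (auto simp: is_end_def)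
    next
      assume f: "free (x i)" "free (x i')"
      note st = star[OF i(1,3) f(1)] star[OF i(2,4) f(2)]
      show False
      proof (cases "\<exists>j\<in>simple. x i < \<xi> j \<and> \<xi> j < x i'")
        case True
        then obtain j where j: "j \<in> simple" "x i < \<xi> j" "\<xi> j < x i'" by auto
        thus False using hi_le(2)[OF j(1,2), of y] lo_ge(2)[OF j(1,3), of y] st by simp
      next
        case False
        hence gap: "\<forall>j\<in>simple. \<not> (x i < \<xi> j \<and> \<xi> j < x i')" by auto
        note sg = same_gap[OF f i(5) gap, of y]
        have "s (lead (x i)) < s (lead (x i'))" using assms(2) f i(5) gap by (auto simp: params_def)
        hence "s (lead (x i)) * (hi (x i) y - lo (x i) y) < s (lead (x i')) * (hi (x i) y - lo (x i) y)"
          using st by (intro mult_strict_right_mono) auto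
        hence "y i < y i'" 
          unfolding fixed_value[OF assms(1) i(1)] fixed_value[OF assms(1) i(2)] place_free[OF f(1)] place_free[OF f(2)]
          by (simp add: sg algebra_simps)
        thus False using i by simp
      qed
    qed (use m in blast)+
  qed
  show "x i = x i'" if "i < n" "i' < n" "y i = c" "y i' = c" for i i'
    using lt[of i i'] lt[of i' i] that by fastforce
qed

text \<open>Weak inequalities of the base configuration persist because blocks do not cross nodes.  New equalities are excluded
by inspecting the cluster of all roots with a given value, which has more than \<open>k\<close> elements or not.\<close>

theorem fixed_imp_same_pattern:
  assumes "fixed s y" "params s"
  shows "same_pattern k n y x"
proof -
  have y: "sorted_seq n y" by (rule fixed_sorted[OF assms(1)])
  have blk: "y i = y i'" if "x i = x i'" "i < n" "i' < n" for i i'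
    by (rule fixed_block[OF assms(1) that])
  have main: "(\<forall>i'<n. y i' = y i \<longrightarrow> x i' = x i) \<and> (\<forall>j\<in>simple. deriv_root k n y j = y i \<longrightarrow> x i = \<xi> j)" if i: "i < n" for i
  proof -
    define I where "I = {i'. i' < n \<and> y i' = y i}"
    have I: "finite I" "I \<noteq> {}" using i by (auto simp: I_def)
    define a b where "a = Min I" and "b = Max I"
    have "i \<in> I" using i by (simp add: I_def)
    hence ab: "a \<in> I" "b \<in> I" "a \<le> i" "i \<le> b" unfolding a_def b_def
      using I by (simp_all del: Min_le_iff Max_ge_iff)
    have ab': "b < n" "y a = y i" "y b = y i" "a \<le> b" using ab by (auto simp: I_def)
    have out: "\<And>l. l < a \<Longrightarrow> y l \<noteq> y i" "\<And>l. b < l \<Longrightarrow> l < n \<Longrightarrow> y l \<noteq> y i"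
    proof -
      fix l assume l: "l < a"
      hence "l \<notin> I" using Min_le[OF I(1), of l] by (auto simp: a_def)
      thus "y l \<noteq> y i" using l ab'(1,4) by (simp add: I_def)
    next
      fix l assume l: "b < l" "l < n"
      hence "l \<notin> I" using Max_ge[OF I(1), of l] by (auto simp: b_def)
      thus "y l \<noteq> y i" using l by (simp add: I_def)
    qed
    show ?thesis
    proof (cases "a + k \<le> b")
      case True
      have e: "x a = x b" by (rule big_cluster[OF assms True ab'(1-3) out])
      have "x l = x a" if "a \<le> l" "l \<le> b" for l
        using sorted_squeeze[OF sorted that ab'(1) e] .
      moreover have "a \<le> l \<and> l \<le> b" if "l < n" "y l = y i" for l
        using out(1)[of l] out(2)[of l] that by (meson not_le)
      moreover have "j \<notin> simple" if "j < n - k" "deriv_root k n y j = y i" for j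
      proof -
        have "a \<le> j" "j + k \<le> b" using deriv_root_at_cluster[OF y True ab'(1-3) out that] by auto
        hence "a \<le> j" "j \<le> b" "a \<le> j + k" "j + k \<le> b" by linarith+
        hence "x j = x a" "x (j + k) = x a" using sorted_squeeze[OF sorted _ _ ab'(1) e] by blast+
        thus ?thesis by (simp add: simple_def)
      qed
      ultimately show ?thesis using i simple_less by metis
    next
      case False
      hence "b < a + k" by simp
      note sc = small_cluster[OF assms this ab'(4,1,2,3) out]
      show ?thesis using sc i by blast
    qed
  qed
  show ?thesis
  proof (rule same_patternI[OF y sorted k])
    show xx: "y i \<le> y i' \<longleftrightarrow> x i \<le> x i'" if "i < n" "i' < n" for i i'
    proof (cases "i \<le> i'")
      case True
      thus ?thesis using sorted_seqD[OF y] sorted_seqD[OF sorted] that by simp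
    next
      case False
      hence "y i' \<le> y i" "x i' \<le> x i" using sorted_seqD[OF y] sorted_seqD[OF sorted] that by auto
      moreover have "y i' = y i \<longleftrightarrow> x i' = x i" using main[OF that(1)] blk[of i' i] that by blast
      ultimately show ?thesis by (smt (verit))
    qed
    have nonsimple: "\<xi> j = x j \<and> deriv_root k n y j = y j" if "j < n - k" "j \<notin> simple" for j
    proof -
      have e: "x j = x (j + k)" using that by (simp add: simple_def)
      hence "y j = y (j + k)" using blk[of j "j + k"] that by simp
      thus ?thesis using deriv_root_bounds[OF y that(1)] deriv_root_bounds[OF sorted that(1)] e by simp
    qed
    show "y i \<le> deriv_root k n y j \<longleftrightarrow> x i \<le> \<xi> j" if "i < n" "j < n - k" for i j
    proof (cases "j \<in> simple")
      case True
      have "deriv_root k n y j = y i \<longrightarrow> x i = \<xi> j" using main[OF that(1)] True by blast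
      thus ?thesis using fixed_weak[OF assms that(1) True] by (smt (verit))
    next
      case False
      thus ?thesis using nonsimple[OF that(2)] xx[of i j] that by simp
    qed
    show "deriv_root k n y j \<le> y i \<longleftrightarrow> \<xi> j \<le> x i" if "i < n" "j < n - k" for i j
    proof (cases "j \<in> simple")
      case True
      have "deriv_root k n y j = y i \<longrightarrow> x i = \<xi> j" using main[OF that(1)] True by blast
      thus ?thesis using fixed_weak[OF assms that(1) True] by (smt (verit))
    next
      case False
      thus ?thesis using nonsimple[OF that(2)] xx[of j i] that by simp
    qed
  qed
qed

lemma same_patternD:
  assumes "same_pattern k n y x"
  shows "i < n \<Longrightarrow> i' < n \<Longrightarrow> y i \<le> y i' \<longleftrightarrow> x i \<le> x i'"
    "i < n \<Longrightarrow> j < n - k \<Longrightarrow> y i \<le> deriv_root k n y j \<longleftrightarrow> x i \<le> \<xi> j"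
    "i < n \<Longrightarrow> j < n - k \<Longrightarrow> deriv_root k n y j \<le> y i \<longleftrightarrow> \<xi> j \<le> x i"
proof -
  have *: "node k n y p \<le> node k n y q \<longleftrightarrow> node k n x p \<le> node k n x q" if "p < 2*n-k" "q < 2*n-k" for p q
    using assms that by (simp add: same_pattern_def)
  show "i < n \<Longrightarrow> i' < n \<Longrightarrow> y i \<le> y i' \<longleftrightarrow> x i \<le> x i'"
    using *[of i i'] k by (simp add: node_def)
  show "i < n \<Longrightarrow> j < n - k \<Longrightarrow> y i \<le> deriv_root k n y j \<longleftrightarrow> x i \<le> \<xi> j"
    using *[of i "n + j"] k by (simp add: node_def)
  show "i < n \<Longrightarrow> j < n - k \<Longrightarrow> deriv_root k n y j \<le> y i \<longleftrightarrow> \<xi> j \<le> x i"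
    using *[of "n + j" i] k by (simp add: node_def)
qed

lemma same_pattern_eq:
  assumes "same_pattern k n y x"
  shows "i < n \<Longrightarrow> i' < n \<Longrightarrow> y i = y i' \<longleftrightarrow> x i = x i'"
    "i < n \<Longrightarrow> j < n - k \<Longrightarrow> deriv_root k n y j = y i \<longleftrightarrow> \<xi> j = x i"
  using same_patternD(1)[OF assms, of i i'] same_patternD(1)[OF assms, of i' i]
    same_patternD(2,3)[OF assms, of i j] by force+

lemma lo_topical:
  assumes "sorted_seq n y" "sorted_seq n y'" "\<And>i. i < n \<Longrightarrow> y' i \<le> y i + d"
  shows "lo c y' \<le> lo c y + d"
proof (rule lo_cases[of c y'])
  assume "lo c y' = y' 0"
  thus ?thesis using assms(3)[OF n_pos] lo_ge(1)[of y c] by simp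
next
  fix j assume j: "j \<in> simple" "\<xi> j < c" "lo c y' = deriv_root k n y' j"
  thus ?thesis using deriv_root_topical(1)[OF assms simple_less[OF j(1)]] lo_ge(2)[OF j(1,2), of y] by simp
qed

lemma hi_topical:
  assumes "sorted_seq n y" "sorted_seq n y'" "\<And>i. i < n \<Longrightarrow> y' i \<le> y i + d"
  shows "hi c y' \<le> hi c y + d"
proof (rule hi_cases[of c y])
  assume "hi c y = y (n - 1)"
  thus ?thesis using assms(3)[of "n - 1"] n_pos hi_le(1)[of c y'] by simp
next
  fix j assume j: "j \<in> simple" "c < \<xi> j" "hi c y = deriv_root k n y j"
  thus ?thesis using deriv_root_topical(1)[OF assms simple_less[OF j(1)]] hi_le(2)[OF j(1,2), of y'] by simp
qed

text \<open>Let \<open>d\<close> be the largest displacement \<open>y' i - y i\<close> and suppose that it is positive.  The extreme roots do not move,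
so strict topicality moves every node by less than \<open>d\<close>.  Then every block moves by less than \<open>d\<close> as well.\<close>

lemma fixed_le:
  assumes "fixed s y" "fixed s y'" "params s" "i < n"
  shows "y' i \<le> y i"
proof (rule ccontr)
  assume neg: "\<not> y' i \<le> y i"
  define d where "d = Max ((\<lambda>i. y' i - y i) ` {..<n})"
  have dge: "y' i \<le> y i + d" if "i < n" for i
  proof -
    have "y' i - y i \<le> d" unfolding d_def using that by (intro Max_ge) auto
    thus ?thesis by simp
  qed
  have "d > 0" using dge[OF assms(4)] neg by simp
  have "d \<in> (\<lambda>i. y' i - y i) ` {..<n}" unfolding d_def using n_pos by (intro Max_in) auto
  then obtain l where l: "l < n" "y' l = y l + d" by auto
  have s: "sorted_seq n y" "sorted_seq n y'" by (rule fixed_sorted[OF assms(1)] fixed_sorted[OF assms(2)])+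
  have e: "y' 0 = y 0" "y' (n - 1) = y (n - 1)"
    using fixed_ends_at[OF assms(1)] fixed_ends_at[OF assms(2)] by (auto simp: ends_at_def)
  note sp = fixed_imp_same_pattern[OF assms(1,3)]
  have strict: "deriv_root k n y' j < deriv_root k n y j + d" if j: "j \<in> simple" for j
  proof -
    have "j < n" "j + k < n" using simple_less[OF j] by auto
    hence "y j \<noteq> y (j + k)" using same_pattern_eq(1)[OF sp, of j "j + k"] j by (simp add: simple_def)
    moreover have "\<not> (\<forall>i<n. y' i = y i + d)" using e(1) \<open>d > 0\<close> n_pos by auto
    ultimately show ?thesis
      using deriv_root_topical[OF s dge simple_less[OF j]] k by force
  qed
  show False
  proof (rule value_cases[OF l(1)])
    assume "is_end (x l)"
    hence "y' l = y l" using fixed_value[OF assms(1) l(1)] fixed_value[OF assms(2) l(1)] by (simp add: place_end)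
    thus False using l(2) \<open>d > 0\<close> by simp
  next
    fix j assume j: "j \<in> simple" "\<xi> j = x l"
    have "y l = deriv_root k n y j" "y' l = deriv_root k n y' j"
      using fixed_value[OF assms(1) l(1)] fixed_value[OF assms(2) l(1)] place_simple[OF j(1)] j(2) by auto
    thus False using strict[OF j(1)] l(2) by simp
  next
    assume f: "free (x l)"
    have "lo (x l) y' < lo (x l) y + d"
    proof (rule lo_cases[of "x l" y'])
      assume "lo (x l) y' = y' 0"
      thus ?thesis using e(1) lo_ge(1)[of y "x l"] \<open>d > 0\<close> by simp
    next
      fix j assume j: "j \<in> simple" "\<xi> j < x l" "lo (x l) y' = deriv_root k n y' j"
      thus ?thesis using strict[OF j(1)] lo_ge(2)[OF j(1,2), of y] by simp
    qed
    moreover have "hi (x l) y' \<le> hi (x l) y + d" by (rule hi_topical[OF s dge])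
    moreover define t where "t = s (lead (x l))"
    moreover have t: "0 < t" "t < 1" using assms(3) f by (auto simp: params_def t_def)
    ultimately have "(1 - t) * lo (x l) y' < (1 - t) * (lo (x l) y + d)" "t * hi (x l) y' \<le> t * (hi (x l) y + d)"
      by auto
    hence "y' l < y l + d"
      unfolding fixed_value[OF assms(1) l(1)] fixed_value[OF assms(2) l(1)] place_free[OF f] t_def[symmetric]
      by (simp add: algebra_simps)
    thus False using l(2) by simp
  qed
qed

lemma fixed_unique:
  assumes "fixed s y" "fixed s y'" "params s" "i < n"
  shows "y i = y' i"
  using fixed_le[OF assms] fixed_le[OF assms(2,1,3,4)] by simp

text \<open>The parameters of a configuration; only first indices of blocks carry one, so that the parameters fill an open part of
a coordinate subspace.\<close>

definition param_of :: "(nat \<Rightarrow> real) \<Rightarrow> nat \<Rightarrow> real" where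
  "param_of y i = (if lead (x i) \<noteq> i then 0 else if is_end (x i) then y i
     else if free (x i) then (y i - lo (x i) y) / (hi (x i) y - lo (x i) y) else 0)"

lemma pattern_lo_hi:
  assumes "sorted_seq n y" "same_pattern k n y x" "i < n" "free (x i)"
  shows "lo (x i) y < y i" "y i < hi (x i) y"
proof -
  have ne: "x i \<noteq> x 0" "x i \<noteq> x (n - 1)" using assms(4) by (auto simp: free_def is_end_def)
  show "lo (x i) y < y i"
  proof (rule lo_cases[of "x i" y])
    assume "lo (x i) y = y 0"
    thus ?thesis using same_patternD(1)[OF assms(2,3), of 0] ne x_bounds(1)[OF assms(3)] n_pos by force
  next
    fix j assume "j \<in> simple" "\<xi> j < x i" "lo (x i) y = deriv_root k n y j"
    thus ?thesis using same_patternD(2)[OF assms(2,3) simple_less] by force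
  qed
  show "y i < hi (x i) y"
  proof (rule hi_cases[of "x i" y])
    assume "hi (x i) y = y (n - 1)"
    thus ?thesis using same_patternD(1)[OF assms(2) _ assms(3), of "n - 1"] ne x_bounds(2)[OF assms(3)] n_pos by force
  next
    fix j assume "j \<in> simple" "x i < \<xi> j" "hi (x i) y = deriv_root k n y j"
    thus ?thesis using same_patternD(3)[OF assms(2,3) simple_less] by force
  qed
qed

lemma lead_props:
  assumes "c \<in> x ` {..<n}"
  shows "lead c < n" "x (lead c) = c" "lead (x (lead c)) = lead c"
  using assms lead by (auto intro: le_less_trans)

lemma pattern_blockwise:
  assumes "sorted_seq n y" "same_pattern k n y x"
  shows "blockwise y"
  using assms same_pattern_eq(1)[OF assms(2)] by (auto simp: blockwise_def)

lemma param_of_fixed: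
  assumes "sorted_seq n y" "same_pattern k n y x"
  shows "params (param_of y)" "fixed (param_of y) y"
proof -
  note bw = pattern_blockwise[OF assms]
  have val: "y (lead (x i)) = y i" if "i < n" for i
  proof -
    have "x i \<in> x ` {..<n}" using that by simp
    note l = lead_props[OF this]
    show ?thesis using bw l(1,2) that unfolding blockwise_def by metis
  qed
  have fr: "param_of y (lead c) = (y i - lo c y) / (hi c y - lo c y)" if "free c" "c = x i" "i < n" for c i
  proof -
    have "c \<in> x ` {..<n}" "\<not> is_end c" using that(1) by (auto simp: free_def)
    thus ?thesis using that val[OF that(3)] lead_props[of c] by (simp add: param_of_def)
  qed
  have en: "param_of y (lead c) = y i" if "is_end c" "c = x i" "i < n" for c i
  proof -
    have "c \<in> x ` {..<n}" using that by auto
    thus ?thesis using that val[OF that(3)] lead_props[of c] by (simp add: param_of_def)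
  qed
  have frE: "\<exists>i<n. c = x i" if "free c" for c using that by (auto simp: free_def)
  show "fixed (param_of y) y"
    unfolding fixed_def
  proof (intro conjI bw allI impI)
    fix i assume i: "i < n"
    show "y i = place (param_of y) y (x i)"
    proof (rule value_cases[OF i])
      assume "is_end (x i)" thus ?thesis using en[OF _ refl i] by (simp add: place_end)
    next
      fix j assume j: "j \<in> simple" "\<xi> j = x i"
      thus ?thesis using place_simple[OF j(1)] same_pattern_eq(2)[OF assms(2) i simple_less[OF j(1)]] by simp
    next
      assume f: "free (x i)"
      note p = pattern_lo_hi[OF assms i f]
      define w where "w = hi (x i) y - lo (x i) y"
      have w: "w > 0" "hi (x i) y = lo (x i) y + w" using p by (auto simp: w_def)
      show ?thesis unfolding place_free[OF f] fr[OF f refl i] w_def[symmetric] w(2)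
        using w(1) by (simp add: field_simps)
    qed
  qed
  show "params (param_of y)"
    unfolding params_def
  proof (intro conjI allI impI)
    assume lt: "x 0 < x (n - 1)"
    have "y 0 < y (n - 1)" using same_patternD(1)[OF assms(2), of "n - 1" 0] lt n_pos by force
    thus "param_of y 0 < param_of y (lead (x (n - 1)))"
      using en[of "x 0" 0] en[of "x (n - 1)" "n - 1"] n_pos by (simp add: is_end_def)
  next
    fix c assume f: "free c"
    then obtain i where i: "i < n" "c = x i" using frE by blast
    note p = pattern_lo_hi[OF assms i(1) f[unfolded i(2)], folded i(2)]
    show "0 < param_of y (lead c)" "param_of y (lead c) < 1"
      unfolding fr[OF f i(2,1)] using p by simp_all
  next
    fix c d assume f: "free c" "free d" "c < d" "\<forall>j\<in>simple. \<not> (c < \<xi> j \<and> \<xi> j < d)"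
    obtain i where i: "i < n" "c = x i" using frE f by blast
    obtain i' where i': "i' < n" "d = x i'" using frE f by blast
    note p = pattern_lo_hi[OF assms i(1) f(1)[unfolded i(2)], folded i(2)]
    have "y i < y i'" using same_patternD(1)[OF assms(2) i'(1) i(1)] f i i' by force
    thus "param_of y (lead c) < param_of y (lead d)"
      unfolding fr[OF f(1) i(2,1)] fr[OF f(2) i'(2,1)] same_gap[OF f, symmetric]
      using p \<open>y i < y i'\<close> by (intro divide_strict_right_mono) auto
  qed
qed

definition param_index :: "nat set" where
  "param_index = {i. i < n \<and> lead (x i) = i \<and> (is_end (x i) \<or> free (x i))}"

lemma param_of_inverse:
  assumes "params s" "fixed s y" "\<And>i. i < n \<Longrightarrow> i \<notin> param_index \<Longrightarrow> s i = 0" "i < n"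
  shows "param_of y i = s i"
proof (cases "i \<in> param_index")
  case True
  hence i: "i < n" "lead (x i) = i" "is_end (x i) \<or> free (x i)" by (auto simp: param_index_def)
  have v: "y i = place s y (x i)" using fixed_value[OF assms(2) i(1)] .
  show ?thesis
  proof (cases "is_end (x i)")
    case True
    thus ?thesis using v i by (simp add: param_of_def place_end)
  next
    case False
    hence f: "free (x i)" using i by simp
    have y: "sorted_seq n y" by (rule fixed_sorted[OF assms(2)])
    note p = pattern_lo_hi[OF y fixed_imp_same_pattern[OF assms(2,1)] i(1) f]
    define w where "w = hi (x i) y - lo (x i) y"
    have w: "w > 0" "hi (x i) y = lo (x i) y + w" using p by (auto simp: w_def)
    have "y i - lo (x i) y = s i * w" using v i unfolding place_free[OF f] w(2) by (simp add: algebra_simps)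
    thus ?thesis using False f i w by (simp add: param_of_def w_def[symmetric])
  qed
next
  case False
  hence "param_of y i = 0" using assms(4) by (auto simp: param_of_def param_index_def)
  thus ?thesis using assms(3)[OF assms(4) False] by simp
qed

end

section \<open>Coefficient vectors, root vectors and continuity\<close>

text \<open>Vectors indexed by the linearly ordered type serve as sequences of length \<open>CARD('n)\<close> numbered from 0, whereas
\<open>coord_pos\<close> counts from 1.\<close>

definition seq_of :: "real ^ 'n::{finite,linorder} \<Rightarrow> nat \<Rightarrow> real" where
  "seq_of y m = y $ (inv coord_pos (Suc m))"

definition vec_of :: "(nat \<Rightarrow> real) \<Rightarrow> real ^ 'n::{finite,linorder}" where
  "vec_of f = (\<chi> i. f (coord_pos i - 1))"

lemma coord_pos_less_iff: "coord_pos i < coord_pos j \<longleftrightarrow> i < (j :: 'n::{finite,linorder})"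
proof -
  have "coord_pos i < coord_pos j" if "i < j" for i j :: 'n
    unfolding coord_pos_def 
  proof (rule psubset_card_mono)
    have "j \<in> {l. l \<le> j}" "j \<notin> {l. l \<le> i}" using that by auto
    moreover have "{l. l \<le> i} \<subseteq> {l. l \<le> j}" using that by auto
    ultimately show "{l. l \<le> i} \<subset> {l. l \<le> j}" by blast
  qed simp
  thus ?thesis by (metis less_imp_not_less not_less_iff_gr_or_eq)
qed

lemma bij_coord_pos: "bij_betw (coord_pos :: 'n::{finite,linorder} \<Rightarrow> nat) UNIV {1..CARD('n)}"
proof -
  have inj: "inj (coord_pos :: 'n \<Rightarrow> nat)"
    by (rule injI) (metis coord_pos_less_iff less_irrefl neq_iff)
  have pos: "coord_pos i \<in> {1..CARD('n)}" for i :: 'n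
  proof -
    have "card {i} \<le> coord_pos i" unfolding coord_pos_def by (rule card_mono) auto
    moreover have "coord_pos i \<le> CARD('n)" unfolding coord_pos_def by (rule card_mono) auto
    ultimately show ?thesis by simp
  qed
  hence "range (coord_pos :: 'n \<Rightarrow> nat) = {1..CARD('n)}"
    using inj by (intro card_subset_eq) (auto simp: card_image)
  thus ?thesis using inj by (simp add: bij_betw_def)
qed

lemma coord_pos_bounds: "1 \<le> coord_pos i" "coord_pos i \<le> CARD('n)" for i :: "'n::{finite,linorder}"
  using bij_coord_pos[where 'n='n] by (auto simp: bij_betw_def)

lemma coord_pos_inv:
  assumes "m < CARD('n::{finite,linorder})"
  shows "coord_pos (inv coord_pos (Suc m) :: 'n) = Suc m"
proof -
  have "Suc m \<in> range (coord_pos :: 'n \<Rightarrow> nat)"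
    using bij_coord_pos[where 'n='n] assms by (auto simp: bij_betw_def)
  thus ?thesis by (rule f_inv_into_f)
qed

lemma inv_coord_pos: "inv coord_pos (coord_pos i) = (i :: 'n::{finite,linorder})"
  using bij_coord_pos[where 'n='n] by (simp add: bij_betw_def)

lemma seq_of_vec_of: "m < CARD('n) \<Longrightarrow> seq_of (vec_of f :: real ^ 'n::{finite,linorder}) m = f m"
  by (simp add: seq_of_def vec_of_def coord_pos_inv)

lemma seq_of_coord_pos: "seq_of y (coord_pos i - 1) = y $ i"
  using coord_pos_bounds[of i] by (simp add: seq_of_def inv_coord_pos)

lemma vec_eqI_seq:
  assumes "\<And>m. m < CARD('n) \<Longrightarrow> seq_of y m = seq_of z m"
  shows "y = (z :: real ^ 'n::{finite,linorder})"
proof -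
  have "y $ i = z $ i" for i
  proof -
    have "coord_pos i - 1 < CARD('n)" using coord_pos_bounds[of i] by linarith
    from assms[OF this] show ?thesis by (simp only: seq_of_coord_pos)
  qed
  thus ?thesis by (simp add: vec_eq_iff)
qed

lemma seq_of_linear [simp]:
  "seq_of (y + z) m = seq_of y m + seq_of z m" "seq_of (y - z) m = seq_of y m - seq_of z m"
  "seq_of (c *\<^sub>R y) m = c * seq_of y m" "seq_of 0 m = 0"
  by (simp_all add: seq_of_def)

lemma abs_seq_of_le: "\<bar>seq_of y m\<bar> \<le> norm y"
  unfolding seq_of_def using component_le_norm_cart[of y] by blast

lemma continuous_on_seq_of [continuous_intros]:
  "continuous_on S f \<Longrightarrow> continuous_on S (\<lambda>z. seq_of (f z) m)"
  unfolding seq_of_def by (intro continuous_intros)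

lemma continuous_on_vec_of:
  assumes "\<And>m. m < CARD('n) \<Longrightarrow> continuous_on S (\<lambda>z. f z m)"
  shows "continuous_on S (\<lambda>z. vec_of (f z) :: real ^ 'n::{finite,linorder})"
  unfolding vec_of_def
proof (rule continuous_on_vec_lambda)
  fix i :: 'n show "continuous_on S (\<lambda>z. f z (coord_pos i - 1))"
    using assms[of "coord_pos i - 1"] coord_pos_bounds[of i] by simp
qed

lemma coeff_monic_poly_of:
  fixes a :: "real ^ 'n::{finite,linorder}"
  shows "coeff (monic_poly_of a) (CARD('n) - coord_pos i) = a $ i"
    and "coeff (monic_poly_of a) CARD('n) = 1"
    and "j > CARD('n) \<Longrightarrow> coeff (monic_poly_of a) j = 0"
proof -
  have c: "coeff (monic_poly_of a) j = (if CARD('n) = j then 1 else 0) + (\<Sum>i\<in>UNIV. if CARD('n) - coord_pos i = j then a $ i else 0)" for j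
    by (simp add: monic_poly_of_def coeff_sum)
  have e: "CARD('n) - coord_pos j = CARD('n) - coord_pos i \<longleftrightarrow> j = i" for i j :: 'n
    using coord_pos_bounds[of i] coord_pos_bounds[of j] inv_coord_pos by (metis diff_diff_cancel)
  have "CARD('n) \<noteq> CARD('n) - coord_pos i" using coord_pos_bounds[of i] by simp
  thus "coeff (monic_poly_of a) (CARD('n) - coord_pos i) = a $ i" unfolding c by (simp add: e)
  have "\<And>i::'n. CARD('n) - coord_pos i \<noteq> CARD('n)" using coord_pos_bounds by (metis diff_less leD not_one_le_zero order_refl zero_less_card_finite gr0I)
  thus "coeff (monic_poly_of a) CARD('n) = 1" unfolding c by simp
  show "j > CARD('n) \<Longrightarrow> coeff (monic_poly_of a) j = 0" unfolding c by (auto intro!: sum.neutral)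
qed

lemma degree_monic_poly_of [simp]: "degree (monic_poly_of a) = CARD('n)" for a :: "real ^ 'n::{finite,linorder}"
  using coeff_monic_poly_of(2,3)[where a = a] by (metis le_degree degree_le le_antisym zero_neq_one)

definition coeffs_of_roots :: "real ^ 'n::{finite,linorder} \<Rightarrow> real ^ 'n::{finite,linorder}" where
  "coeffs_of_roots y = (\<chi> i. coeff (root_poly CARD('n) (seq_of y)) (CARD('n) - coord_pos i))"

lemma monic_poly_of_eqI:
  fixes p :: "real poly"
  assumes "degree p = CARD('n)" "coeff p CARD('n) = 1"
    "\<And>i. a $ i = coeff p (CARD('n) - coord_pos i)"
  shows "monic_poly_of (a :: real ^ 'n::{finite,linorder}) = p"
proof (rule poly_eqI)
  fix j
  consider "j > CARD('n)" | "j = CARD('n)" | "j < CARD('n)" by linarith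
  thus "coeff (monic_poly_of a) j = coeff p j"
  proof cases
    case 3
    define i where "i = (inv coord_pos (Suc (CARD('n) - j - 1)) :: 'n)"
    have "coord_pos i = CARD('n) - j" unfolding i_def using 3 by (subst coord_pos_inv) auto
    hence "j = CARD('n) - coord_pos i" using 3 by simp
    thus ?thesis using assms(3)[of i] by (simp add: coeff_monic_poly_of)
  qed (use assms coeff_monic_poly_of[where a = a] in \<open>auto simp: coeff_eq_0\<close>)
qed

lemma monic_poly_of_coeffs_of_roots:
  "monic_poly_of (coeffs_of_roots y) = root_poly CARD('n) (seq_of (y :: real ^ 'n::{finite,linorder}))"
  by (rule monic_poly_of_eqI) (auto simp: coeffs_of_roots_def)

lemma monic_poly_of_inj: "monic_poly_of a = monic_poly_of b \<longleftrightarrow> a = (b :: real ^ 'n::{finite,linorder})"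
  by (metis coeff_monic_poly_of(1) vec_eq_iff)

lemma continuous_on_coeffs_of_roots: 
  "continuous_on S (coeffs_of_roots :: real ^ 'n::{finite,linorder} \<Rightarrow> real ^ 'n::{finite,linorder})"
proof -
  have "continuous_on S (\<lambda>y :: (real, 'n) vec. coeff (root_poly m (seq_of y)) j)" for m j
  proof (induction m arbitrary: j)
    case (Suc m)
    have "coeff (root_poly (Suc m) (seq_of y)) j =
       (if j = 0 then 0 else coeff (root_poly m (seq_of y)) (j - 1)) - seq_of y m * coeff (root_poly m (seq_of y)) j" for y :: "(real, 'n) vec"
      by (simp add: root_poly_Suc coeff_pCons split: nat.split)
    thus ?case using Suc by (cases "j = 0") (auto intro!: continuous_intros)
  qed simp
  thus ?thesis unfolding coeffs_of_roots_def by (intro continuous_on_vec_lambda)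
qed

text \<open>Cauchy's bound: for \<open>\<bar>z\<bar> > 1\<close> all lower powers of \<open>z\<close> are dominated by the power just below the leading one.\<close>

lemma root_bound:
  fixes a :: "real ^ 'n::{finite,linorder}"
  assumes "poly (monic_poly_of a) z = 0"
  shows "\<bar>z\<bar> \<le> 1 + (\<Sum>i\<in>UNIV. \<bar>a $ i\<bar>)"
proof (cases "\<bar>z\<bar> \<le> 1")
  case True
  thus ?thesis by (smt (verit) sum_nonneg abs_ge_zero)
next
  case False
  let ?n = "CARD('n)"
  have "z ^ ?n + (\<Sum>i\<in>UNIV. a $ i * z ^ (?n - coord_pos i)) = 0"
    using assms by (simp add: monic_poly_of_def poly_sum poly_monom)
  hence "\<bar>z\<bar> ^ ?n = \<bar>\<Sum>i\<in>UNIV. a $ i * z ^ (?n - coord_pos i)\<bar>"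
    by (simp add: power_abs[symmetric] eq_neg_iff_add_eq_0[symmetric])
  also have "\<dots> \<le> (\<Sum>i\<in>UNIV. \<bar>a $ i * z ^ (?n - coord_pos i)\<bar>)" by (rule sum_abs)
  also have "\<dots> \<le> (\<Sum>i\<in>UNIV. \<bar>a $ i\<bar> * \<bar>z\<bar> ^ (?n - 1))"
  proof (rule sum_mono)
    fix i :: 'n
    have "\<bar>z\<bar> ^ (?n - coord_pos i) \<le> \<bar>z\<bar> ^ (?n - 1)"
      using False coord_pos_bounds[of i] by (intro power_increasing) auto
    thus "\<bar>a $ i * z ^ (?n - coord_pos i)\<bar> \<le> \<bar>a $ i\<bar> * \<bar>z\<bar> ^ (?n - 1)"
      by (simp add: abs_mult power_abs mult_left_mono)
  qed
  also have "\<dots> = (\<Sum>i\<in>UNIV. \<bar>a $ i\<bar>) * \<bar>z\<bar> ^ (?n - 1)" by (simp add: sum_distrib_right)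
  finally have "\<bar>z\<bar> * \<bar>z\<bar> ^ (?n - 1) \<le> (\<Sum>i\<in>UNIV. \<bar>a $ i\<bar>) * \<bar>z\<bar> ^ (?n - 1)"
    by (simp flip: power_Suc)
  moreover have "\<bar>z\<bar> ^ (?n - 1) > 0" using False by simp
  ultimately show ?thesis by simp
qed

text \<open>Locally the function takes values in a compact set because \<open>\<beta>\<close> is bounded on balls, and there a function with closed
graph is continuous.\<close>

lemma continuous_on_implicit:
  fixes \<psi> :: "'a::euclidean_space \<Rightarrow> 'b::euclidean_space" and G :: "'a \<times> 'b \<Rightarrow> 'c::real_normed_vector"
  assumes "closed B" and G: "continuous_on (S \<times> B) G"
    and sol: "\<And>s. s \<in> S \<Longrightarrow> \<psi> s \<in> B" "\<And>s. s \<in> S \<Longrightarrow> G (s, \<psi> s) = 0"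
    and uniq: "\<And>s y. s \<in> S \<Longrightarrow> y \<in> B \<Longrightarrow> G (s, y) = 0 \<Longrightarrow> y = \<psi> s"
    and bd: "\<And>s. s \<in> S \<Longrightarrow> norm (\<psi> s) \<le> \<beta> s" "continuous_on UNIV \<beta>"
  shows "continuous_on S \<psi>"
proof -
  have "continuous (at s within S) \<psi>" if "s \<in> S" for s
  proof -
    define S' where "S' = S \<inter> ball s 1"
    have "compact (\<beta> ` cball s 1)" 
      by (rule compact_continuous_image) (use bd(2) continuous_on_subset in blast, simp)
    hence "bounded (\<beta> ` cball s 1)" by (rule compact_imp_bounded)
    then obtain M where M: "\<And>t. t \<in> cball s 1 \<Longrightarrow> \<bar>\<beta> t\<bar> \<le> M" unfolding bounded_iff by (auto simp del: mem_cball)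
    define T where "T = B \<inter> cball 0 M"
    have T: "compact T" unfolding T_def using assms(1) by (intro closed_Int_compact) auto
    have im: "\<psi> \<in> S' \<rightarrow> T"
    proof
      fix t assume t: "t \<in> S'"
      hence "t \<in> S" "t \<in> cball s 1" by (auto simp: S'_def)
      thus "\<psi> t \<in> T" using sol(1)[of t] bd(1)[of t] M[of t] by (simp add: T_def)
    qed
    have eq: "(\<lambda>s. (s, \<psi> s)) ` S' = {z \<in> S' \<times> T. G z = 0}"
      using sol uniq im unfolding S'_def T_def by auto
    have "continuous_on (S' \<times> T) G" by (rule continuous_on_subset[OF G]) (auto simp: S'_def T_def)
    hence "closedin (top_of_set (S' \<times> T)) {z \<in> S' \<times> T. G z = 0}"
      by (rule continuous_closedin_preimage_constant)
    hence "continuous_on S' \<psi>" using continuous_closed_graph_eq[OF T im] eq by simp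
    hence "continuous (at s within S') \<psi>"
      using that by (simp add: continuous_on_eq_continuous_within S'_def)
    moreover have "at s within S' = at s within S"
      unfolding S'_def by (rule at_within_nhd[of _ "ball s 1"]) auto
    ultimately show ?thesis by simp
  qed
  thus ?thesis by (simp add: continuous_on_eq_continuous_within)
qed

lemma closed_sorted: "closed {y :: real ^ 'n::{finite,linorder}. sorted_seq m (seq_of y)}"
proof -
  have eq: "{y :: (real, 'n) vec. sorted_seq m (seq_of y)} =
    (\<Inter>i. \<Inter>j. {y. i \<le> j \<longrightarrow> j < m \<longrightarrow> seq_of y i \<le> seq_of y j})"
    by (auto simp: sorted_seq_def)
  have "closed {y :: (real, 'n) vec. i \<le> j \<longrightarrow> j < m \<longrightarrow> seq_of y i \<le> seq_of y j}" for i j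
    by (cases "i \<le> j \<and> j < m") (auto intro!: closed_Collect_le continuous_intros)
  thus ?thesis unfolding eq by (intro closed_INT ballI)
qed

text \<open>A topical function is 1-Lipschitz for the maximum norm.\<close>

lemma continuous_on_topical:
  fixes F :: "(nat \<Rightarrow> real) \<Rightarrow> real"
  assumes "\<And>y y' d. sorted_seq n y \<Longrightarrow> sorted_seq n y' \<Longrightarrow> (\<And>i. i < n \<Longrightarrow> y' i \<le> y i + d) \<Longrightarrow> F y' \<le> F y + d"
  shows "continuous_on {y :: real ^ 'n::{finite,linorder}. sorted_seq n (seq_of y)} (\<lambda>y. F (seq_of y))"
proof -
  have le: "F (seq_of y') \<le> F (seq_of y) + dist y' y"
    if "sorted_seq n (seq_of y)" "sorted_seq n (seq_of y')" for y y' :: "(real, 'n) vec"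
  proof (rule assms[OF that])
    fix i
    have "seq_of y' i - seq_of y i \<le> dist y' y"
      using abs_seq_of_le[of "y' - y" i] by (simp add: dist_norm)
    thus "seq_of y' i \<le> seq_of y i + dist y' y" by simp
  qed
  show ?thesis
    unfolding continuous_on_iff
  proof (intro ballI allI impI)
    fix y :: "(real, 'n) vec" and e :: real assume y: "y \<in> {y. sorted_seq n (seq_of y)}" and e: "0 < e"
    show "\<exists>d>0. \<forall>y'\<in>{y. sorted_seq n (seq_of y)}. dist y' y < d \<longrightarrow> dist (F (seq_of y')) (F (seq_of y)) < e"
    proof (intro exI[of _ e] conjI e ballI impI)
      fix y' assume "y' \<in> {y. sorted_seq n (seq_of y)}" "dist y' y < e"
      thus "dist (F (seq_of y')) (F (seq_of y)) < e"
        using le[of y y'] le[of y' y] y by (simp add: dist_real_def dist_commute)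
    qed
  qed
qed

lemma norm_le_seq:
  fixes y :: "real ^ 'n::{finite,linorder}"
  assumes "\<And>m. m < CARD('n) \<Longrightarrow> \<bar>seq_of y m\<bar> \<le> b"
  shows "norm y \<le> real CARD('n) * b"
proof -
  have "\<bar>y $ i\<bar> \<le> b" for i
  proof -
    have "coord_pos i - 1 < CARD('n)" using coord_pos_bounds[of i] by linarith
    from assms[OF this] show ?thesis by (simp only: seq_of_coord_pos)
  qed
  hence "(\<Sum>i\<in>UNIV. \<bar>y $ i\<bar>) \<le> (\<Sum>i\<in>(UNIV :: 'n set). b)" by (intro sum_mono)
  thus ?thesis using norm_le_l1_cart[of y] by simp
qed

definition sorted_vecs :: "(real ^ 'n::{finite,linorder}) set" where
  "sorted_vecs = {y. sorted_seq CARD('n) (seq_of y)}"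

definition split_polys :: "(real ^ 'n::{finite,linorder}) set" where
  "split_polys = {a. \<exists>y\<in>sorted_vecs. monic_poly_of a = root_poly CARD('n) (seq_of (y :: (real, 'n) vec))}"

definition roots_vec :: "real ^ 'n::{finite,linorder} \<Rightarrow> real ^ 'n::{finite,linorder}" where
  "roots_vec a = (SOME y. y \<in> sorted_vecs \<and> monic_poly_of a = root_poly CARD('n) (seq_of y))"

lemma roots_vec:
  assumes "a \<in> split_polys"
  shows "roots_vec a \<in> sorted_vecs" "monic_poly_of a = root_poly CARD('n) (seq_of (roots_vec (a :: real ^ 'n::{finite,linorder})))"
proof -
  have "\<exists>y. y \<in> sorted_vecs \<and> monic_poly_of a = root_poly CARD('n) (seq_of (y :: (real, 'n) vec))"
    using assms by (auto simp: split_polys_def)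
  from someI_ex[OF this] show "roots_vec a \<in> sorted_vecs" "monic_poly_of a = root_poly CARD('n) (seq_of (roots_vec a))"
    unfolding roots_vec_def by auto
qed

lemma roots_vec_unique:
  fixes y :: "real ^ 'n::{finite,linorder}"
  assumes "y \<in> sorted_vecs" "monic_poly_of a = root_poly CARD('n) (seq_of y)"
  shows "roots_vec a = y"
proof -
  have "a \<in> split_polys" using assms by (auto simp: split_polys_def)
  note r = roots_vec[OF this]
  show ?thesis
  proof (rule vec_eqI_seq)
    fix m assume "m < CARD('n)"
    thus "seq_of (roots_vec a) m = seq_of y m"
      by (rule root_poly_inj[rotated 3]) (use r assms in \<open>auto simp: sorted_vecs_def\<close>)
  qed
qed

lemma monic_poly_of_eq_iff:
  "monic_poly_of a = root_poly CARD('n) (seq_of y) \<longleftrightarrow> coeffs_of_roots y = (a :: real ^ 'n::{finite,linorder})"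
  using monic_poly_of_coeffs_of_roots monic_poly_of_inj by metis

text \<open>Roots depend continuously on coefficients: the root vector is the unique sorted solution of a closed equation, and it is
locally bounded.\<close>

lemma continuous_on_roots_vec:
  "continuous_on split_polys (roots_vec :: real ^ 'n::{finite,linorder} \<Rightarrow> real ^ 'n::{finite,linorder})"
proof (rule continuous_on_implicit[where B = sorted_vecs and G = "\<lambda>z. coeffs_of_roots (snd z) - fst z"
     and \<beta> = "\<lambda>a. real CARD('n) * (1 + (\<Sum>i\<in>UNIV. \<bar>a $ i\<bar>))"])
  show "closed (sorted_vecs :: (real, 'n) vec set)" unfolding sorted_vecs_def by (rule closed_sorted)
  show "continuous_on (split_polys \<times> sorted_vecs) (\<lambda>z. coeffs_of_roots (snd z :: (real, 'n) vec) - fst z)"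
    by (intro continuous_intros continuous_on_compose2[OF continuous_on_coeffs_of_roots]) auto
  show "continuous_on UNIV (\<lambda>a :: (real, 'n) vec. real CARD('n) * (1 + (\<Sum>i\<in>UNIV. \<bar>a $ i\<bar>)))"
    by (intro continuous_intros)
  fix a :: "(real, 'n) vec" assume a: "a \<in> split_polys"
  note r = roots_vec[OF a]
  show "roots_vec a \<in> sorted_vecs" by (rule r)
  show "coeffs_of_roots (snd (a, roots_vec a)) - fst (a, roots_vec a) = 0"
    using r(2) by (simp add: monic_poly_of_eq_iff)
  show "y = roots_vec a" if "y \<in> sorted_vecs" "coeffs_of_roots (snd (a, y)) - fst (a, y) = 0" for y
    using roots_vec_unique[OF that(1), of a] that(2) by (simp add: monic_poly_of_eq_iff)
  show "norm (roots_vec a) \<le> real CARD('n) * (1 + (\<Sum>i\<in>UNIV. \<bar>a $ i\<bar>))"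
  proof (rule norm_le_seq)
    fix m assume "m < CARD('n)"
    hence "poly (monic_poly_of a) (seq_of (roots_vec a) m) = 0"
      unfolding r(2) poly_root_poly_eq_0_iff by blast
    thus "\<bar>seq_of (roots_vec a) m\<bar> \<le> 1 + (\<Sum>i\<in>UNIV. \<bar>a $ i\<bar>)" by (rule root_bound)
  qed
qed

section \<open>The chart of a stratum\<close>

text \<open>The type argument ties the degree to the index type of the coefficient vectors.\<close>

locale stratum_chart = sorted_roots n k x for n k x +
  fixes type_n :: "'n::{finite,linorder} itself"
  assumes n_card: "n = CARD('n)"
begin

definition coord_space :: "((real, 'n) vec) set" where
  "coord_space = {s. \<forall>m<n. m \<notin> param_index \<longrightarrow> seq_of s m = 0}"

definition param_space :: "((real, 'n) vec) set" where
  "param_space = coord_space \<inter> {s. params (seq_of s)}"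

definition pattern_stratum :: "((real, 'n) vec) set" where
  "pattern_stratum = {a. \<exists>y. sorted_seq n y \<and> monic_poly_of a = root_poly n y \<and> same_pattern k n y x}"

lemma subspace_coord_space: "subspace coord_space"
  by (auto simp: coord_space_def subspace_def)

lemma dim_coord_space: "dim coord_space = card param_index"
proof -
  define ax where "ax m = (axis (inv coord_pos (Suc m)) 1 :: (real, 'n) vec)" for m
  have pi: "m < n" if "m \<in> param_index" for m using that by (auto simp: param_index_def)
  have ax_eq: "ax (coord_pos i - 1) = axis i 1" for i
    using coord_pos_bounds[of i] by (simp add: ax_def inv_coord_pos)
  have ax_inj: "ax m = ax m' \<longleftrightarrow> m = m'" if "m < n" "m' < n" for m m'
    using that coord_pos_inv[where 'n='n, folded n_card] unfolding ax_def axis_eq_axis by (metis nat.inject zero_neq_one)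
  have eq: "coord_space = {v. \<forall>b\<in>Basis. b \<notin> ax ` param_index \<longrightarrow> v \<bullet> b = 0}"
  proof (intro equalityI subsetI CollectI ballI impI)
    fix v b assume v: "v \<in> coord_space" and b: "(b :: (real, 'n) vec) \<in> Basis" "b \<notin> ax ` param_index"
    obtain i where i: "b = axis i 1" using b(1) by (auto simp: Basis_vec_def)
    have "coord_pos i - 1 < n" using coord_pos_bounds[of i] n_card by simp
    moreover have "coord_pos i - 1 \<notin> param_index" using b(2) ax_eq[of i] i by (metis imageI)
    ultimately have "seq_of v (coord_pos i - 1) = 0" using v by (auto simp: coord_space_def)
    thus "v \<bullet> b = 0" unfolding seq_of_coord_pos i by (simp add: inner_axis)
  next
    fix v assume v: "v \<in> {v. \<forall>b\<in>Basis. b \<notin> ax ` param_index \<longrightarrow> v \<bullet> b = 0}"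
    show "v \<in> coord_space"
      unfolding coord_space_def
    proof (intro CollectI allI impI)
      fix m assume m: "m < n" "m \<notin> param_index"
      have "ax m \<in> Basis" by (simp add: ax_def axis_in_Basis_iff)
      moreover have "ax m \<notin> ax ` param_index" using m ax_inj[OF m(1) pi] by (auto simp: image_iff)
      ultimately have "v \<bullet> ax m = 0" using v by blast
      thus "seq_of v m = 0" by (simp add: ax_def seq_of_def inner_axis)
    qed
  qed
  have sub: "ax ` param_index \<subseteq> Basis" by (auto simp: ax_def axis_in_Basis_iff)
  have crd: "card (ax ` param_index) = card param_index"
    using ax_inj[OF pi pi] by (intro card_image inj_onI) simp
  show ?thesis unfolding eq dim_substandard[OF sub] crd ..
qed

lemma finite_free: "finite {c. free c}"
  by (rule finite_subset[of _ "x ` {..<n}"]) (auto simp: free_def)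

lemma open_params: "open {s :: (real, 'n) vec. params (seq_of s)}"
proof -
  have eq: "{s :: (real, 'n) vec. params (seq_of s)} =
     {s. x 0 < x (n - 1) \<longrightarrow> seq_of s 0 < seq_of s (lead (x (n - 1)))} \<inter>
     (\<Inter>c\<in>{c. free c}. {s. 0 < seq_of s (lead c)} \<inter> {s. seq_of s (lead c) < 1}) \<inter>
     (\<Inter>c\<in>{c. free c}. \<Inter>d\<in>{c. free c}. {s. c < d \<longrightarrow> (\<forall>j\<in>simple. \<not> (c < \<xi> j \<and> \<xi> j < d))
        \<longrightarrow> seq_of s (lead c) < seq_of s (lead d)})"
    unfolding params_def by blast
  have imp: "open {s :: (real, 'n) vec. A \<longrightarrow> seq_of s i < seq_of s j}" for A i j
    by (cases A) (auto intro!: open_Collect_less continuous_intros)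
  have imp2: "open {s :: (real, 'n) vec. A \<longrightarrow> B \<longrightarrow> seq_of s i < seq_of s j}" for A B i j
    using imp[of "A \<and> B" i j] unfolding imp_conjL .
  show ?thesis
    unfolding eq
    by (intro open_Int open_INT finite_free ballI imp imp2 open_Collect_less continuous_intros)
qed

lemma openin_param_space: "openin (top_of_set coord_space) param_space"
  unfolding param_space_def using open_params by (simp add: openin_open_Int)

lemma convex_param_space: "convex param_space"
proof -
  have mix: "u * a + v * a' < u * b + v * (b' :: real)"
    if "0 \<le> u" "0 \<le> v" "u + v = 1" "a < b" "a' < b'" for u v a a' b b'
  proof (cases "u = 0")
    case False
    hence "u * a < u * b" "v * a' \<le> v * b'" using that by (auto intro: mult_left_mono)
    thus ?thesis by simp
  qed (use that in auto)
  have "convex {s :: (real, 'n) vec. params (seq_of s)}"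
  proof (rule convexI)
    fix s s' :: "(real, 'n) vec" and u v :: real
    assume s: "s \<in> {s. params (seq_of s)}" "s' \<in> {s. params (seq_of s)}" and uv: "0 \<le> u" "0 \<le> v" "u + v = 1"
    have "0 < u * seq_of s (lead c) + v * seq_of s' (lead c)" 
      "u * seq_of s (lead c) + v * seq_of s' (lead c) < 1" if "free c" for c
      using mix[OF uv, of 0 "seq_of s (lead c)" 0 "seq_of s' (lead c)"]
        mix[OF uv, of "seq_of s (lead c)" 1 "seq_of s' (lead c)" 1] s that uv(3) by (auto simp: params_def)
    thus "u *\<^sub>R s + v *\<^sub>R s' \<in> {s. params (seq_of s)}"
      using s unfolding params_def mem_Collect_eq by (auto intro!: mix[OF uv])
  qed
  thus ?thesis unfolding param_space_def
    by (rule convex_Int[OF subspace_imp_convex[OF subspace_coord_space]])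
qed

definition blockwise_vecs :: "((real, 'n) vec) set" where
  "blockwise_vecs = {y. blockwise (seq_of y)}"

lemma blockwise_vecs_sorted: "blockwise_vecs \<subseteq> sorted_vecs"
  by (auto simp: blockwise_vecs_def sorted_vecs_def blockwise_def n_card[symmetric])

lemma closed_blockwise: "closed blockwise_vecs"
proof -
  have eq: "blockwise_vecs = {y. sorted_seq n (seq_of y)} \<inter>
      (\<Inter>i. \<Inter>i'. {y :: (real, 'n) vec. i < n \<and> i' < n \<and> x i = x i' \<longrightarrow> seq_of y i = seq_of y i'})"
    unfolding blockwise_vecs_def blockwise_def by blast
  have "closed {y :: (real, 'n) vec. i < n \<and> i' < n \<and> x i = x i' \<longrightarrow> seq_of y i = seq_of y i'}" for i i'
    by (cases "i < n \<and> i' < n \<and> x i = x i'") (auto intro!: closed_Collect_eq continuous_intros)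
  thus ?thesis unfolding eq by (intro closed_Int closed_sorted closed_INT ballI)
qed

lemma convex_blockwise: "convex blockwise_vecs"
proof (rule convexI)
  fix y z :: "(real, 'n) vec" and u v :: real
  assume yz: "y \<in> blockwise_vecs" "z \<in> blockwise_vecs" and uv: "0 \<le> u" "0 \<le> v" "u + v = 1"
  have "u * seq_of y i + v * seq_of z i \<le> u * seq_of y j + v * seq_of z j" if "i \<le> j" "j < n" for i j
  proof -
    have "sorted_seq n (seq_of y)" "sorted_seq n (seq_of z)"
      using yz unfolding blockwise_vecs_def blockwise_def by blast+
    thus ?thesis using sorted_seqD that uv by (intro add_mono mult_left_mono) blast+
  qed
  moreover have "u * seq_of y i + v * seq_of z i = u * seq_of y j + v * seq_of z j" if "i < n" "j < n" "x i = x j" for i j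
  proof -
    have "seq_of y i = seq_of y j" "seq_of z i = seq_of z j"
      using yz that unfolding blockwise_vecs_def blockwise_def by blast+
    thus ?thesis by simp
  qed
  ultimately show "u *\<^sub>R y + v *\<^sub>R z \<in> blockwise_vecs"
    unfolding blockwise_vecs_def blockwise_def sorted_seq_def mem_Collect_eq seq_of_linear by blast
qed

lemma continuous_on_deriv_root: "j < n - k \<Longrightarrow> continuous_on sorted_vecs (\<lambda>y :: (real, 'n) vec. deriv_root k n (seq_of y) j)"
  unfolding sorted_vecs_def n_card[symmetric]
  by (rule continuous_on_topical) (rule deriv_root_topical(1))

lemma continuous_on_lo: "continuous_on sorted_vecs (\<lambda>y :: (real, 'n) vec. lo c (seq_of y))"
  unfolding sorted_vecs_def n_card[symmetric] by (rule continuous_on_topical) (rule lo_topical)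

lemma continuous_on_hi: "continuous_on sorted_vecs (\<lambda>y :: (real, 'n) vec. hi c (seq_of y))"
  unfolding sorted_vecs_def n_card[symmetric] by (rule continuous_on_topical) (rule hi_topical)

lemma continuous_on_place:
  "continuous_on (UNIV \<times> sorted_vecs) (\<lambda>z :: (real, 'n) vec \<times> (real, 'n) vec. place (seq_of (fst z)) (seq_of (snd z)) c)"
proof (cases "is_end c \<or> c \<notin> \<xi> ` simple")
  case True
  have "continuous_on (UNIV \<times> sorted_vecs) (\<lambda>z :: (real, 'n) vec \<times> (real, 'n) vec. lo c (seq_of (snd z)))"
    "continuous_on (UNIV \<times> sorted_vecs) (\<lambda>z :: (real, 'n) vec \<times> (real, 'n) vec. hi c (seq_of (snd z)))"
    by (rule continuous_on_compose2[OF continuous_on_lo continuous_on_snd[OF continuous_on_id]]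
         continuous_on_compose2[OF continuous_on_hi continuous_on_snd[OF continuous_on_id]]; auto)+
  thus ?thesis using True unfolding place_def by (cases "is_end c") (auto intro!: continuous_intros)
next
  case False
  then obtain j where j: "j \<in> simple" "c = \<xi> j" by auto
  show ?thesis unfolding j(2) place_simple[OF j(1)]
    by (rule continuous_on_compose2[OF continuous_on_deriv_root[OF simple_less[OF j(1)]] continuous_on_snd[OF continuous_on_id]]) auto
qed

definition place_vec :: "((real, 'n) vec) \<times> ((real, 'n) vec) \<Rightarrow> (real, 'n) vec" where
  "place_vec z = vec_of (\<lambda>m. place (seq_of (fst z)) (seq_of (snd z)) (x m))"

lemma continuous_on_place_vec: "continuous_on (UNIV \<times> sorted_vecs) place_vec"
  unfolding place_vec_def by (rule continuous_on_vec_of) (rule continuous_on_place)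

lemma seq_of_place_vec: "m < n \<Longrightarrow> seq_of (place_vec (s, y)) m = place (seq_of s) (seq_of y) (x m)"
  unfolding place_vec_def fst_conv snd_conv by (rule seq_of_vec_of) (simp add: n_card[symmetric])

lemma fixed_iff:
  "fixed (seq_of s) (seq_of y) \<longleftrightarrow> y \<in> blockwise_vecs \<and> place_vec (s, y) = y"
proof
  assume f: "fixed (seq_of s) (seq_of y)"
  have "place_vec (s, y) = y"
  proof (rule vec_eqI_seq)
    fix m assume "m < CARD('n)"
    hence m: "m < n" by (simp add: n_card[symmetric])
    show "seq_of (place_vec (s, y)) m = seq_of y m"
      unfolding seq_of_place_vec[OF m] by (rule fixed_value[OF f m, symmetric])
  qed
  thus "y \<in> blockwise_vecs \<and> place_vec (s, y) = y"
    using f by (simp add: blockwise_vecs_def fixed_def)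
next
  assume a: "y \<in> blockwise_vecs \<and> place_vec (s, y) = y"
  have "seq_of y m = place (seq_of s) (seq_of y) (x m)" if "m < n" for m
    unfolding seq_of_place_vec[OF that, of s y, symmetric] using a by simp
  thus "fixed (seq_of s) (seq_of y)" using a unfolding fixed_def blockwise_vecs_def by blast
qed

text \<open>Brouwer's theorem for the sorted, blockwise constant vectors with prescribed extreme roots, a set that is preserved by
\<open>place\<close> because blocks keep their order.\<close>

lemma fixed_exists:
  assumes "s \<in> param_space"
  shows "\<exists>y :: (real, 'n) vec. fixed (seq_of s) (seq_of y)"
proof -
  have ps: "params (seq_of s)" using assms by (simp add: param_space_def)
  define L where "L = lead (x (n - 1))"
  define K where "K = blockwise_vecs \<inter> {y :: (real, 'n) vec. ends_at (seq_of s) (seq_of y)}"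
  have conv: "convex {y :: (real, 'n) vec. ends_at (seq_of s) (seq_of y)}"
  proof (rule convexI)
    fix y z :: "(real, 'n) vec" and u v :: real
    assume yz: "y \<in> {y. ends_at (seq_of s) (seq_of y)}" "z \<in> {y. ends_at (seq_of s) (seq_of y)}" and "u + v = 1"
    have "u * t + v * t = t" for t using \<open>u + v = 1\<close> by (metis distrib_right mult_1)
    thus "u *\<^sub>R y + v *\<^sub>R z \<in> {y. ends_at (seq_of s) (seq_of y)}" using yz by (simp add: ends_at_def)
  qed
  have clo: "closed {y :: (real, 'n) vec. ends_at (seq_of s) (seq_of y)}"
    unfolding ends_at_def by (intro closed_Collect_conj closed_Collect_eq continuous_intros)
  have bd: "norm y \<le> real CARD('n) * norm s" if "y \<in> K" for y
  proof (rule norm_le_seq)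
    fix m assume m: "m < CARD('n)"
    have y: "sorted_seq n (seq_of y)" "ends_at (seq_of s) (seq_of y)"
      using that by (auto simp: K_def blockwise_vecs_def blockwise_def)
    have "seq_of y 0 \<le> seq_of y m" "seq_of y m \<le> seq_of y (n - 1)" using bounds_gen(1,2)[OF y(1) m[folded n_card]] by auto
    moreover have "\<bar>seq_of y 0\<bar> \<le> norm s" "\<bar>seq_of y (n - 1)\<bar> \<le> norm s"
      using y(2) abs_seq_of_le by (auto simp: ends_at_def)
    ultimately show "\<bar>seq_of y m\<bar> \<le> norm s" by linarith
  qed
  have compact: "compact K"
    unfolding compact_eq_bounded_closed
  proof
    show "bounded K" using bd unfolding bounded_iff by blast
    show "closed K" unfolding K_def using clo closed_blockwise by (rule closed_Int[rotated])
  qed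
  have convex: "convex K" unfolding K_def using conv convex_blockwise by (intro convex_Int)
  have ne: "K \<noteq> {}"
  proof -
    \<comment> \<open>All blocks but the last one are put at the left end.\<close>
    define y where "y = (vec_of (\<lambda>m. if x m = x (n - 1) then seq_of s L else seq_of s 0) :: (real, 'n) vec)"
    have y: "seq_of y m = (if x m = x (n - 1) then seq_of s L else seq_of s 0)" if "m < n" for m
      unfolding y_def by (rule seq_of_vec_of) (use that in \<open>simp add: n_card[symmetric]\<close>)
    have le: "seq_of s 0 \<le> seq_of s L" 
    proof (cases "x 0 = x (n - 1)")
      case True
      have "L = 0" unfolding L_def True[symmetric] by (rule lead_0)
      thus ?thesis by simp
    next
      case False
      hence "x 0 < x (n - 1)" using x_bounds(2)[OF n_pos] by simp
      thus ?thesis using ps unfolding params_def L_def by (simp add: less_imp_le)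
    qed
    have "sorted_seq n (seq_of y)"
      unfolding sorted_seq_def
    proof (intro allI impI)
      fix i j assume ij: "i \<le> j" "j < n"
      have "x j = x (n - 1)" if "x i = x (n - 1)"
        using sorted_seqD[OF sorted ij] x_bounds(2)[OF ij(2)] that by simp
      thus "seq_of y i \<le> seq_of y j" using le ij by (auto simp: y)
    qed
    moreover have "ends_at (seq_of s) (seq_of y)"
    proof -
      have "seq_of y 0 = seq_of s 0"
      proof (cases "x 0 = x (n - 1)")
        case True
        have "L = 0" unfolding L_def True[symmetric] by (rule lead_0)
        thus ?thesis using y[OF n_pos] by simp
      qed (use y[OF n_pos] in simp)
      moreover have "seq_of y (n - 1) = seq_of s L" using y[of "n - 1"] n_pos by simp
      ultimately show ?thesis by (simp add: ends_at_def L_def)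
    qed
    ultimately have "y \<in> K" using y by (auto simp: K_def blockwise_vecs_def blockwise_def)
    thus ?thesis by blast
  qed
  have cont: "continuous_on K (\<lambda>y. place_vec (s, y))"
    by (rule continuous_on_compose2[OF continuous_on_place_vec])
       (use blockwise_vecs_sorted in \<open>auto simp: K_def intro!: continuous_intros\<close>)
  have maps: "(\<lambda>y. place_vec (s, y)) \<in> K \<rightarrow> K"
  proof
    fix y assume "y \<in> K"
    hence y: "blockwise (seq_of y)" "ends_at (seq_of s) (seq_of y)" by (auto simp: K_def blockwise_vecs_def)
    have v: "seq_of (place_vec (s, y)) m = place (seq_of s) (seq_of y) (x m)" if "m < n" for m
      using that by (rule seq_of_place_vec)
    note pb = place_blockwise[OF y(1) ps y(2)]
    have "sorted_seq n (seq_of (place_vec (s, y)))"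
      using pb(1) v unfolding blockwise_def sorted_seq_def by auto
    moreover have "seq_of (place_vec (s, y)) i = seq_of (place_vec (s, y)) i'" if "i < n" "i' < n" "x i = x i'" for i i'
      using that v by simp
    moreover have "ends_at (seq_of s) (seq_of (place_vec (s, y)))"
      using pb(2) v[OF n_pos] v[of "n - 1"] n_pos unfolding ends_at_def by simp
    ultimately show "place_vec (s, y) \<in> K" unfolding K_def blockwise_vecs_def blockwise_def by blast
  qed
  obtain y where "y \<in> K" "place_vec (s, y) = y"
    using brouwer[OF compact convex ne cont maps] by blast
  thus ?thesis using fixed_iff by (auto simp: K_def)
qed

definition chart :: "(real, 'n) vec \<Rightarrow> (real, 'n) vec" where
  "chart s = (SOME y. fixed (seq_of s) (seq_of y))"

lemma chart_fixed: "s \<in> param_space \<Longrightarrow> fixed (seq_of s) (seq_of (chart s))"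
  unfolding chart_def using fixed_exists by (rule someI_ex)

lemma chart_unique:
  assumes "s \<in> param_space" "fixed (seq_of s) (seq_of y)"
  shows "y = chart s"
proof (rule vec_eqI_seq)
  fix m assume "m < CARD('n)"
  thus "seq_of y m = seq_of (chart s) m"
    using fixed_unique[OF assms(2) chart_fixed[OF assms(1)], of m] assms(1) by (simp add: param_space_def n_card[symmetric])
qed

lemma continuous_on_chart: "continuous_on param_space chart"
proof (rule continuous_on_implicit[where B = blockwise_vecs and G = "\<lambda>z. place_vec z - snd z"
     and \<beta> = "\<lambda>s. real CARD('n) * norm s"])
  show "closed blockwise_vecs" by (rule closed_blockwise)
  show "continuous_on (param_space \<times> blockwise_vecs) (\<lambda>z. place_vec z - snd z)"
    by (intro continuous_intros continuous_on_subset[OF continuous_on_place_vec])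
       (use blockwise_vecs_sorted in auto)
  show "continuous_on UNIV (\<lambda>s :: (real, 'n) vec. real CARD('n) * norm s)" by (intro continuous_intros)
  fix s assume s: "s \<in> param_space"
  note f = chart_fixed[OF s]
  show "chart s \<in> blockwise_vecs" "place_vec (s, chart s) - snd (s, chart s) = 0" using f by (auto simp: fixed_iff)
  show "y = chart s" if "y \<in> blockwise_vecs" "place_vec (s, y) - snd (s, y) = 0" for y
    using that by (intro chart_unique[OF s]) (simp add: fixed_iff)
  show "norm (chart s) \<le> real CARD('n) * norm s"
  proof (rule norm_le_seq)
    fix m assume m: "m < CARD('n)"
    have "seq_of (chart s) 0 \<le> seq_of (chart s) m" "seq_of (chart s) m \<le> seq_of (chart s) (n - 1)"
      using bounds_gen(1,2)[OF fixed_sorted[OF f] m[folded n_card]] by auto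
    moreover have "\<bar>seq_of (chart s) 0\<bar> \<le> norm s" "\<bar>seq_of (chart s) (n - 1)\<bar> \<le> norm s"
      using fixed_ends_at[OF f] abs_seq_of_le by (auto simp: ends_at_def)
    ultimately show "\<bar>seq_of (chart s) m\<bar> \<le> norm s" by linarith
  qed
qed

lemma pattern_stratum_roots:
  assumes "a \<in> pattern_stratum"
  shows "a \<in> split_polys" "sorted_seq n (seq_of (roots_vec a))" "monic_poly_of a = root_poly n (seq_of (roots_vec a))"
    "same_pattern k n (seq_of (roots_vec a)) x"
proof -
  obtain y where y: "sorted_seq n y" "monic_poly_of a = root_poly n y" "same_pattern k n y x"
    using assms by (auto simp: pattern_stratum_def)
  define z where "z = (vec_of y :: (real, 'n) vec)"
  have z: "seq_of z m = y m" if "m < n" for m unfolding z_def using that[unfolded n_card] by (rule seq_of_vec_of)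
  have s: "sorted_seq n (seq_of z)" using y(1) z by (auto simp: sorted_seq_def)
  have m: "monic_poly_of a = root_poly n (seq_of z)" unfolding y(2) using z by (intro root_poly_cong) simp
  show spl: "a \<in> split_polys" using s m by (auto simp: split_polys_def sorted_vecs_def n_card[symmetric])
  show r: "sorted_seq n (seq_of (roots_vec a))" "monic_poly_of a = root_poly n (seq_of (roots_vec a))"
    using roots_vec[OF spl] by (auto simp: sorted_vecs_def n_card[symmetric])
  have "cv_of k (monic_poly_of a) = cv_of k (root_poly n x)"
    unfolding y(2) by (rule same_pattern_imp_cv_eq[OF y(1) sorted k y(3)])
  thus "same_pattern k n (seq_of (roots_vec a)) x"
    unfolding r(2) by (rule cv_eq_imp_same_pattern[OF r(1) sorted k])
qed

definition params_vec :: "(real, 'n) vec \<Rightarrow> (real, 'n) vec" where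
  "params_vec y = vec_of (param_of (seq_of y))"

lemma seq_of_params_vec: "m < n \<Longrightarrow> seq_of (params_vec y) m = param_of (seq_of y) m"
  unfolding params_vec_def by (rule seq_of_vec_of) (simp add: n_card[symmetric])

text \<open>Only the entries with index below \<open>n\<close> matter, so the vector and the sequence of parameters may be interchanged.\<close>

lemma params_cong:
  assumes "\<And>m. m < n \<Longrightarrow> s m = s' m"
  shows "params s \<longleftrightarrow> params s'"
proof -
  have "lead c < n" if "free c" for c using that lead_props(1)[of c] by (simp add: free_def)
  moreover have "lead (x (n - 1)) < n" using n_pos by (intro lead_props(1)) auto
  ultimately show ?thesis using assms n_pos unfolding params_def by (simp cong: imp_cong)
qed

lemma fixed_cong:
  assumes "\<And>m. m < n \<Longrightarrow> s m = s' m"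
  shows "fixed s y \<longleftrightarrow> fixed s' y"
proof -
  have "place s y (x i) = place s' y (x i)" if "i < n" for i
    using lead_props(1)[of "x i"] that assms by (simp add: place_def)
  thus ?thesis unfolding fixed_def by auto
qed

lemma params_vec_chart:
  assumes "sorted_seq n (seq_of y)" "same_pattern k n (seq_of y) x"
  shows "params_vec y \<in> param_space" "chart (params_vec y) = y"
proof -
  note pf = param_of_fixed[OF assms]
  have "params (seq_of (params_vec y))"
    using pf(1) params_cong[of "seq_of (params_vec y)" "param_of (seq_of y)"] seq_of_params_vec by blast
  moreover have "seq_of (params_vec y) m = 0" if "m < n" "m \<notin> param_index" for m
    unfolding seq_of_params_vec[OF that(1)] using that by (auto simp: param_of_def param_index_def)
  ultimately show ps: "params_vec y \<in> param_space" by (simp add: param_space_def coord_space_def)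
  have "fixed (seq_of (params_vec y)) (seq_of y)"
    using pf(2) fixed_cong[of "seq_of (params_vec y)" "param_of (seq_of y)"] seq_of_params_vec by blast
  thus "chart (params_vec y) = y" using chart_unique[OF ps] by simp
qed

lemma chart_params_vec:
  assumes "s \<in> param_space"
  shows "params_vec (chart s) = s"
proof (rule vec_eqI_seq)
  fix m assume m: "m < CARD('n)"
  have "params (seq_of s)" "\<And>i. i < n \<Longrightarrow> i \<notin> param_index \<Longrightarrow> seq_of s i = 0"
    using assms by (auto simp: param_space_def coord_space_def)
  thus "seq_of (params_vec (chart s)) m = seq_of s m"
    using param_of_inverse[OF _ chart_fixed[OF assms]] m[folded n_card] by (simp add: seq_of_params_vec)
qed

lemma continuous_on_params_vec:
  "continuous_on {y. sorted_seq n (seq_of y) \<and> same_pattern k n (seq_of y) x} params_vec"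
  unfolding params_vec_def
proof (rule continuous_on_vec_of)
  fix m assume m: "m < CARD('n)"
  let ?X = "{y :: (real, 'n) vec. sorted_seq n (seq_of y) \<and> same_pattern k n (seq_of y) x}"
  have sub: "?X \<subseteq> sorted_vecs" by (auto simp: sorted_vecs_def n_card[symmetric])
  have lohi: "continuous_on ?X (\<lambda>y. lo (x m) (seq_of y))" "continuous_on ?X (\<lambda>y. hi (x m) (seq_of y))"
    using continuous_on_subset[OF continuous_on_lo sub] continuous_on_subset[OF continuous_on_hi sub] by auto
  show "continuous_on ?X (\<lambda>y. param_of (seq_of y) m)"
  proof (cases "lead (x m) = m \<and> \<not> is_end (x m) \<and> free (x m)")
    case True
    have "hi (x m) (seq_of y) - lo (x m) (seq_of y) \<noteq> 0" if "y \<in> ?X" for y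
      using pattern_lo_hi[of "seq_of y" m] that True m[folded n_card] by simp
    thus ?thesis using True lohi unfolding param_of_def by (auto intro!: continuous_intros)
  next
    case False
    hence "param_of (seq_of y) m = (if lead (x m) = m \<and> is_end (x m) then seq_of y m else 0)" for y :: "(real, 'n) vec"
      by (auto simp: param_of_def)
    thus ?thesis by (cases "lead (x m) = m \<and> is_end (x m)") (auto intro!: continuous_intros)
  qed
qed

theorem stratum_homeomorphism:
  "homeomorphism param_space pattern_stratum (coeffs_of_roots \<circ> chart) (params_vec \<circ> roots_vec)"
proof (rule homeomorphismI)
  have chart: "sorted_seq n (seq_of (chart s))" "same_pattern k n (seq_of (chart s)) x" if "s \<in> param_space" for s
  proof -
    have "params (seq_of s)" using that by (simp add: param_space_def)
    thus "sorted_seq n (seq_of (chart s))" "same_pattern k n (seq_of (chart s)) x"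
      using fixed_imp_same_pattern[OF chart_fixed[OF that]] fixed_sorted[OF chart_fixed[OF that]] by auto
  qed
  show "continuous_on param_space (coeffs_of_roots \<circ> chart)"
    by (intro continuous_on_compose continuous_on_chart continuous_on_coeffs_of_roots)
  have "roots_vec ` pattern_stratum \<subseteq> {y. sorted_seq n (seq_of y) \<and> same_pattern k n (seq_of y) x}"
    using pattern_stratum_roots by auto
  thus "continuous_on pattern_stratum (params_vec \<circ> roots_vec)"
    using pattern_stratum_roots(1)
    by (intro continuous_on_compose continuous_on_subset[OF continuous_on_roots_vec]
       continuous_on_subset[OF continuous_on_params_vec]) auto
  have im1: "(coeffs_of_roots \<circ> chart) \<in> param_space \<rightarrow> pattern_stratum"
  proof
    fix s assume "s \<in> param_space"
    moreover have "monic_poly_of ((coeffs_of_roots \<circ> chart) s) = root_poly n (seq_of (chart s))"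
      using monic_poly_of_coeffs_of_roots[of "chart s"] by (simp add: n_card[symmetric])
    ultimately show "(coeffs_of_roots \<circ> chart) s \<in> pattern_stratum"
      unfolding pattern_stratum_def using chart by blast
  qed
  have im2: "(params_vec \<circ> roots_vec) \<in> pattern_stratum \<rightarrow> param_space"
    using pattern_stratum_roots params_vec_chart by auto
  show "(coeffs_of_roots \<circ> chart) ` param_space \<subseteq> pattern_stratum" using im1 by blast
  show "(params_vec \<circ> roots_vec) ` pattern_stratum \<subseteq> param_space" using im2 by blast
  show "(params_vec \<circ> roots_vec) ((coeffs_of_roots \<circ> chart) s) = s" if "s \<in> param_space" for s
  proof -
    have "roots_vec (coeffs_of_roots (chart s)) = chart s"
      using chart[OF that] by (intro roots_vec_unique) (auto simp: sorted_vecs_def n_card[symmetric] monic_poly_of_coeffs_of_roots)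
    thus ?thesis using chart_params_vec[OF that] by simp
  qed
  show "(coeffs_of_roots \<circ> chart) ((params_vec \<circ> roots_vec) a) = a" if "a \<in> pattern_stratum" for a
    using pattern_stratum_roots[OF that] params_vec_chart(2)[of "roots_vec a"] monic_poly_of_eq_iff[of a "roots_vec a"]
    by (simp add: n_card[symmetric])
qed

lemma contractible_pattern_stratum: "contractible pattern_stratum"
  using homeomorphic_contractible[OF convex_imp_contractible[OF convex_param_space]] stratum_homeomorphism
  unfolding homeomorphic_def by blast

end

section \<open>Regular functions and tangent vectors at a point\<close>

lemma real_polynomial_function_gradient:
  fixes f :: "'a::euclidean_space \<Rightarrow> real"
  assumes "real_polynomial_function f"
  shows "\<exists>G. continuous_on UNIV G \<and> (\<forall>x. GDERIV f x :> G x)"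
  using assms
proof (induction rule: real_polynomial_function.induct)
  case (linear f)
  define g where "g = (\<Sum>b\<in>Basis. f b *\<^sub>R b)"
  have "f h = h \<bullet> g" for h
  proof -
    have "f h = f (\<Sum>b\<in>Basis. (h \<bullet> b) *\<^sub>R b)" by (simp add: euclidean_representation)
    also have "\<dots> = h \<bullet> g"
      using linear by (simp add: bounded_linear.linear linear_sum linear_cmul g_def inner_sum_right mult.commute)
    finally show ?thesis .
  qed
  hence "f = (\<lambda>h. h \<bullet> g)" by auto
  hence "GDERIV f x :> g" for x using bounded_linear_imp_has_derivative[OF linear] by (simp add: gderiv_def)
  thus ?case by (intro exI[of _ "\<lambda>_. g"]) simp
next
  case (const c)
  thus ?case by (intro exI[of _ "\<lambda>_. 0"]) (simp add: GDERIV_const)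
next
  case (add f g)
  then obtain F G where "continuous_on UNIV F" "\<And>x. GDERIV f x :> F x" "continuous_on UNIV G" "\<And>x. GDERIV g x :> G x" by blast
  thus ?case by (intro exI[of _ "\<lambda>x. F x + G x"] conjI allI GDERIV_add continuous_on_add) auto
next
  case (mult f g)
  then obtain F G where FG: "continuous_on UNIV F" "\<And>x. GDERIV f x :> F x" "continuous_on UNIV G" "\<And>x. GDERIV g x :> G x" by blast
  have "continuous_on UNIV f" "continuous_on UNIV g"
    using FG(2,4) unfolding gderiv_def by (meson has_derivative_continuous continuous_at_imp_continuous_on)+
  thus ?case using FG
    by (intro exI[of _ "\<lambda>x. f x *\<^sub>R G x + g x *\<^sub>R F x"] conjI allI GDERIV_mult continuous_intros) auto
qed

text \<open>Quotients of polynomials, as functions on \<open>S\<close>, whose denominator does not vanish at \<open>a0\<close>.  The equation is multiplied out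
because the denominator may vanish elsewhere on \<open>S\<close>.\<close>

definition regular :: "'a::euclidean_space set \<Rightarrow> 'a \<Rightarrow> ('a \<Rightarrow> real) \<Rightarrow> bool" where
  "regular S a0 f \<longleftrightarrow> (\<exists>p q. real_polynomial_function p \<and> real_polynomial_function q \<and> q a0 \<noteq> 0 \<and>
     (\<forall>a\<in>S. f a * q a = p a))"

text \<open>\<open>y\<close> is the derivative of \<open>f = p / q\<close> at \<open>a0\<close> in the direction \<open>v\<close> according to the quotient rule.  For a tangent vector \<open>v\<close> it does not
depend on the representation (\<open>tv_unique\<close>).\<close>

definition tangent_value :: "'a::euclidean_space set \<Rightarrow> 'a \<Rightarrow> 'a \<Rightarrow> ('a \<Rightarrow> real) \<Rightarrow> real \<Rightarrow> bool" where
  "tangent_value S a0 v f y \<longleftrightarrow> (\<exists>p q gp gq. real_polynomial_function p \<and> real_polynomial_function q \<and> q a0 \<noteq> 0 \<and>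
     (\<forall>a\<in>S. f a * q a = p a) \<and> GDERIV p a0 :> gp \<and> GDERIV q a0 :> gq \<and> y * q a0 + f a0 * (gq \<bullet> v) = gp \<bullet> v)"

lemma regularI:
  "real_polynomial_function p \<Longrightarrow> real_polynomial_function q \<Longrightarrow> q a0 \<noteq> 0 \<Longrightarrow> (\<And>a. a \<in> S \<Longrightarrow> f a * q a = p a) \<Longrightarrow> regular S a0 f"
  unfolding regular_def by blast

lemma regular_poly: "real_polynomial_function f \<Longrightarrow> regular S a0 f"
  by (rule regularI[of f "\<lambda>_. 1"]) auto

lemma regular_const: "regular S a0 (\<lambda>_. c)"
  by (rule regular_poly) auto

lemma regular_add:
  assumes "regular S a0 f" "regular S a0 g"
  shows "regular S a0 (\<lambda>a. f a + g a)"
proof -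
  obtain p q where f: "real_polynomial_function p" "real_polynomial_function q" "q a0 \<noteq> 0" "\<And>a. a \<in> S \<Longrightarrow> f a * q a = p a"
    using assms(1) unfolding regular_def by blast
  obtain p' q' where g: "real_polynomial_function p'" "real_polynomial_function q'" "q' a0 \<noteq> 0" "\<And>a. a \<in> S \<Longrightarrow> g a * q' a = p' a"
    using assms(2) unfolding regular_def by blast
  show ?thesis
    by (rule regularI[of "\<lambda>a. p a * q' a + p' a * q a" "\<lambda>a. q a * q' a"])
       (use f g in \<open>auto simp: algebra_simps simp flip: f(4) g(4)\<close>)
qed

lemma regular_mult:
  assumes "regular S a0 f" "regular S a0 g"
  shows "regular S a0 (\<lambda>a. f a * g a)"
proof -
  obtain p q where f: "real_polynomial_function p" "real_polynomial_function q" "q a0 \<noteq> 0" "\<And>a. a \<in> S \<Longrightarrow> f a * q a = p a"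
    using assms(1) unfolding regular_def by blast
  obtain p' q' where g: "real_polynomial_function p'" "real_polynomial_function q'" "q' a0 \<noteq> 0" "\<And>a. a \<in> S \<Longrightarrow> g a * q' a = p' a"
    using assms(2) unfolding regular_def by blast
  show ?thesis
    by (rule regularI[of "\<lambda>a. p a * p' a" "\<lambda>a. q a * q' a"])
       (use f g in \<open>auto simp: algebra_simps simp flip: f(4) g(4)\<close>)
qed

lemma regular_uminus: "regular S a0 f \<Longrightarrow> regular S a0 (\<lambda>a. - f a)"
  using regular_mult[OF regular_const[of S a0 "-1"], of f] by simp

lemma regular_diff: "regular S a0 f \<Longrightarrow> regular S a0 g \<Longrightarrow> regular S a0 (\<lambda>a. f a - g a)"
  using regular_add[OF _ regular_uminus, of S a0 f g] by simp

lemma regular_sum: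
  assumes "\<And>i. i \<in> I \<Longrightarrow> regular S a0 (f i)"
  shows "regular S a0 (\<lambda>a. \<Sum>i\<in>I. f i a)"
  using assms by (induction I rule: infinite_finite_induct) (auto intro: regular_const regular_add)

lemma regular_quotient:
  assumes "regular S a0 f" "regular S a0 g" "f a0 \<noteq> 0" "a0 \<in> S" "\<And>a. a \<in> S \<Longrightarrow> z a * f a = g a"
  shows "regular S a0 z"
proof -
  obtain p q where f: "real_polynomial_function p" "real_polynomial_function q" "q a0 \<noteq> 0" "\<And>a. a \<in> S \<Longrightarrow> f a * q a = p a"
    using assms(1) unfolding regular_def by blast
  obtain p' q' where g: "real_polynomial_function p'" "real_polynomial_function q'" "q' a0 \<noteq> 0" "\<And>a. a \<in> S \<Longrightarrow> g a * q' a = p' a"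
    using assms(2) unfolding regular_def by blast
  show ?thesis
  proof (rule regularI[of "\<lambda>a. p' a * q a" "\<lambda>a. p a * q' a"])
    show "p a0 * q' a0 \<noteq> 0" using f(3) g(3) assms(3) f(4)[OF assms(4)] by auto
    fix a assume a: "a \<in> S"
    have "z a * (p a * q' a) = z a * f a * (q a * q' a)" using f(4)[OF a] by (simp add: algebra_simps)
    also have "\<dots> = p' a * q a" using g(4)[OF a] assms(5)[OF a] by (simp add: algebra_simps)
    finally show "z a * (p a * q' a) = p' a * q a" .
  qed (use f g in auto)
qed

text \<open>Gaussian elimination without division.  Injectivity of the system at \<open>a0\<close> provides a pivot that does not vanish
there, and cross-multiplication eliminates the last unknown while injectivity at \<open>a0\<close> is preserved.\<close>

lemma regular_linear_system:
  fixes N :: nat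
  assumes "a0 \<in> S"
    and "\<And>i j. i \<in> I \<Longrightarrow> j < N \<Longrightarrow> regular S a0 (A i j)" "\<And>i. i \<in> I \<Longrightarrow> regular S a0 (b i)"
    and "\<And>a i. a \<in> S \<Longrightarrow> i \<in> I \<Longrightarrow> (\<Sum>j<N. A i j a * z j a) = b i a"
    and "\<And>c. (\<And>i. i \<in> I \<Longrightarrow> (\<Sum>j<N. A i j a0 * c j) = 0) \<Longrightarrow> (\<And>j. j < N \<Longrightarrow> c j = (0::real))"
    and "j < N"
  shows "regular S a0 (z j)"
  using assms(2-)
proof (induction N arbitrary: A b j rule: nat.induct[case_names 0 Suc])
  case (Suc N)
  have "\<exists>i\<in>I. A i N a0 \<noteq> 0"
  proof (rule ccontr)
    assume no: "\<not> (\<exists>i\<in>I. A i N a0 \<noteq> 0)"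
    have "(\<Sum>j<Suc N. A i j a0 * (if j = N then 1 else 0)) = 0" if "i \<in> I" for i
      using no that by simp
    from Suc.prems(4)[of "\<lambda>j. if j = N then 1 else 0", OF this, of N] show False by simp
  qed
  then obtain i0 where i0: "i0 \<in> I" "A i0 N a0 \<noteq> 0" by blast
  \<comment> \<open>The other equations are multiplied by the pivot instead of dividing by it.\<close>
  define A' where "A' i j a = A i j a * A i0 N a - A i N a * A i0 j a" for i j a
  define b' where "b' i a = b i a * A i0 N a - A i N a * b i0 a" for i a
  have split: "(\<Sum>j<N. A' i j a * w j) = (\<Sum>j<N. A i j a * w j) * A i0 N a - A i N a * (\<Sum>j<N. A i0 j a * w j)" for i a w
    by (simp add: A'_def sum_distrib_left sum_distrib_right sum_subtractf[symmetric] algebra_simps)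
  have regz: "regular S a0 (z j)" if "j < N" for j
  proof (rule Suc.IH[of A' b', OF _ _ _ _ that])
    show "regular S a0 (A' i j)" if "i \<in> I" "j < N" for i j
      unfolding A'_def using Suc.prems(1) i0 that by (intro regular_diff regular_mult) auto
    show "regular S a0 (b' i)" if "i \<in> I" for i
      unfolding b'_def using Suc.prems(1,2) i0 that by (intro regular_diff regular_mult) auto
    show "(\<Sum>j<N. A' i j a * z j a) = b' i a" if "a \<in> S" "i \<in> I" for a i
    proof -
      have e: "(\<Sum>j<N. A i j a * z j a) = b i a - A i N a * z N a" "(\<Sum>j<N. A i0 j a * z j a) = b i0 a - A i0 N a * z N a"
        using Suc.prems(3)[OF that] Suc.prems(3)[OF that(1) i0(1)] by auto
      show ?thesis unfolding split b'_def e by (simp add: algebra_simps)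
    qed
    fix c j assume c: "\<And>i. i \<in> I \<Longrightarrow> (\<Sum>j<N. A' i j a0 * c j) = 0" and j: "j < N"
    \<comment> \<open>A kernel vector of the reduced system extends to the full one by solving the pivot equation.\<close>
    define d where "d j = (if j = N then - (\<Sum>j<N. A i0 j a0 * c j) / A i0 N a0 else c j)" for j
    have dN: "(\<Sum>j<N. A i j a0 * d j) = (\<Sum>j<N. A i j a0 * c j)" for i
      by (intro sum.cong) (auto simp: d_def)
    have "(\<Sum>j<Suc N. A i j a0 * d j) = 0" if "i \<in> I" for i
    proof -
      have "(\<Sum>j<N. A i j a0 * c j) * A i0 N a0 = A i N a0 * (\<Sum>j<N. A i0 j a0 * c j)"
        using c[OF that] unfolding split by simp
      hence "(\<Sum>j<N. A i j a0 * c j) = A i N a0 * (\<Sum>j<N. A i0 j a0 * c j) / A i0 N a0"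
        using i0(2) by (simp add: field_simps)
      thus ?thesis using dN[of i] by (simp add: d_def)
    qed
    from Suc.prems(4)[of d, OF this, of j] j show "c j = 0" by (simp add: d_def)
  qed
  show ?case
  proof (cases "j = N")
    case True
    show ?thesis unfolding True
    proof (rule regular_quotient[of S a0 "A i0 N" "\<lambda>a. b i0 a - (\<Sum>j<N. A i0 j a * z j a)"])
      show "regular S a0 (\<lambda>a. b i0 a - (\<Sum>j<N. A i0 j a * z j a))"
        using Suc.prems(1,2) i0 regz by (intro regular_diff regular_sum regular_mult) auto
      show "z N a * A i0 N a = b i0 a - (\<Sum>j<N. A i0 j a * z j a)" if "a \<in> S" for a
        using Suc.prems(3)[OF that i0(1)] by (simp add: mult.commute)
    qed (use Suc.prems(1) i0 assms(1) in auto)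
  next
    case False
    thus ?thesis using regz Suc.prems(5) by simp
  qed
next
  case 0
  from 0(5) show ?case by (rule less_zeroE)
qed

definition poly_regular :: "'a::euclidean_space set \<Rightarrow> 'a \<Rightarrow> ('a \<Rightarrow> real poly) \<Rightarrow> bool" where
  "poly_regular S a0 F \<longleftrightarrow> (\<forall>i. regular S a0 (\<lambda>a. coeff (F a) i))"

lemma poly_regular_mult:
  "poly_regular S a0 F \<Longrightarrow> poly_regular S a0 G \<Longrightarrow> poly_regular S a0 (\<lambda>a. F a * G a)"
  unfolding poly_regular_def coeff_mult by (auto intro!: regular_sum regular_mult)

lemma poly_regular_const: "poly_regular S a0 (\<lambda>_. p)"
  unfolding poly_regular_def by (auto intro: regular_const)

lemma poly_regular_pderiv: "poly_regular S a0 F \<Longrightarrow> poly_regular S a0 (\<lambda>a. pderiv (F a))"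
  unfolding poly_regular_def coeff_pderiv by (auto intro!: regular_mult regular_const)

lemma poly_regular_pderiv_pow: "poly_regular S a0 F \<Longrightarrow> poly_regular S a0 (\<lambda>a. (pderiv ^^ k) (F a))"
  by (induction k) (auto intro: poly_regular_pderiv)

lemma sum_monom_eq:
  fixes p :: "real poly"
  assumes "\<And>i. i \<ge> N \<Longrightarrow> coeff p i = 0"
  shows "(\<Sum>j<N. monom (coeff p j) j) = p"
proof (rule poly_eqI)
  fix i show "coeff (\<Sum>j<N. monom (coeff p j) j) i = coeff p i"
    using assms[of i] by (cases "i < N") (auto simp: coeff_sum)
qed

text \<open>The coefficients of \<open>X\<close> and \<open>Y\<close> solve a linear system with regular coefficients.  A solution of the homogeneous system at
\<open>a0\<close> consists of \<open>p\<close> and \<open>q\<close> with \<open>F p = G q\<close> and \<open>deg p < deg X\<close>; then \<open>p Y = q X\<close>, so \<open>p\<close> vanishes at the \<open>deg X\<close> zeros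
of \<open>X\<close> in \<open>R\<close>, where \<open>Y\<close> is nonzero, and therefore \<open>p = 0\<close>.\<close>

lemma syzygy_regular:
  fixes F G X Y :: "'a::euclidean_space \<Rightarrow> real poly"
  assumes a0: "a0 \<in> S"
    and reg: "poly_regular S a0 F" "poly_regular S a0 G"
    and eq: "\<And>a. a \<in> S \<Longrightarrow> F a * X a = G a * Y a"
    and X: "\<And>a. a \<in> S \<Longrightarrow> degree (X a) = d" "\<And>a. a \<in> S \<Longrightarrow> coeff (X a) d = 1"
    and Y: "\<And>a. a \<in> S \<Longrightarrow> degree (Y a) < e"
    and G0: "G a0 \<noteq> 0"
    and R: "finite R" "card R = d" "\<And>t. t \<in> R \<Longrightarrow> poly (X a0) t = 0" "\<And>t. t \<in> R \<Longrightarrow> poly (Y a0) t \<noteq> 0"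
  shows "\<And>i. regular S a0 (\<lambda>a. if a \<in> S then coeff (X a) i else 0)"
    and "\<And>i. regular S a0 (\<lambda>a. if a \<in> S then coeff (Y a) i else 0)"
proof -
  define A where "A i j a = (if j < d then coeff (F a * monom 1 j) i else - coeff (G a * monom 1 (j - d)) i)" for i j a
  define z where "z j a = (if a \<in> S then if j < d then coeff (X a) j else coeff (Y a) (j - d) else 0)" for j a
  have lin: "(\<Sum>j<d+e. A i j a * w j) = coeff (F a * (\<Sum>j<d. monom (w j) j) - G a * (\<Sum>j<e. monom (w (d + j)) j)) i" for i a w
  proof -
    have "(\<Sum>j<d+e. A i j a * w j) = (\<Sum>j<d. A i j a * w j) + (\<Sum>j<e. A i (d + j) a * w (d + j))"
      by (induction e) simp_all
    also have "(\<Sum>j<d. A i j a * w j) = coeff (F a * (\<Sum>j<d. monom (w j) j)) i"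
    proof -
      have "A i j a * w j = coeff (F a * monom (w j) j) i" if "j < d" for j
      proof -
        have "monom (w j) j = smult (w j) (monom 1 j)" by (simp add: smult_monom)
        thus ?thesis using that by (simp add: A_def mult.commute)
      qed
      thus ?thesis by (simp add: sum_distrib_left coeff_sum)
    qed
    also have "(\<Sum>j<e. A i (d + j) a * w (d + j)) = - coeff (G a * (\<Sum>j<e. monom (w (d + j)) j)) i"
    proof -
      have "A i (d + j) a * w (d + j) = - coeff (G a * monom (w (d + j)) j) i" for j
      proof -
        have "monom (w (d + j)) j = smult (w (d + j)) (monom 1 j)" by (simp add: smult_monom)
        thus ?thesis by (simp add: A_def mult.commute)
      qed
      thus ?thesis by (simp add: sum_distrib_left coeff_sum sum_negf)
    qed
    finally show ?thesis by simp
  qed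
  have zreg: "regular S a0 (z j)" if "j < d + e" for j
  proof (rule regular_linear_system[where I = UNIV and A = A and b = "\<lambda>i a. - coeff (F a * monom 1 d) i", OF a0 _ _ _ _ that])
    show "regular S a0 (A i j)" for i j
      using poly_regular_mult[OF reg(1) poly_regular_const, of "monom 1 j"]
        poly_regular_mult[OF reg(2) poly_regular_const, of "monom 1 (j - d)"]
      unfolding A_def by (cases "j < d") (auto simp: poly_regular_def intro: regular_uminus)
    show "regular S a0 (\<lambda>a. - coeff (F a * monom 1 d) i)" for i
      using poly_regular_mult[OF reg(1) poly_regular_const, of "monom 1 d"]
      by (auto simp: poly_regular_def intro: regular_uminus)
    show "(\<Sum>j<d+e. A i j a * z j a) = - coeff (F a * monom 1 d) i" if "a \<in> S" for a i
    proof -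
      have "(\<Sum>j<e. monom (z (d + j) a) j) = Y a"
        using sum_monom_eq[of e "Y a"] Y[OF that] that by (simp add: z_def coeff_eq_0)
      moreover have "(\<Sum>j<d. monom (z j a) j) = X a - monom 1 d"
      proof -
        have "(\<Sum>j<Suc d. monom (coeff (X a) j) j) = X a"
          by (rule sum_monom_eq) (use X[OF that] in \<open>simp add: coeff_eq_0\<close>)
        thus ?thesis using X(2)[OF that] that by (simp add: z_def algebra_simps)
      qed
      ultimately have "F a * (\<Sum>j<d. monom (z j a) j) - G a * (\<Sum>j<e. monom (z (d + j) a) j) = - (F a * monom 1 d)"
        using eq[OF that] by (simp add: right_diff_distrib)
      thus ?thesis unfolding lin by simp
    qed
    fix c j assume c: "\<And>i. i \<in> UNIV \<Longrightarrow> (\<Sum>j<d+e. A i j a0 * c j) = 0" and j: "j < d + e"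
    define p q where "p = (\<Sum>j<d. monom (c j) j)" and "q = (\<Sum>j<e. monom (c (d + j)) j)"
    have cp: "coeff p i = (if i < d then c i else 0)" "coeff q i = (if i < e then c (d + i) else 0)" for i
      by (auto simp: p_def q_def coeff_sum)
    have "F a0 * p - G a0 * q = 0" using c unfolding lin p_def q_def by (intro poly_eqI) auto
    hence pq: "F a0 * p = G a0 * q" by simp
    have "G a0 * (p * Y a0) = (G a0 * Y a0) * p" by simp
    also have "\<dots> = (F a0 * X a0) * p" using eq[OF a0] by simp
    also have "\<dots> = X a0 * (F a0 * p)" by simp
    also have "\<dots> = G a0 * (q * X a0)" unfolding pq by simp
    finally have pY: "p * Y a0 = q * X a0" using G0 by simp
    have "p = 0"
    proof (rule ccontr)
      assume "p \<noteq> 0"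
      hence "degree p < d" using cp(1) by (metis leading_coeff_0_iff)
      moreover have "poly p t = 0" if "t \<in> R" for t
        using R(3,4)[OF that] arg_cong[OF pY, of "\<lambda>p. poly p t"] by simp
      hence "R \<subseteq> {t. poly p t = 0}" by auto
      hence "card R \<le> card {t. poly p t = 0}" using poly_roots_finite[OF \<open>p \<noteq> 0\<close>] by (intro card_mono)
      hence "d \<le> degree p" using card_poly_roots_bound[OF \<open>p \<noteq> 0\<close>] R(2) by simp
      ultimately show False by simp
    qed
    hence "q = 0" using pq G0 by simp
    show "c j = 0"
    proof (cases "j < d")
      case True thus ?thesis using cp(1)[of j] \<open>p = 0\<close> by simp
    next
      case False
      hence "j - d < e" "d + (j - d) = j" using j by auto
      thus ?thesis using cp(2)[of "j - d"] \<open>q = 0\<close> by simp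
    qed
  qed
  have cong: "regular S a0 g" if "regular S a0 f" "\<And>a. a \<in> S \<Longrightarrow> f a = g a" for f g
    using that unfolding regular_def by metis
  show "regular S a0 (\<lambda>a. if a \<in> S then coeff (X a) i else 0)" for i
  proof (cases "i < d")
    case True
    show ?thesis by (rule cong[OF zreg[of i]]) (use True in \<open>auto simp: z_def\<close>)
  next
    case False
    have "coeff (X a) i = (if i = d then 1 else 0)" if "a \<in> S" for a
      using X[OF that] False by (auto simp: coeff_eq_0)
    thus ?thesis by (intro cong[OF regular_const[of S a0 "if i = d then 1 else 0"]]) auto
  qed
  show "regular S a0 (\<lambda>a. if a \<in> S then coeff (Y a) i else 0)" for i
  proof (cases "i < e")
    case True
    show ?thesis by (rule cong[OF zreg[of "d + i"]]) (use True in \<open>auto simp: z_def\<close>)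
  next
    case False
    have "coeff (Y a) i = 0" if "a \<in> S" for a
      using Y[OF that] False by (auto simp: coeff_eq_0)
    thus ?thesis by (intro cong[OF regular_const[of S a0 0]]) auto
  qed
qed

text \<open>The direction \<open>v\<close> is orthogonal to the gradients of all polynomials that vanish on \<open>S\<close>; it therefore acts as a derivation on
regular functions and, coefficientwise (\<open>ptv\<close>), on polynomials with regular coefficients.\<close>

locale tangent_vector =
  fixes S :: "'a::euclidean_space set" and a0 v :: 'a
  assumes a0: "a0 \<in> S"
    and tangent: "real_polynomial_function p \<Longrightarrow> (\<And>a. a \<in> S \<Longrightarrow> p a = 0) \<Longrightarrow> GDERIV p a0 :> g \<Longrightarrow> g \<bullet> v = 0"
begin

abbreviation "tv \<equiv> tangent_value S a0 v"

lemma tvI: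
  assumes "real_polynomial_function p" "real_polynomial_function q" "q a0 \<noteq> 0"
     "\<And>a. a \<in> S \<Longrightarrow> f a * q a = p a" "GDERIV p a0 :> gp" "GDERIV q a0 :> gq" "y * q a0 + f a0 * (gq \<bullet> v) = gp \<bullet> v"
  shows "tv f y"
  using assms unfolding tangent_value_def by blast

lemma tv_poly:
  assumes "real_polynomial_function f" "GDERIV f a0 :> g"
  shows "tv f (g \<bullet> v)"
  by (rule tvI[of f "\<lambda>_. 1", OF _ _ _ _ assms(2) GDERIV_const]) (use assms in auto)

lemma tv_const: "tv (\<lambda>_. c) 0"
  using tv_poly[of "\<lambda>_. c", OF _ GDERIV_const] by auto

lemma tv_cong: "tv f y \<Longrightarrow> (\<And>a. a \<in> S \<Longrightarrow> f a = g a) \<Longrightarrow> tv g y"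
  unfolding tangent_value_def using a0 by metis

lemma tv_exists:
  assumes "regular S a0 f"
  shows "\<exists>y. tv f y"
proof -
  obtain p q where f: "real_polynomial_function p" "real_polynomial_function q" "q a0 \<noteq> 0" "\<And>a. a \<in> S \<Longrightarrow> f a * q a = p a"
    using assms(1) unfolding regular_def by blast
  obtain gp gq where g: "GDERIV p a0 :> gp" "GDERIV q a0 :> gq"
    using real_polynomial_function_gradient[OF f(1)] real_polynomial_function_gradient[OF f(2)] by blast
  define y where "y = (gp \<bullet> v - f a0 * (gq \<bullet> v)) / q a0"
  have "y * q a0 = gp \<bullet> v - f a0 * (gq \<bullet> v)"
    unfolding y_def using \<open>q a0 \<noteq> 0\<close> by (rule nonzero_eq_divide_eq[THEN iffD1, OF _ refl])
  hence "y * q a0 + f a0 * (gq \<bullet> v) = gp \<bullet> v" by simp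
  from tvI[OF f g this] show ?thesis ..
qed

lemma tv_add:
  assumes "tv f y" "tv f' y'"
  shows "tv (\<lambda>a. f a + f' a) (y + y')"
proof -
  obtain p q gp gq where f: "real_polynomial_function p" "real_polynomial_function q" "q a0 \<noteq> 0"
     "\<And>a. a \<in> S \<Longrightarrow> f a * q a = p a" "GDERIV p a0 :> gp" "GDERIV q a0 :> gq" "y * q a0 + f a0 * (gq \<bullet> v) = gp \<bullet> v"
    using assms(1) unfolding tangent_value_def by blast
  obtain p' q' gp' gq' where f': "real_polynomial_function p'" "real_polynomial_function q'" "q' a0 \<noteq> 0"
     "\<And>a. a \<in> S \<Longrightarrow> f' a * q' a = p' a" "GDERIV p' a0 :> gp'" "GDERIV q' a0 :> gq'" "y' * q' a0 + f' a0 * (gq' \<bullet> v) = gp' \<bullet> v"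
    using assms(2) unfolding tangent_value_def by blast
  show ?thesis
  proof (rule tvI[of "\<lambda>a. p a * q' a + p' a * q a" "\<lambda>a. q a * q' a"])
    show "GDERIV (\<lambda>a. p a * q' a + p' a * q a) a0 :> ((p a0 *\<^sub>R gq' + q' a0 *\<^sub>R gp) + (p' a0 *\<^sub>R gq + q a0 *\<^sub>R gp'))"
      by (intro GDERIV_add GDERIV_mult f f')
    show "GDERIV (\<lambda>a. q a * q' a) a0 :> (q a0 *\<^sub>R gq' + q' a0 *\<^sub>R gq)" by (intro GDERIV_mult f f')
    show "(y + y') * (q a0 * q' a0) + (f a0 + f' a0) * ((q a0 *\<^sub>R gq' + q' a0 *\<^sub>R gq) \<bullet> v) =
       ((p a0 *\<^sub>R gq' + q' a0 *\<^sub>R gp) + (p' a0 *\<^sub>R gq + q a0 *\<^sub>R gp')) \<bullet> v"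
      by (simp add: inner_add_left f(7)[symmetric] f'(7)[symmetric] f(4)[OF a0, symmetric] f'(4)[OF a0, symmetric] algebra_simps)
    show "(f a + f' a) * (q a * q' a) = p a * q' a + p' a * q a" if "a \<in> S" for a
      by (simp add: f(4)[OF that, symmetric] f'(4)[OF that, symmetric] algebra_simps)
  qed (use f f' in auto)
qed

lemma tv_mult:
  assumes "tv f y" "tv f' y'"
  shows "tv (\<lambda>a. f a * f' a) (y * f' a0 + f a0 * y')"
proof -
  obtain p q gp gq where f: "real_polynomial_function p" "real_polynomial_function q" "q a0 \<noteq> 0"
     "\<And>a. a \<in> S \<Longrightarrow> f a * q a = p a" "GDERIV p a0 :> gp" "GDERIV q a0 :> gq" "y * q a0 + f a0 * (gq \<bullet> v) = gp \<bullet> v"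
    using assms(1) unfolding tangent_value_def by blast
  obtain p' q' gp' gq' where f': "real_polynomial_function p'" "real_polynomial_function q'" "q' a0 \<noteq> 0"
     "\<And>a. a \<in> S \<Longrightarrow> f' a * q' a = p' a" "GDERIV p' a0 :> gp'" "GDERIV q' a0 :> gq'" "y' * q' a0 + f' a0 * (gq' \<bullet> v) = gp' \<bullet> v"
    using assms(2) unfolding tangent_value_def by blast
  show ?thesis
  proof (rule tvI[of "\<lambda>a. p a * p' a" "\<lambda>a. q a * q' a"])
    show "GDERIV (\<lambda>a. p a * p' a) a0 :> (p a0 *\<^sub>R gp' + p' a0 *\<^sub>R gp)" by (intro GDERIV_mult f f')
    show "GDERIV (\<lambda>a. q a * q' a) a0 :> (q a0 *\<^sub>R gq' + q' a0 *\<^sub>R gq)" by (intro GDERIV_mult f f')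
    show "(y * f' a0 + f a0 * y') * (q a0 * q' a0) + (f a0 * f' a0) * ((q a0 *\<^sub>R gq' + q' a0 *\<^sub>R gq) \<bullet> v) =
       (p a0 *\<^sub>R gp' + p' a0 *\<^sub>R gp) \<bullet> v"
      by (simp add: inner_add_left f(7)[symmetric] f'(7)[symmetric] f(4)[OF a0, symmetric] f'(4)[OF a0, symmetric] algebra_simps)
    show "(f a * f' a) * (q a * q' a) = p a * p' a" if "a \<in> S" for a
      by (simp add: f(4)[OF that, symmetric] f'(4)[OF that, symmetric] algebra_simps)
  qed (use f f' in auto)
qed

lemma tv_sum:
  "(\<And>i. i \<in> I \<Longrightarrow> tv (f i) (y i)) \<Longrightarrow> tv (\<lambda>a. \<Sum>i\<in>I. f i a) (\<Sum>i\<in>I. y i)"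
  by (induction I rule: infinite_finite_induct) (auto intro: tv_const tv_add)

text \<open>If \<open>p / q = p' / q'\<close> on \<open>S\<close>, then \<open>p q' - p' q\<close> vanishes on \<open>S\<close>, and so does its derivative along \<open>v\<close>.\<close>

lemma tv_unique:
  assumes "tv f y" "tv f' y'" "\<And>a. a \<in> S \<Longrightarrow> f a = f' a"
  shows "y = y'"
proof -
  obtain p q gp gq where f: "real_polynomial_function p" "real_polynomial_function q" "q a0 \<noteq> 0"
     "\<And>a. a \<in> S \<Longrightarrow> f a * q a = p a" "GDERIV p a0 :> gp" "GDERIV q a0 :> gq" "y * q a0 + f a0 * (gq \<bullet> v) = gp \<bullet> v"
    using assms(1) unfolding tangent_value_def by blast
  obtain p' q' gp' gq' where f': "real_polynomial_function p'" "real_polynomial_function q'" "q' a0 \<noteq> 0"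
     "\<And>a. a \<in> S \<Longrightarrow> f' a * q' a = p' a" "GDERIV p' a0 :> gp'" "GDERIV q' a0 :> gq'" "y' * q' a0 + f' a0 * (gq' \<bullet> v) = gp' \<bullet> v"
    using assms(2) unfolding tangent_value_def by blast
  have "((p a0 *\<^sub>R gq' + q' a0 *\<^sub>R gp) - (p' a0 *\<^sub>R gq + q a0 *\<^sub>R gp')) \<bullet> v = 0"
  proof (rule tangent)
    show "GDERIV (\<lambda>a. p a * q' a - p' a * q a) a0 :> ((p a0 *\<^sub>R gq' + q' a0 *\<^sub>R gp) - (p' a0 *\<^sub>R gq + q a0 *\<^sub>R gp'))"
      by (intro GDERIV_diff GDERIV_mult f f')
    show "p a * q' a - p' a * q a = 0" if "a \<in> S" for a
      by (simp add: f(4)[OF that, symmetric] f'(4)[OF that, symmetric] assms(3)[OF that] algebra_simps)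
  qed (use f f' in auto)
  hence "q a0 * q' a0 * (y - y') = 0"
    by (simp add: inner_add_left inner_diff_left f(7)[symmetric] f'(7)[symmetric] f(4)[OF a0, symmetric] f'(4)[OF a0, symmetric]
        assms(3)[OF a0] algebra_simps)
  thus ?thesis using f(3) f'(3) by simp
qed

definition ptv :: "('a \<Rightarrow> real poly) \<Rightarrow> real poly \<Rightarrow> bool" where
  "ptv F D \<longleftrightarrow> (\<forall>i. tv (\<lambda>a. coeff (F a) i) (coeff D i))"

lemma ptv_mult:
  assumes "ptv F D" "ptv G E"
  shows "ptv (\<lambda>a. F a * G a) (D * G a0 + F a0 * E)"
  unfolding ptv_def
proof
  fix i
  have "tv (\<lambda>a. \<Sum>j\<le>i. coeff (F a) j * coeff (G a) (i - j))
     (\<Sum>j\<le>i. coeff D j * coeff (G a0) (i - j) + coeff (F a0) j * coeff E (i - j))"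
    using assms by (intro tv_sum tv_mult) (auto simp: ptv_def)
  thus "tv (\<lambda>a. coeff (F a * G a) i) (coeff (D * G a0 + F a0 * E) i)"
    by (simp add: coeff_mult sum.distrib)
qed

lemma ptv_pderiv: "ptv F D \<Longrightarrow> ptv (\<lambda>a. pderiv (F a)) (pderiv D)"
  unfolding ptv_def coeff_pderiv using tv_mult[OF tv_const] by fastforce

lemma ptv_pderiv_pow: "ptv F D \<Longrightarrow> ptv (\<lambda>a. (pderiv ^^ k) (F a)) ((pderiv ^^ k) D)"
  by (induction k) (auto intro: ptv_pderiv)

lemma ptv_unique: "ptv F D \<Longrightarrow> ptv F' D' \<Longrightarrow> (\<And>a. a \<in> S \<Longrightarrow> F a = F' a) \<Longrightarrow> D = D'"
  unfolding ptv_def by (intro poly_eqI) (metis tv_unique)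

lemma ptv_exists:
  assumes "\<And>i. regular S a0 (\<lambda>a. if a \<in> S then coeff (F a) i else 0)" "\<And>a. a \<in> S \<Longrightarrow> degree (F a) < N"
  shows "\<exists>D. ptv F D"
proof -
  have "\<exists>y. tv (\<lambda>a. coeff (F a) i) y" for i
  proof -
    obtain y where "tv (\<lambda>a. if a \<in> S then coeff (F a) i else 0) y" using tv_exists[OF assms(1)[of i]] by blast
    hence "tv (\<lambda>a. coeff (F a) i) y" by (rule tv_cong) simp
    thus ?thesis ..
  qed
  then obtain y where y: "\<And>i. tv (\<lambda>a. coeff (F a) i) (y i)" by metis
  define D where "D = (\<Sum>i<N. monom (y i) i)"
  have "tv (\<lambda>a. coeff (F a) i) (coeff D i)" for i
  proof (cases "i < N")
    case True thus ?thesis using y[of i] by (simp add: D_def coeff_sum)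
  next
    case False
    have "tv (\<lambda>a. coeff (F a) i) 0"
      by (rule tv_cong[OF tv_const[of 0]]) (use assms(2) False in \<open>force simp: coeff_eq_0\<close>)
    thus ?thesis using False by (simp add: D_def coeff_sum)
  qed
  thus ?thesis unfolding ptv_def by blast
qed

end

section \<open>A tangent space criterion for smoothness\<close>

lemma GDERIV_unique:
  fixes a :: "'a::euclidean_space"
  assumes "GDERIV f a :> g" "GDERIV f a :> h"
  shows "g = h"
proof -
  have "(\<lambda>v. v \<bullet> g) = (\<lambda>v. v \<bullet> h)"
    using assms unfolding gderiv_def by (rule has_derivative_unique)
  thus ?thesis by (metis vector_eq_ldot)
qed

text \<open>Let \<open>K\<close> be the orthogonal complement of the gradients.  Completing the functions \<open>f i\<close> by linear coordinates on \<open>K\<close> gives a map \<open>F\<close>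
that is injective near \<open>a0\<close> and takes values in \<open>K\<close> wherever all \<open>f i\<close> vanish.  Since \<open>F \<circ> h\<close> maps an open subset of \<open>V\<close>
injectively to \<open>K\<close>, its image is a neighbourhood of \<open>F a0\<close> in \<open>K\<close> by invariance of domain.  So a common zero near \<open>a0\<close> has the same
value under \<open>F\<close> as a point of \<open>S\<close>, and it equals this point.\<close>

lemma smooth_algebraic_atI:
  fixes S :: "'a::euclidean_space set" and h :: "'b::euclidean_space \<Rightarrow> 'a"
  assumes f: "\<And>i. i < r \<Longrightarrow> real_polynomial_function (f i)"
    and van: "\<And>i a. i < r \<Longrightarrow> a \<in> S \<Longrightarrow> f i a = 0"
    and g: "\<And>i. i < r \<Longrightarrow> GDERIV (f i) a0 :> g i" "inj_on g {..<r}" "independent (g ` {..<r})"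
    and V: "subspace V" "DIM('a) \<le> dim V + r" "openin (top_of_set V) E"
    and h: "continuous_on E h" "inj_on h E" "h ` E \<subseteq> S" "a0 \<in> h ` E"
  shows "smooth_algebraic_at r S a0"
proof -
  define N where "N = span (g ` {..<r})"
  have dimN: "dim N = r"
    unfolding N_def dim_span dim_eq_card_independent[OF g(3)] using card_image[OF g(2)] by simp
  define K where "K = {y. \<forall>x\<in>N. orthogonal x y}"
  have K: "subspace K" unfolding K_def by (rule subspace_orthogonal_to_vectors)
  have dimK: "dim K + r = DIM('a)"
    using dim_subspace_orthogonal_to_vectors[of N UNIV] dimN by (simp add: N_def K_def)
  obtain B where B: "B \<subseteq> K" "independent B" "K \<subseteq> span B" "card B = dim K" by (rule basis_exists)
  have finB: "finite B" using B(2) by (rule independent_imp_finite)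
  have "\<forall>i\<in>{..<r}. \<exists>G. continuous_on UNIV G \<and> (\<forall>x. GDERIV (f i) x :> G x)"
    using real_polynomial_function_gradient[OF f] by simp
  from bchoice[OF this] obtain G where G: "\<And>i. i < r \<Longrightarrow> continuous_on UNIV (G i)" "\<And>i x. i < r \<Longrightarrow> GDERIV (f i) x :> G i x" by auto
  have Ga: "G i a0 = g i" if "i < r" for i using GDERIV_unique[OF G(2)[OF that] g(1)[OF that]] .
  \<comment> \<open>The gradients and \<open>B\<close> together span the space, so the values may be collected in the space itself.\<close>
  define F where "F x = (\<Sum>i<r. f i x *\<^sub>R g i) + (\<Sum>b\<in>B. (x \<bullet> b) *\<^sub>R b)" for x
  define F' where "F' x v = (\<Sum>i<r. (v \<bullet> G i x) *\<^sub>R g i) + (\<Sum>b\<in>B. (v \<bullet> b) *\<^sub>R b)" for x v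
  have der: "(F has_derivative F' x) (at x)" for x
    unfolding F_def F'_def using G(2)
    by (auto intro!: derivative_eq_intros simp: gderiv_def)
  have lin: "linear (F' x)" for x using der has_derivative_linear by blast
  have "inj (F' a0)"
  proof (rule linear_injective_0[OF lin, THEN iffD2], intro allI impI)
    fix v assume "F' a0 v = 0"
    hence "v \<bullet> F' a0 v = 0" by simp
    hence sum0: "(\<Sum>i<r. (v \<bullet> g i)\<^sup>2) + (\<Sum>b\<in>B. (v \<bullet> b)\<^sup>2) = 0"
      by (simp add: F'_def Ga inner_add_right inner_sum_right power2_eq_square)
    moreover have "(\<Sum>i<r. (v \<bullet> g i)\<^sup>2) \<ge> 0" "(\<Sum>b\<in>B. (v \<bullet> b)\<^sup>2) \<ge> 0" by (auto intro!: sum_nonneg)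
    ultimately have "(\<Sum>i<r. (v \<bullet> g i)\<^sup>2) = 0" "(\<Sum>b\<in>B. (v \<bullet> b)\<^sup>2) = 0" by linarith+
    hence vg: "\<And>i. i < r \<Longrightarrow> v \<bullet> g i = 0" and vb: "\<And>b. b \<in> B \<Longrightarrow> v \<bullet> b = 0"
      using finB by (auto simp: sum_nonneg_eq_0_iff)
    have "orthogonal v x" if "x \<in> g ` {..<r}" for x using vg that by (auto simp: orthogonal_def)
    hence "orthogonal v x" if "x \<in> N" for x using orthogonal_to_span[of x "g ` {..<r}" v] that unfolding N_def by blast
    hence "v \<in> K" by (auto simp: K_def orthogonal_commute)
    hence "v \<in> span B" using B(3) by blast
    moreover have "orthogonal v b" if "b \<in> B" for b using vb that by (simp add: orthogonal_def)
    ultimately have "orthogonal v v" using orthogonal_to_span[of v B v] by blast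
    thus "v = 0" by (simp add: orthogonal_self)
  qed
  then obtain F1 where F1: "linear F1" "F1 \<circ> F' a0 = id" using linear_injective_left_inverse[OF lin] by blast
  have cont': "\<exists>d>0. \<forall>x. dist a0 x < d \<longrightarrow> onorm (\<lambda>v. F' x v - F' a0 v) < e" if e: "e > 0" for e
  proof -
    define c where "c x = (\<Sum>i<r. norm (G i x - G i a0) * norm (g i))" for x
    have "continuous_on UNIV c" unfolding c_def using G(1) by (intro continuous_intros) auto
    hence "isCont c a0" by (simp add: continuous_on_eq_continuous_at)
    moreover have "c a0 = 0" by (simp add: c_def)
    ultimately obtain d where d: "d > 0" "\<And>x. dist x a0 < d \<Longrightarrow> dist (c x) 0 < e"
      using e unfolding continuous_at_eps_delta dist_real_def dist_norm by (metis diff_zero)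
    have "onorm (\<lambda>v. F' x v - F' a0 v) \<le> c x" for x
    proof (rule onorm_le)
      fix v
      have "F' x v - F' a0 v = (\<Sum>i<r. (v \<bullet> (G i x - G i a0)) *\<^sub>R g i)"
        by (simp add: F'_def inner_diff_right scaleR_diff_left sum_subtractf)
      also have "norm \<dots> \<le> (\<Sum>i<r. norm ((v \<bullet> (G i x - G i a0)) *\<^sub>R g i))" by (rule norm_sum)
      also have "\<dots> \<le> (\<Sum>i<r. norm (G i x - G i a0) * norm (g i) * norm v)"
      proof (rule sum_mono)
        fix i
        have "\<bar>v \<bullet> (G i x - G i a0)\<bar> * norm (g i) \<le> (norm v * norm (G i x - G i a0)) * norm (g i)"
          by (rule mult_right_mono[OF Cauchy_Schwarz_ineq2]) simp
        thus "norm ((v \<bullet> (G i x - G i a0)) *\<^sub>R g i) \<le> norm (G i x - G i a0) * norm (g i) * norm v"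
          by (simp add: mult_ac)
      qed
      also have "\<dots> = c x * norm v" by (simp add: c_def sum_distrib_right)
      finally show "norm (F' x v - F' a0 v) \<le> c x * norm v" .
    qed
    moreover have "c x < e" if "dist a0 x < d" for x
      using d(2)[of x] that abs_le_D1[of "c x" "\<bar>c x\<bar>"] by (simp add: dist_commute)
    ultimately show ?thesis using d(1) by (meson le_less_trans)
  qed
  obtain \<rho> where \<rho>: "\<rho> > 0" "inj_on F (ball a0 \<rho>)"
    using has_derivative_locally_injective[OF UNIV_I open_UNIV _ F1(2) der cont'] F1(1)
    by (metis linear_conv_bounded_linear)
  define E' where "E' = {e \<in> E. h e \<in> ball a0 \<rho>}"
  have "openin (top_of_set E) E'"
    unfolding E'_def using continuous_openin_preimage_gen[OF h(1) open_ball, of a0 \<rho>] by (simp add: vimage_def Int_def)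
  hence opE: "openin (top_of_set V) E'" using V(3) by (rule openin_trans)
  have FK: "F x = (\<Sum>b\<in>B. (x \<bullet> b) *\<^sub>R b)" "F x \<in> K" if "\<And>i. i < r \<Longrightarrow> f i x = 0" for x
  proof -
    show "F x = (\<Sum>b\<in>B. (x \<bullet> b) *\<^sub>R b)" using that by (simp add: F_def)
    thus "F x \<in> K" using B(1) K by (auto intro!: subspace_sum subspace_scale)
  qed
  have contF: "continuous_on UNIV F"
    using der has_derivative_continuous continuous_at_imp_continuous_on by blast
  have "openin (top_of_set K) ((F \<circ> h) ` E')"
  proof (rule invariance_of_domain_subspaces[OF opE V(1) K])
    show "dim K \<le> dim V" using dimK V(2) by simp
    have "continuous_on E' h" using h(1) by (rule continuous_on_subset) (auto simp: E'_def)
    thus "continuous_on E' (F \<circ> h)" by (intro continuous_on_compose continuous_on_subset[OF contF]) auto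
    show "F \<circ> h \<in> E' \<rightarrow> K" using FK(2) van h(3) by (force simp: E'_def)
    show "inj_on (F \<circ> h) E'"
      by (rule comp_inj_on[OF inj_on_subset[OF h(2)] inj_on_subset[OF \<rho>(2)]]) (auto simp: E'_def)
  qed
  then obtain T where T: "open T" "(F \<circ> h) ` E' = K \<inter> T" by (auto simp: openin_open)
  define U where "U = ball a0 \<rho> \<inter> F -` T"
  have "open U" unfolding U_def using contF T(1) by (intro open_Int open_ball open_vimage)
  moreover have "a0 \<in> U"
  proof -
    obtain e where e: "e \<in> E" "h e = a0" using h(4) by auto
    hence "e \<in> E'" using \<rho>(1) by (simp add: E'_def)
    hence "F a0 \<in> T" using T(2) e(2) by auto
    thus ?thesis using \<rho>(1) by (simp add: U_def)
  qed
  moreover have "S \<inter> U = {x \<in> U. \<forall>i<r. f i x = 0}"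
  proof (intro equalityI subsetI)
    fix x assume x: "x \<in> {x \<in> U. \<forall>i<r. f i x = 0}"
    hence "F x \<in> K \<inter> T" using FK(2) by (auto simp: U_def)
    then obtain e where e: "e \<in> E'" "F x = F (h e)" using T(2) by (metis (no_types, lifting) comp_apply imageE)
    hence "x = h e" using \<rho>(2) x by (auto simp: inj_on_def U_def E'_def)
    thus "x \<in> S \<inter> U" using e(1) h(3) x by (auto simp: E'_def)
  qed (use van in auto)
  ultimately show ?thesis unfolding smooth_algebraic_at_def using f g by blast
qed

definition tangent_space :: "'a::euclidean_space set \<Rightarrow> 'a \<Rightarrow> 'a set" where
  "tangent_space S a0 = {v. \<forall>p g. real_polynomial_function p \<longrightarrow> (\<forall>a\<in>S. p a = 0) \<longrightarrow> GDERIV p a0 :> g \<longrightarrow> g \<bullet> v = 0}"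

lemma subspace_tangent_space: "subspace (tangent_space S a0)"
  by (auto simp: subspace_def tangent_space_def inner_add_right)

text \<open>If the tangent space is at most as large as the parameter space, then the gradients of polynomials vanishing on \<open>S\<close> span a
space of dimension at least \<open>r\<close>.\<close>

lemma smooth_algebraic_at_tangent_space:
  fixes S :: "'a::euclidean_space set" and h :: "'b::euclidean_space \<Rightarrow> 'a"
  assumes T: "dim (tangent_space S a0) \<le> dim V" and dim: "DIM('a) = dim V + r"
    and V: "subspace V" "openin (top_of_set V) E"
    and h: "continuous_on E h" "inj_on h E" "h ` E \<subseteq> S" "a0 \<in> h ` E"
  shows "smooth_algebraic_at r S a0"
proof -
  define \<Gamma> where "\<Gamma> = {g. \<exists>p. real_polynomial_function p \<and> (\<forall>a\<in>S. p a = 0) \<and> GDERIV p a0 :> g}"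
  have "{y \<in> UNIV. \<forall>x\<in>span \<Gamma>. orthogonal x y} \<subseteq> tangent_space S a0"
    using span_base[of _ \<Gamma>] by (auto simp: tangent_space_def \<Gamma>_def orthogonal_def)
  hence "dim {y \<in> UNIV. \<forall>x\<in>span \<Gamma>. orthogonal x y} \<le> dim V" using T dim_subset order_trans by blast
  hence "r \<le> dim \<Gamma>"
    using dim_subspace_orthogonal_to_vectors[of "span \<Gamma>" UNIV] dim by simp
  moreover obtain B where B: "B \<subseteq> \<Gamma>" "independent B" "\<Gamma> \<subseteq> span B" "card B = dim \<Gamma>" by (rule basis_exists)
  ultimately obtain C where C: "C \<subseteq> B" "card C = r" "finite C" by (metis obtain_subset_with_card_n)
  then obtain g where g: "bij_betw g {..<r} C" using ex_bij_betw_nat_finite[of C] by (auto simp: atLeast0LessThan)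
  have "\<forall>i\<in>{..<r}. \<exists>p. real_polynomial_function p \<and> (\<forall>a\<in>S. p a = 0) \<and> GDERIV p a0 :> g i"
    using g B(1) C(1) unfolding bij_betw_def \<Gamma>_def by blast
  from bchoice[OF this] obtain f where f: "\<And>i. i < r \<Longrightarrow> real_polynomial_function (f i)" "\<And>i a. i < r \<Longrightarrow> a \<in> S \<Longrightarrow> f i a = 0"
    "\<And>i. i < r \<Longrightarrow> GDERIV (f i) a0 :> g i" by auto
  have "inj_on g {..<r}" "g ` {..<r} \<subseteq> B" using g C(1) by (auto simp: bij_betw_def)
  hence "inj_on g {..<r}" "independent (g ` {..<r})" using independent_mono[OF B(2)] by blast+
  from smooth_algebraic_atI[OF f this V(1) _ V(2) h] dim show ?thesis by simp
qed

section \<open>Laguerre's inequality and the motion of roots of derivatives\<close>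

lemma pderiv_linear: "pderiv [:- t, 1:] = (1 :: real poly)"
  by (simp add: pderiv_pCons one_pCons)

text \<open>The product with a further linear factor satisfies, with \<open>u = z - x n\<close> and \<open>A\<close> the product of the others,
\<open>(A u)'\<^sup>2 - (A u) (A u)'' = A\<^sup>2 + u\<^sup>2 (A'\<^sup>2 - A A'')\<close>.\<close>

lemma laguerre:
  "0 \<le> (poly (pderiv (root_poly n x)) z)\<^sup>2 - poly (root_poly n x) z * poly (pderiv (pderiv (root_poly n x))) z \<and>
   (n > 0 \<longrightarrow> poly (root_poly n x) z \<noteq> 0 \<longrightarrow>
     0 < (poly (pderiv (root_poly n x)) z)\<^sup>2 - poly (root_poly n x) z * poly (pderiv (pderiv (root_poly n x))) z)"
proof (induction n)
  case (Suc n)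
  let ?A = "root_poly n x"
  define a a1 a2 u where "a = poly ?A z" and "a1 = poly (pderiv ?A) z" and "a2 = poly (pderiv (pderiv ?A)) z" and "u = z - x n"
  have d1: "pderiv (root_poly (Suc n) x) = ?A + [:- x n, 1:] * pderiv ?A"
    unfolding root_poly_Suc by (simp add: pderiv_mult pderiv_linear del: mult_pCons_right mult_pCons_left)
  have d2: "pderiv (pderiv (root_poly (Suc n) x)) = 2 * pderiv ?A + [:- x n, 1:] * pderiv (pderiv ?A)"
    unfolding d1 by (simp add: pderiv_add pderiv_mult pderiv_linear del: mult_pCons_right mult_pCons_left)
  have "poly (root_poly (Suc n) x) z = a * u" "poly (pderiv (root_poly (Suc n) x)) z = a + u * a1"
    "poly (pderiv (pderiv (root_poly (Suc n) x))) z = 2 * a1 + u * a2"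
    unfolding d2 unfolding d1 by (simp_all add: root_poly_Suc a_def a1_def a2_def u_def del: mult_pCons_right mult_pCons_left)
  moreover have "(a + u * a1)\<^sup>2 - a * u * (2 * a1 + u * a2) = a\<^sup>2 + u\<^sup>2 * (a1\<^sup>2 - a * a2)"
    by (simp add: power2_eq_square algebra_simps)
  moreover have "0 \<le> u\<^sup>2 * (a1\<^sup>2 - a * a2)" using Suc.IH by (simp add: a_def a1_def a2_def)
  ultimately show ?case by (auto simp: add_pos_nonneg)
qed simp

lemma pderiv_pow_root_poly_obtain:
  assumes "i \<le> n"
  obtains c y where "c \<noteq> 0" "(pderiv ^^ i) (root_poly n x) = smult c (root_poly (n - i) y)"
proof -
  obtain z where z: "sorted_seq n z" "root_poly n z = root_poly n x" by (rule root_poly_sort)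
  have "(\<Prod>j<i. real (n - j)) \<noteq> 0" using assms by auto
  thus ?thesis using pderiv_pow_root_poly[OF z(1) assms] that unfolding z(2) by blast
qed

text \<open>A double root of the next derivative is a root of the present one by the strict form of \<open>laguerre\<close>, so the vanishing descends
to the polynomial itself.\<close>

lemma order_ge_of_double_root:
  assumes "i < n" "poly ((pderiv ^^ i) (root_poly n x)) z = 0" "poly ((pderiv ^^ Suc i) (root_poly n x)) z = 0"
  shows "i + 2 \<le> order z (root_poly n x)"
  using assms
proof (induction i)
  case 0
  have "pderiv (root_poly n x) \<noteq> 0" using 0(1) by (simp add: pderiv_eq_0_iff)
  hence "order z (pderiv (root_poly n x)) \<noteq> 0" using 0(3) order_root[of "pderiv (root_poly n x)" z] by simp
  thus ?case using order_pderiv[of "root_poly n x" z] 0(2) by simp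
next
  case (Suc i)
  let ?P = "root_poly n x"
  obtain c y where cy: "c \<noteq> 0" "(pderiv ^^ i) ?P = smult c (root_poly (n - i) y)"
    using pderiv_pow_root_poly_obtain[of i n x] Suc.prems(1) by auto
  have "poly (pderiv (root_poly (n - i) y)) z = 0" "poly (pderiv (pderiv (root_poly (n - i) y))) z = 0"
    using Suc.prems(2,3) cy by (auto simp: pderiv_smult)
  hence "poly (root_poly (n - i) y) z = 0" using laguerre[of "n - i" y z] Suc.prems(1) by auto
  hence "i + 2 \<le> order z ?P" using Suc cy by simp
  moreover have "order z ((pderiv ^^ (i + 2)) ?P) \<noteq> 0"
  proof -
    obtain c' y' where c': "c' \<noteq> 0" "(pderiv ^^ (i + 2)) ?P = smult c' (root_poly (n - (i + 2)) y')"
      using pderiv_pow_root_poly_obtain[of "i + 2" n x] Suc.prems(1) by auto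
    hence "(pderiv ^^ (i + 2)) ?P \<noteq> 0" by simp
    moreover have "poly ((pderiv ^^ (i + 2)) ?P) z = 0" using Suc.prems(3) by simp
    ultimately show ?thesis using order_root by blast
  qed
  ultimately show ?case using order_pderiv_pow[of ?P "i + 2" z] by simp
qed

lemma leibniz_linear:
  "(pderiv ^^ Suc l) ([:- t, 1:] * q) = [:- t, 1:] * (pderiv ^^ Suc l) q + of_nat (Suc l) * (pderiv ^^ l) (q :: real poly)"
proof (induction l)
  case 0 show ?case by (simp add: pderiv_mult pderiv_linear del: mult_pCons_right mult_pCons_left)
next
  case (Suc l)
  have "(pderiv ^^ Suc (Suc l)) ([:- t, 1:] * q) = pderiv ((pderiv ^^ Suc l) ([:- t, 1:] * q))" by simp
  also have "\<dots> = pderiv ([:- t, 1:] * (pderiv ^^ Suc l) q + of_nat (Suc l) * (pderiv ^^ l) q)" unfolding Suc ..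
  also have "\<dots> = [:- t, 1:] * (pderiv ^^ Suc (Suc l)) q + (pderiv ^^ Suc l) q + of_nat (Suc l) * (pderiv ^^ Suc l) q"
    by (simp add: pderiv_add pderiv_mult pderiv_linear del: mult_pCons_left mult_pCons_right of_nat_Suc)
  finally show ?case by (simp add: algebra_simps del: mult_pCons_left)
qed

text \<open>In terms of roots: moving a root \<open>t\<close> of \<open>P\<close> to the right moves the root \<open>z\<close> of the \<open>k\<close>-th derivative to the right.  Let \<open>q = P / (X - t)\<close> and let
\<open>R\<close> be its derivative of order \<open>k - 1\<close>.  At \<open>z\<close> the Leibniz rule gives \<open>(z - t) R' + k R = 0\<close>, and the derivative of \<open>P\<close> of order
\<open>k + 1\<close> equals \<open>(z - t) R'' + (k + 1) R'\<close>.  Eliminating \<open>z - t\<close>, its product with \<open>R'\<close> is \<open>R'\<^sup>2 + k (R'\<^sup>2 - R R'')\<close>.\<close>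

lemma deriv_quotient_sign:
  assumes k: "0 < k" "k \<le> m" and P: "P = [:- t, 1:] * root_poly m y"
    and z: "poly ((pderiv ^^ k) P) z = 0" "order z P \<le> k"
  shows "0 < poly ((pderiv ^^ k) (root_poly m y)) z * poly ((pderiv ^^ Suc k) P) z"
proof -
  let ?q = "root_poly m y"
  obtain l where l: "k = Suc l" using k by (cases k) auto
  obtain c w where cw: "c \<noteq> 0" "(pderiv ^^ l) ?q = smult c (root_poly (m - l) w)"
    using pderiv_pow_root_poly_obtain[of l m y] k l by auto
  define r r1 r2 where "r = poly ((pderiv ^^ l) ?q) z" and "r1 = poly ((pderiv ^^ Suc l) ?q) z"
    and "r2 = poly ((pderiv ^^ Suc (Suc l)) ?q) z"
  define L where "L = real l"
  have L: "poly (of_nat (Suc l)) z = L + 1" "poly (of_nat (Suc (Suc l))) z = L + 2" "L \<ge> 0"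
    by (simp_all add: L_def of_nat_poly del: of_nat_Suc)
  have e1: "(z - t) * r1 + (L + 1) * r = 0"
    using z(1) unfolding l P leibniz_linear poly_add poly_mult L r_def r1_def by simp
  have e2: "poly ((pderiv ^^ Suc k) P) z = (z - t) * r2 + (L + 2) * r1"
    unfolding l P leibniz_linear poly_add poly_mult L r1_def r2_def by simp
  have "r1 \<noteq> 0"
  proof
    assume r1: "r1 = 0"
    hence "r = 0" using e1 L(3) by simp
    hence "l + 2 \<le> order z ?q"
      using order_ge_of_double_root[of l m y z] r1 k l by (simp add: r_def r1_def)
    moreover have "order z P = order z [:- t, 1:] + order z ?q"
      unfolding P by (rule order_mult) (simp del: mult_pCons_left)
    ultimately show False using z(2) l by simp
  qed
  have "r1\<^sup>2 - r * r2 = c\<^sup>2 * ((poly (pderiv (root_poly (m - l) w)) z)\<^sup>2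
      - poly (root_poly (m - l) w) z * poly (pderiv (pderiv (root_poly (m - l) w))) z)"
    unfolding r_def r1_def r2_def funpow.simps o_def cw(2) by (simp add: pderiv_smult power2_eq_square algebra_simps)
  hence lag: "0 \<le> r1\<^sup>2 - r * r2" using laguerre[of "m - l" w z] by simp
  have "(z - t) * r1 = - (L + 1) * r" using e1 by (simp add: algebra_simps)
  hence "(z - t) * r1 * r2 = - (L + 1) * r * r2" by simp
  hence "r1 * ((z - t) * r2 + (L + 2) * r1) = r1\<^sup>2 + (L + 1) * (r1\<^sup>2 - r * r2)"
    by (simp add: power2_eq_square algebra_simps)
  also have "\<dots> > 0" using \<open>r1 \<noteq> 0\<close> lag L(3) by (intro add_pos_nonneg) auto
  finally show ?thesis unfolding e2 by (simp add: r1_def l)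
qed

lemma prod_power_dvd:
  assumes "finite L" "inj_on t L" "(p :: real poly) \<noteq> 0" "\<And>l. l \<in> L \<Longrightarrow> e l \<le> order (t l) p"
  shows "(\<Prod>l\<in>L. [:- t l, 1:] ^ e l) dvd p"
  using assms
proof (induction L arbitrary: p rule: finite_induct)
  case (insert l L)
  have "[:- t l, 1:] ^ e l dvd p" using insert.prems(2,3) by (meson insertI1 order_divides)
  then obtain q where q: "p = [:- t l, 1:] ^ e l * q" by (auto elim: dvdE)
  have q0: "q \<noteq> 0" using q insert.prems(2) by auto
  have "e l' \<le> order (t l') q" if "l' \<in> L" for l'
  proof -
    have "t l' \<noteq> t l" using insert.prems(1) insert.hyps(2) that by (auto simp: inj_on_def)
    hence "order (t l') ([:- t l, 1:] ^ e l) = 0" by (intro order_0I) simp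
    moreover have "order (t l') p = order (t l') ([:- t l, 1:] ^ e l) + order (t l') q"
      unfolding q by (rule order_mult) (use insert.prems(2) q in auto)
    ultimately show ?thesis using insert.prems(3)[of l'] that by simp
  qed
  hence "(\<Prod>l\<in>L. [:- t l, 1:] ^ e l) dvd q" using insert.IH[OF _ q0] insert.prems(1) by simp
  thus ?case unfolding q using insert.hyps by (simp add: mult_dvd_mono)
qed simp

section \<open>Velocities of the roots along a tangent vector\<close>

lemma pderiv_pow_add: "(pderiv ^^ k) (p + q) = (pderiv ^^ k) p + (pderiv ^^ k) (q :: real poly)"
  by (induction k) (simp_all add: pderiv_add)

lemma pderiv_pow_sum_smult:
  "(pderiv ^^ k) (\<Sum>l\<in>L. smult (c l) (p l)) = (\<Sum>l\<in>L. smult (c l) ((pderiv ^^ k) (p l :: real poly)))"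
proof -
  have z: "(pderiv ^^ k) 0 = (0 :: real poly)" by (induction k) simp_all
  have s: "(pderiv ^^ k) (smult c p) = smult c ((pderiv ^^ k) p)" for c and p :: "real poly"
    by (induction k) (simp_all add: pderiv_smult)
  show ?thesis
    by (induction L rule: infinite_finite_induct) (simp_all add: z s pderiv_pow_add)
qed

lemma root_poly_remove:
  assumes "j < n"
  obtains y' where "root_poly n y = [:- y j, 1:] * root_poly (n - 1) y'"
proof -
  obtain h where h: "bij_betw h {0..<card ({..<n} - {j})} ({..<n} - {j})"
    using ex_bij_betw_nat_finite[of "{..<n} - {j}"] by auto
  have c: "card ({..<n} - {j}) = n - 1" using assms by simp
  have "root_poly n y = [:- y j, 1:] * (\<Prod>i\<in>{..<n} - {j}. [:- y i, 1:])"
    unfolding root_poly_def using assms by (intro prod.remove) auto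
  also have "(\<Prod>i\<in>{..<n} - {j}. [:- y i, 1:]) = root_poly (n - 1) (y \<circ> h)"
    unfolding root_poly_def o_def using prod.reindex_bij_betw[OF h, of "\<lambda>i. [:- y i, 1:]"] c
    by (simp add: atLeast0LessThan)
  finally show ?thesis by (rule that)
qed

text \<open>Maximum principle: if the maximum of \<open>c\<close> is attained outside \<open>F\<close>, then all values equal it, in particular the value 0 taken on \<open>F\<close>.\<close>

lemma weighted_mean_le_0:
  fixes c :: "'i \<Rightarrow> real"
  assumes "finite L" "F \<subseteq> L" "F \<noteq> {}" "\<And>l. l \<in> F \<Longrightarrow> c l = 0"
    and mean: "\<And>i. i \<in> L - F \<Longrightarrow> \<exists>\<alpha>. (\<forall>l\<in>L. \<alpha> l > 0) \<and> (\<Sum>l\<in>L. \<alpha> l * (c l - c i)) = 0"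
    and "l \<in> L"
  shows "c l \<le> 0"
proof -
  have "c l \<le> Max (c ` L)" using assms(1,6) by simp
  moreover have "Max (c ` L) \<in> c ` L" using assms(1,6) by (intro Max_in) auto
  then obtain i where i: "i \<in> L" "c i = Max (c ` L)" by force
  have "c i = 0"
  proof (cases "i \<in> F")
    case False
    then obtain \<alpha> where \<alpha>: "\<And>l. l \<in> L \<Longrightarrow> \<alpha> l > 0" "(\<Sum>l\<in>L. \<alpha> l * (c l - c i)) = 0" using mean i by blast
    obtain f where f: "f \<in> F" using assms(3) by blast
    have "(\<Sum>l\<in>L. \<alpha> l * (c i - c l)) = - (\<Sum>l\<in>L. \<alpha> l * (c l - c i))"
      unfolding sum_negf[symmetric] by (intro sum.cong) (auto simp: algebra_simps)
    hence "(\<Sum>l\<in>L. \<alpha> l * (c i - c l)) = 0" using \<alpha>(2) by simp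
    moreover have "0 \<le> \<alpha> l * (c i - c l)" if "l \<in> L" for l
      using \<alpha>(1)[OF that] i(2) Max_ge[of "c ` L" "c l"] assms(1) that by (intro mult_nonneg_nonneg) auto
    ultimately have "\<alpha> f * (c i - c f) = 0"
      using sum_nonneg_eq_0_iff[OF assms(1), of "\<lambda>l. \<alpha> l * (c i - c l)"] f assms(2) by blast
    thus ?thesis using \<alpha>(1)[of f] f assms(2,4) by auto
  qed (use assms(4) in simp)
  ultimately show ?thesis using i by simp
qed

locale root_blocks =
  fixes L :: "'i set" and t :: "'i \<Rightarrow> real" and m :: "'i \<Rightarrow> nat"
  assumes finite_L: "finite L" and inj_t: "inj_on t L" and m_pos: "\<And>l. l \<in> L \<Longrightarrow> m l > 0"
begin

definition blocks_poly :: "real poly" where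
  "blocks_poly = (\<Prod>l\<in>L. [:- t l, 1:] ^ m l)"

definition repeated_part :: "real poly" where
  "repeated_part = (\<Prod>l\<in>L. [:- t l, 1:] ^ (m l - 1))"

definition radical :: "real poly" where
  "radical = (\<Prod>l\<in>L. [:- t l, 1:])"

definition cofactor :: "'i \<Rightarrow> real poly" where
  "cofactor l = (\<Prod>l'\<in>L - {l}. [:- t l', 1:])"

text \<open>The logarithmic derivative of \<open>blocks_poly\<close> is \<open>log_deriv_num / radical\<close> in lowest terms.\<close>

definition log_deriv_num :: "real poly" where
  "log_deriv_num = (\<Sum>l\<in>L. smult (real (m l)) (cofactor l))"

lemma blocks_poly_eq: "blocks_poly = repeated_part * radical"
  unfolding blocks_poly_def repeated_part_def radical_def prod.distrib[symmetric]
proof (rule prod.cong[OF refl])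
  fix l assume "l \<in> L"
  hence "m l = Suc (m l - 1)" using m_pos by simp
  thus "[:- t l, 1:] ^ m l = [:- t l, 1:] ^ (m l - 1) * [:- t l, 1:]" by (metis power_Suc2)
qed

lemma radical_eq: "l \<in> L \<Longrightarrow> radical = [:- t l, 1:] * cofactor l"
  unfolding radical_def cofactor_def by (rule prod.remove[OF finite_L])

lemma nonzero: "blocks_poly \<noteq> 0" "repeated_part \<noteq> 0" "radical \<noteq> 0"
  unfolding blocks_poly_def repeated_part_def radical_def using finite_L by auto

lemma pderiv_blocks_poly: "pderiv blocks_poly = repeated_part * log_deriv_num"
proof -
  have "(\<Prod>l'\<in>L - {l}. [:- t l', 1:] ^ m l') * pderiv ([:- t l, 1:] ^ m l) = repeated_part * smult (real (m l)) (cofactor l)"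
    if l: "l \<in> L" for l
  proof -
    have "(\<Prod>l'\<in>L - {l}. [:- t l', 1:] ^ m l') = (\<Prod>l'\<in>L - {l}. [:- t l', 1:] ^ (m l' - 1)) * cofactor l"
      unfolding cofactor_def prod.distrib[symmetric]
    proof (rule prod.cong[OF refl])
      fix l' assume "l' \<in> L - {l}"
      hence "m l' = Suc (m l' - 1)" using m_pos by simp
      thus "[:- t l', 1:] ^ m l' = [:- t l', 1:] ^ (m l' - 1) * [:- t l', 1:]" by (metis power_Suc2)
    qed
    moreover have "repeated_part = [:- t l, 1:] ^ (m l - 1) * (\<Prod>l'\<in>L - {l}. [:- t l', 1:] ^ (m l' - 1))"
      unfolding repeated_part_def by (rule prod.remove[OF finite_L l])
    moreover have "pderiv ([:- t l, 1:] ^ m l) = smult (real (m l)) ([:- t l, 1:] ^ (m l - 1))"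
      by (simp only: pderiv_power pderiv_linear mult_1_right)
    ultimately show ?thesis by (simp only: mult_smult_right mult_smult_left mult_ac)
  qed
  thus ?thesis unfolding blocks_poly_def pderiv_prod log_deriv_num_def sum_distrib_left by (intro sum.cong refl)
qed

lemma poly_cofactor:
  "l \<in> L \<Longrightarrow> poly (cofactor l) (t l) \<noteq> 0" "l \<in> L \<Longrightarrow> l' \<in> L \<Longrightarrow> l' \<noteq> l \<Longrightarrow> poly (cofactor l) (t l') = 0"
  using finite_L inj_t by (auto simp: cofactor_def poly_prod inj_on_def)

lemma poly_radical: "l \<in> L \<Longrightarrow> poly radical (t l) = 0"
  "l \<in> L \<Longrightarrow> poly (pderiv radical) (t l) = poly (cofactor l) (t l)"
  unfolding radical_eq by (simp_all add: pderiv_mult pderiv_linear del: mult_pCons_left mult_pCons_right)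

lemma poly_log_deriv_num:
  assumes "l \<in> L"
  shows "poly log_deriv_num (t l) = real (m l) * poly (cofactor l) (t l)"
proof -
  have "poly log_deriv_num (t l) = (\<Sum>l'\<in>L. real (m l') * poly (cofactor l') (t l))"
    by (simp add: log_deriv_num_def poly_sum)
  also have "\<dots> = (\<Sum>l'\<in>L. if l' = l then real (m l) * poly (cofactor l) (t l) else 0)"
    using poly_cofactor(2) assms by (intro sum.cong refl) auto
  also have "\<dots> = real (m l) * poly (cofactor l) (t l)" using assms finite_L by simp
  finally show ?thesis .
qed

lemma degree_radical: "degree radical = card L"
  unfolding radical_def by (subst degree_prod_sum_eq) auto

lemma degree_cofactor: "l \<in> L \<Longrightarrow> degree (cofactor l) = card L - 1"
  unfolding cofactor_def by (subst degree_prod_sum_eq) (auto simp: finite_L)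

lemma coeff_radical: "coeff radical (card L) = 1"
proof -
  have "lead_coeff radical = 1" unfolding radical_def lead_coeff_prod by simp
  thus ?thesis by (simp add: degree_radical)
qed

lemma degree_log_deriv_num: "degree log_deriv_num \<le> card L"
  unfolding log_deriv_num_def
  by (intro degree_sum_le finite_L order_trans[OF degree_smult_le]) (simp add: degree_cofactor)

text \<open>If \<open>V\<close> had order \<open>\<mu> < m l - 1\<close> at \<open>t l\<close>, then \<open>V' * radical - V * log_deriv_num\<close> would have the same order, because its leading coefficient
there has the factor \<open>\<mu> - m l\<close>; but the equation makes it divisible by \<open>repeated_part\<close>.\<close>

lemma repeated_part_dvd:
  assumes eq: "pderiv V * radical + pderiv blocks_poly * Hd = V * log_deriv_num + blocks_poly * Wd"
  shows "repeated_part dvd V"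
proof (cases "V = 0")
  case False
  have "m l - 1 \<le> order (t l) V" if l: "l \<in> L" for l
  proof (rule ccontr)
    define \<mu> where "\<mu> = order (t l) V"
    define X where "X = [:- t l, 1:]"
    assume "\<not> m l - 1 \<le> order (t l) V"
    hence mu: "Suc \<mu> \<le> m l - 1" by (simp add: \<mu>_def)
    obtain V1 where V1: "V = X ^ \<mu> * V1" "\<not> X dvd V1"
      using order_decomp[OF False, of "t l"] unfolding X_def \<mu>_def by blast
    define B where "B = (smult (real \<mu>) V1 + X * pderiv V1) * cofactor l - V1 * log_deriv_num"
    have e: "pderiv V * X = X ^ \<mu> * (smult (real \<mu>) V1 + X * pderiv V1)"
    proof (cases \<mu>)
      case (Suc e)
      thus ?thesis unfolding V1(1) pderiv_mult pderiv_power X_def pderiv_linear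
        by (simp add: algebra_simps del: mult_pCons_left mult_pCons_right)
    qed (simp add: V1(1) algebra_simps)
    have "pderiv V * radical = X ^ \<mu> * ((smult (real \<mu>) V1 + X * pderiv V1) * cofactor l)"
      unfolding radical_eq[OF l] X_def[symmetric] using e by (metis mult.assoc)
    moreover have "V * log_deriv_num = X ^ \<mu> * (V1 * log_deriv_num)" by (simp only: V1(1) mult.assoc)
    ultimately have "pderiv V * radical - V * log_deriv_num = X ^ \<mu> * B"
      by (simp only: B_def right_diff_distrib)
    moreover have "pderiv V * radical - V * log_deriv_num = repeated_part * (radical * Wd - log_deriv_num * Hd)"
      using eq unfolding pderiv_blocks_poly unfolding blocks_poly_eq by (simp add: algebra_simps)
    moreover have "X ^ (m l - 1) dvd repeated_part"
      unfolding repeated_part_def X_def by (rule dvd_prodI[OF finite_L l])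
    hence "X ^ Suc \<mu> dvd repeated_part" using mu by (meson dvd_trans le_imp_power_dvd)
    ultimately have "X ^ Suc \<mu> dvd X ^ \<mu> * B" by (metis dvd_mult2)
    then obtain D where "X ^ \<mu> * B = X ^ Suc \<mu> * D" by (rule dvdE)
    hence "X ^ \<mu> * B = X ^ \<mu> * (X * D)" by (simp only: power_Suc2 mult.assoc)
    moreover have "X ^ \<mu> \<noteq> 0" by (simp add: X_def)
    ultimately have "B = X * D" by (metis mult_left_cancel)
    hence "X dvd B" by simp
    hence "poly B (t l) = 0" by (simp add: X_def poly_eq_0_iff_dvd)
    moreover have "poly X (t l) = 0" by (simp add: X_def)
    ultimately have "(real \<mu> - real (m l)) * (poly V1 (t l) * poly (cofactor l) (t l)) = 0"
      unfolding B_def using poly_log_deriv_num[OF l] by (simp add: algebra_simps)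
    moreover have "poly V1 (t l) \<noteq> 0" using V1(2) by (simp add: X_def poly_eq_0_iff_dvd)
    ultimately show False using poly_cofactor(1)[OF l] mu by simp
  qed
  thus ?thesis unfolding repeated_part_def by (rule prod_power_dvd[OF finite_L inj_t False])
qed simp

text \<open>Lagrange interpolation writes \<open>V\<close> as the sum of the \<open>c l * m l * P / (X - t l)\<close>, the infinitesimal change of \<open>P\<close> if each root
\<open>t l\<close> moves with velocity \<open>- c l\<close>.  At a marked root \<open>t i\<close> the first equation relates \<open>Hd\<close> to \<open>c i\<close>, and the second one then says that
the \<open>k\<close>-th derivative of \<open>V\<close> equals \<open>c i\<close> times the derivative of \<open>P\<close> of order \<open>k + 1\<close>.  The latter is the sum of the
\<open>k\<close>-th derivatives of \<open>m l * P / (X - t l)\<close>, which all have its sign by \<open>deriv_quotient_sign\<close>.  So \<open>c i\<close> is a mean of all \<open>c l\<close> with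
positive weights.\<close>

lemma tangent_poly_eq_0:
  assumes eq1: "pderiv V * radical + pderiv blocks_poly * Hd = V * log_deriv_num + blocks_poly * Wd"
    and eq2: "(pderiv ^^ k) V * E + (pderiv ^^ k) blocks_poly * Ed = Hd * C + radical * Cd"
    and EC: "(pderiv ^^ k) blocks_poly * E = radical * C"
    and P: "blocks_poly = root_poly n y" and k: "0 < k" "k < n" and V: "degree V < n"
    and M: "M \<subseteq> L" "L - M \<noteq> {}" "\<And>l. l \<in> M \<Longrightarrow> poly ((pderiv ^^ k) blocks_poly) (t l) = 0"
      "\<And>l. l \<in> M \<Longrightarrow> poly E (t l) \<noteq> 0" "\<And>l. l \<in> M \<Longrightarrow> order (t l) blocks_poly \<le> k"
    and free: "\<And>l. l \<in> L - M \<Longrightarrow> poly (V div repeated_part) (t l) = 0"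
  shows "V = 0"
proof -
  define w where "w = V div repeated_part"
  have Vw: "V = repeated_part * w" using repeated_part_dvd[OF eq1] by (simp add: w_def)
  define c where "c l = poly w (t l) / (real (m l) * poly (cofactor l) (t l))" for l
  define Q where "Q l = repeated_part * cofactor l" for l
  have mc: "real (m l) * poly (cofactor l) (t l) \<noteq> 0" if "l \<in> L" for l
    using poly_cofactor(1)[OF that] m_pos[OF that] by simp
  have cw: "poly w (t l) = c l * (real (m l) * poly (cofactor l) (t l))" if "l \<in> L" for l
    using mc[OF that] by (simp add: c_def)
  have PQ: "blocks_poly = [:- t l, 1:] * Q l" if "l \<in> L" for l
    unfolding blocks_poly_eq Q_def radical_eq[OF that] by (simp only: mult_ac)
  have "0 < card L" using M(2) finite_L by (metis Diff_empty card_gt_0_iff empty_Diff)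
  have degw: "degree w < card L"
  proof (cases "w = 0")
    case False
    have "degree blocks_poly = degree repeated_part + card L"
      unfolding blocks_poly_eq using nonzero by (simp add: degree_mult_eq degree_radical)
    moreover have "degree V = degree repeated_part + degree w"
      unfolding Vw using nonzero False by (simp add: degree_mult_eq)
    ultimately show ?thesis using V P by simp
  qed (use \<open>0 < card L\<close> in simp)
  have weq: "w = (\<Sum>l\<in>L. smult (c l * real (m l)) (cofactor l))"
  proof (rule poly_eqI_degree[where A = "t ` L"])
    fix z assume "z \<in> t ` L"
    then obtain l where l: "l \<in> L" "z = t l" by blast
    have "poly (\<Sum>l\<in>L. smult (c l * real (m l)) (cofactor l)) z
       = (\<Sum>l'\<in>L. if l' = l then c l * real (m l) * poly (cofactor l) (t l) else 0)"
      unfolding poly_sum using poly_cofactor(2) l by (intro sum.cong refl) auto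
    also have "\<dots> = poly w z" using l finite_L cw[OF l(1)] by simp
    finally show "poly w z = poly (\<Sum>l\<in>L. smult (c l * real (m l)) (cofactor l)) z" by simp
  next
    show "degree w < card (t ` L)" using degw inj_t by (simp add: card_image)
    have "degree (\<Sum>l\<in>L. smult (c l * real (m l)) (cofactor l)) \<le> card L - 1"
      by (intro degree_sum_le finite_L order_trans[OF degree_smult_le]) (simp add: degree_cofactor)
    thus "degree (\<Sum>l\<in>L. smult (c l * real (m l)) (cofactor l)) < card (t ` L)"
      using \<open>0 < card L\<close> inj_t by (simp add: card_image)
  qed
  have VQ: "V = (\<Sum>l\<in>L. smult (c l * real (m l)) (Q l))"
    unfolding Vw by (subst weq) (simp add: sum_distrib_left Q_def)
  have PQ': "pderiv blocks_poly = (\<Sum>l\<in>L. smult (real (m l)) (Q l))"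
    unfolding pderiv_blocks_poly log_deriv_num_def by (simp add: sum_distrib_left Q_def)
  have mean: "\<exists>\<alpha>. (\<forall>l\<in>L. \<alpha> l > 0) \<and> (\<Sum>l\<in>L. \<alpha> l * (c l - c i)) = 0" if i: "i \<in> M" for i
  proof -
    have iL: "i \<in> L" using M(1) i by blast
    let ?z = "t i"
    define q where "q l = poly ((pderiv ^^ k) (Q l)) ?z" for l
    define p where "p = poly ((pderiv ^^ Suc k) blocks_poly) ?z"
    have qp: "0 < q l * p" if l: "l \<in> L" for l
    proof -
      have "poly blocks_poly (t l) = 0" unfolding PQ[OF l] by simp
      then obtain j where j: "j < n" "y j = t l" unfolding P poly_root_poly_eq_0_iff by blast
      obtain y' where y': "root_poly n y = [:- y j, 1:] * root_poly (n - 1) y'" using root_poly_remove[OF j(1)] .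
      have "[:- t l, 1:] * Q l = [:- t l, 1:] * root_poly (n - 1) y'" using PQ[OF l] y' P j(2) by simp
      moreover have "[:- t l, 1:] \<noteq> 0" by simp
      ultimately have Ql: "Q l = root_poly (n - 1) y'" by (metis mult_left_cancel)
      show ?thesis unfolding q_def p_def Ql
        by (rule deriv_quotient_sign[of k "n - 1" blocks_poly "t l"]) (use k M(3,5)[OF i] PQ[OF l] Ql in auto)
    qed
    have Hd: "real (m i) * poly Hd ?z = poly w ?z"
    proof -
      have e: "pderiv repeated_part * radical = repeated_part * (log_deriv_num - pderiv radical)"
        using pderiv_blocks_poly unfolding blocks_poly_eq pderiv_mult by (simp add: algebra_simps)
      have "pderiv V * radical = repeated_part * (pderiv w * radical) + w * (pderiv repeated_part * radical)"
        unfolding Vw pderiv_mult by (simp add: algebra_simps)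
      hence "pderiv V * radical - V * log_deriv_num = repeated_part * (pderiv w * radical - pderiv radical * w)"
        unfolding e unfolding Vw by (simp add: algebra_simps)
      moreover have "pderiv V * radical - V * log_deriv_num = repeated_part * (radical * Wd - log_deriv_num * Hd)"
        using eq1 unfolding pderiv_blocks_poly unfolding blocks_poly_eq by (simp add: algebra_simps)
      ultimately have "pderiv w * radical - pderiv radical * w = radical * Wd - log_deriv_num * Hd"
        using nonzero(2) by (metis mult_left_cancel)
      from arg_cong[OF this, of "\<lambda>p. poly p ?z"]
      have "poly (cofactor i) ?z * poly w ?z = poly (cofactor i) ?z * (real (m i) * poly Hd ?z)"
        using poly_radical[OF iL] poly_log_deriv_num[OF iL] by simp
      thus ?thesis using poly_cofactor(1)[OF iL] by simp
    qed
    have v1: "poly ((pderiv ^^ k) V) ?z * poly E ?z = poly Hd ?z * poly C ?z"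
      using arg_cong[OF eq2, of "\<lambda>p. poly p ?z"] M(3)[OF i] poly_radical(1)[OF iL] by simp
    have "pderiv ((pderiv ^^ k) blocks_poly * E) = pderiv (radical * C)" using EC by simp
    from arg_cong[OF this, of "\<lambda>p. poly p ?z"]
    have v2: "p * poly E ?z = poly (cofactor i) ?z * poly C ?z"
      using M(3)[OF i] poly_radical[OF iL] by (simp add: pderiv_mult p_def algebra_simps)
    have "poly Hd ?z = c i * poly (cofactor i) ?z"
      using Hd cw[OF iL] m_pos[OF iL] by simp
    hence "poly ((pderiv ^^ k) V) ?z * poly E ?z = c i * (p * poly E ?z)" using v1 v2 by simp
    hence v: "poly ((pderiv ^^ k) V) ?z = c i * p" using M(4)[OF i] by simp
    have "poly ((pderiv ^^ k) V) ?z = (\<Sum>l\<in>L. c l * real (m l) * q l)"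
      unfolding VQ pderiv_pow_sum_smult poly_sum by (simp add: q_def)
    moreover have "p = (\<Sum>l\<in>L. real (m l) * q l)"
      unfolding p_def funpow_Suc_right o_def PQ' pderiv_pow_sum_smult poly_sum by (simp add: q_def)
    ultimately have s: "(\<Sum>l\<in>L. c l * real (m l) * q l) = c i * (\<Sum>l\<in>L. real (m l) * q l)" using v by simp
    have "(\<Sum>l\<in>L. (real (m l) * (q l * p)) * (c l - c i))
      = p * ((\<Sum>l\<in>L. c l * real (m l) * q l) - c i * (\<Sum>l\<in>L. real (m l) * q l))"
      unfolding sum_distrib_left sum_subtractf[symmetric] by (intro sum.cong refl) (simp add: algebra_simps)
    hence "(\<Sum>l\<in>L. (real (m l) * (q l * p)) * (c l - c i)) = 0" using s by simp
    moreover have "\<forall>l\<in>L. 0 < real (m l) * (q l * p)" using qp m_pos by simp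
    ultimately show ?thesis by (intro exI[of _ "\<lambda>l. real (m l) * (q l * p)"]) auto
  qed
  have c0: "c l = 0" if "l \<in> L - M" for l using free[OF that] by (simp add: c_def w_def)
  have LM: "L - (L - M) = M" using M(1) by blast
  have "c l \<le> 0" if "l \<in> L" for l
    by (rule weighted_mean_le_0[of L "L - M" c]) (use finite_L M(2) c0 mean LM that in auto)
  moreover have "- c l \<le> 0" if "l \<in> L" for l
  proof (rule weighted_mean_le_0[of L "L - M" "\<lambda>l. - c l"])
    fix i assume "i \<in> L - (L - M)"
    hence "i \<in> M" using LM by simp
    from mean[OF this] obtain \<alpha> where \<alpha>: "\<forall>l\<in>L. \<alpha> l > 0" "(\<Sum>l\<in>L. \<alpha> l * (c l - c i)) = 0" by blast
    have "(\<Sum>l\<in>L. \<alpha> l * (- c l - - c i)) = - (\<Sum>l\<in>L. \<alpha> l * (c l - c i))"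
      unfolding sum_negf[symmetric] by (intro sum.cong refl) (simp add: algebra_simps)
    thus "\<exists>\<alpha>. (\<forall>l\<in>L. 0 < \<alpha> l) \<and> (\<Sum>l\<in>L. \<alpha> l * (- c l - - c i)) = 0" using \<alpha> by (intro exI[of _ \<alpha>]) simp
  qed (use finite_L M(2) c0 that in auto)
  ultimately have "c l = 0" if "l \<in> L" for l using that by force
  thus "V = 0" unfolding VQ by simp
qed

end

lemma linear_factors_dvd:
  assumes "finite A" "inj_on t A" "\<And>l. l \<in> A \<Longrightarrow> poly p (t l) = (0 :: real)"
  shows "(\<Prod>l\<in>A. [:- t l, 1:]) dvd p"
proof (cases "p = 0")
  case False
  have "(\<Prod>l\<in>A. [:- t l, 1:] ^ 1) dvd p"
    by (rule prod_power_dvd[OF assms(1,2) False]) (use assms(3) False order_root[of p] in \<open>force simp: Suc_le_eq\<close>)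
  thus ?thesis by simp
qed simp

section \<open>Smoothness of the strata\<close>

text \<open>The direction in which the polynomial moves if its coefficient vector moves in the direction \<open>v\<close>.\<close>

definition linear_part :: "real ^ 'n::{finite,linorder} \<Rightarrow> real poly" where
  "linear_part v = (\<Sum>i\<in>UNIV. monom (v $ i) (CARD('n) - coord_pos i))"

lemma linear_part_linear:
  fixes u v :: "real ^ 'n::{finite,linorder}"
  shows "linear_part (u + v) = linear_part u + linear_part v"
  "linear_part (c *\<^sub>R v) = smult c (linear_part v)"
proof -
  have c: "coeff (linear_part v) j = (\<Sum>i\<in>UNIV. if CARD('n) - coord_pos i = j then v $ i else 0)" for v :: "(real, 'n) vec" and j
    by (simp add: linear_part_def coeff_sum)
  show "linear_part (u + v) = linear_part u + linear_part v"
    by (rule poly_eqI, unfold coeff_add c sum.distrib[symmetric]) (intro sum.cong, auto)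
  show "linear_part (c *\<^sub>R v) = smult c (linear_part v)"
    by (rule poly_eqI, unfold coeff_smult c sum_distrib_left) (intro sum.cong, auto)
qed

lemma coeff_linear_part:
  "coeff (linear_part (v :: real ^ 'n::{finite,linorder})) j = coeff (monic_poly_of v) j - coeff (monic_poly_of (0 :: real ^ 'n::{finite,linorder})) j"
  by (simp add: linear_part_def monic_poly_of_def)

lemma coeff_linear_part_coord_pos:
  "coeff (linear_part v) (CARD('n) - coord_pos i) = (v :: real ^ 'n::{finite,linorder}) $ i"
  by (simp add: coeff_linear_part coeff_monic_poly_of(1))

lemma linear_part_eq_0: "linear_part v = 0 \<Longrightarrow> v = (0 :: real ^ 'n::{finite,linorder})"
  using coeff_linear_part_coord_pos[of v] by (simp add: vec_eq_iff)

lemma degree_linear_part: "degree (linear_part v) < CARD('n)" for v :: "real ^ 'n::{finite,linorder}"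
proof (cases "linear_part v = 0")
  case False
  have "coeff (linear_part v) j = 0" if "j \<ge> CARD('n)" for j
    using that coeff_monic_poly_of(2,3)[where 'n='n] by (cases "j = CARD('n)") (auto simp: coeff_linear_part)
  thus ?thesis using False by (metis leading_coeff_0_iff not_le)
qed simp

lemma coeff_monic_poly_of_cases:
  fixes j :: nat
  obtains i where "\<And>a :: real ^ 'n::{finite,linorder}. coeff (monic_poly_of a) j = a $ i" "j = CARD('n) - coord_pos i"
  | c where "\<And>a :: real ^ 'n::{finite,linorder}. coeff (monic_poly_of a) j = c"
proof -
  consider "j > CARD('n)" | "j = CARD('n)" | "j < CARD('n)" by linarith
  thus ?thesis
  proof cases
    case 3
    define i where "i = (inv coord_pos (Suc (CARD('n) - j - 1)) :: 'n)"
    have "coord_pos i = CARD('n) - j" unfolding i_def using 3 by (subst coord_pos_inv) auto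
    hence "j = CARD('n) - coord_pos i" using 3 by simp
    thus ?thesis using that(1)[of i] by (simp add: coeff_monic_poly_of)
  qed (use that(2) coeff_monic_poly_of(2,3) in blast)+
qed

lemma poly_regular_monic_poly_of: "poly_regular S a0 (monic_poly_of :: real ^ 'n::{finite,linorder} \<Rightarrow> real poly)"
  unfolding poly_regular_def
proof
  fix j
  show "regular S a0 (\<lambda>a :: (real, 'n) vec. coeff (monic_poly_of a) j)"
  proof (rule coeff_monic_poly_of_cases[where 'n = 'n and j = j])
    fix i assume "\<And>a :: (real, 'n) vec. coeff (monic_poly_of a) j = a $ i"
    thus ?thesis by (auto intro!: regular_poly real_polynomial_function.intros(1) bounded_linear_vec_nth)
  qed (auto intro: regular_const)
qed

lemma ptv_monic_poly_of:
  fixes v :: "real ^ 'n::{finite,linorder}"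
  assumes "tangent_vector S a0 v"
  shows "tangent_vector.ptv S a0 v monic_poly_of (linear_part v)"
proof -
  interpret tangent_vector S a0 v by fact
  show ?thesis
    unfolding ptv_def
  proof
    fix j
    show "tv (\<lambda>a. coeff (monic_poly_of a) j) (coeff (linear_part v) j)"
    proof (rule coeff_monic_poly_of_cases[where 'n = 'n and j = j])
      fix i assume i: "\<And>a :: (real, 'n) vec. coeff (monic_poly_of a) j = a $ i" "j = CARD('n) - coord_pos i"
      have "((\<lambda>a :: (real, 'n) vec. a $ i) has_derivative (\<lambda>h. h \<bullet> axis i 1)) (at a0)"
        using bounded_linear_imp_has_derivative[OF bounded_linear_vec_nth[of i]] by (simp add: inner_axis)
      hence "GDERIV (\<lambda>a :: (real, 'n) vec. a $ i) a0 :> axis i 1" by (simp add: gderiv_def)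
      from tv_poly[OF real_polynomial_function.intros(1)[OF bounded_linear_vec_nth] this]
      show ?thesis unfolding i(1) unfolding i(2) coeff_linear_part_coord_pos by (simp add: inner_axis')
    next
      fix c assume c: "\<And>a :: (real, 'n) vec. coeff (monic_poly_of a) j = c"
      show ?thesis unfolding coeff_linear_part c using tv_const by simp
    qed
  qed
qed

context stratum_chart
begin

abbreviation "leads \<equiv> {i. i < n \<and> lead (x i) = i}"
abbreviation "block_size l \<equiv> card {i. i < n \<and> lead (x i) = l}"
abbreviation "roots a \<equiv> seq_of (roots_vec a)"

text \<open>Among the distinct roots of \<open>P\<close>, the stationary ones are all common roots with the \<open>k\<close>-th derivative, and the marked ones are those of
multiplicity less than \<open>k\<close> among them.\<close>

definition stationary :: "nat set" where
  "stationary = {l \<in> leads. \<exists>j<n-k. \<xi> j = x l}"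

definition marked :: "nat set" where
  "marked = {l \<in> leads. x l \<in> \<xi> ` simple}"

lemma param_index_eq: "param_index = leads - marked"
  using simple_strict by (force simp: param_index_def marked_def free_def is_end_def)

lemma marked_subset: "marked \<subseteq> stationary"
  using simple_less by (force simp: marked_def stationary_def)

lemma zero_in_param_index: "0 \<in> param_index"
  using n_pos by (simp add: param_index_def is_end_def)

text \<open>A root of multiplicity greater than \<open>k\<close> starts with an index that belongs to no node, while nodes have distinct values.\<close>

lemma marked_order:
  assumes "l \<in> marked"
  shows "order (x l) P \<le> k"
proof (rule ccontr)
  assume neg: "\<not> order (x l) P \<le> k"
  obtain j where j: "j \<in> simple" "\<xi> j = x l" using assms by (auto simp: marked_def)
  have l: "l < n" "lead (x l) = l" using assms by (auto simp: marked_def)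
  have "\<exists>i. l + k \<le> i \<and> i < n \<and> x i = x l"
  proof (rule ccontr)
    assume no: "\<not> ?thesis"
    have "{i. i < n \<and> x i = x l} \<subseteq> {l..<l+k}"
    proof
      fix i assume i: "i \<in> {i. i < n \<and> x i = x l}"
      have "l \<le> i" using lead(1)[of i] i l(2) by auto
      thus "i \<in> {l..<l+k}" using no i by auto
    qed
    hence "card {i. i < n \<and> x i = x l} \<le> card {l..<l+k}" by (intro card_mono) auto
    thus False using neg by (simp add: order_root_poly)
  qed
  then obtain i where i: "l + k \<le> i" "i < n" "x i = x l" by blast
  have e: "x (l + k) = x l" using sorted_squeeze[OF sorted, of l "l+k" i] i by simp
  have lk: "l < n - k" using i by simp
  have "\<xi> l = x l" using deriv_root_bounds[OF sorted lk] e by simp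
  hence "j = l" using simple_inj[OF j(1) lk] j(2) by simp
  thus False using j(1) e by (simp add: simple_def)
qed

context
  fixes a
  assumes a: "a \<in> pattern_stratum"
begin

lemma roots_eq: "i < n \<Longrightarrow> i' < n \<Longrightarrow> roots a i = roots a i' \<longleftrightarrow> x i = x i'"
  using same_pattern_eq(1)[OF pattern_stratum_roots(4)[OF a]] .

lemma blocks: "root_blocks leads (roots a) (\<lambda>l. block_size l)"
proof
  show "inj_on (roots a) leads"
  proof (rule inj_onI)
    fix l l' assume l: "l \<in> leads" "l' \<in> leads" "roots a l = roots a l'"
    have ln: "l < n" "lead (x l) = l" "l' < n" "lead (x l') = l'" using l(1,2) by auto
    have "x l = x l'" using roots_eq[OF ln(1,3)] l(3) by blast
    from ln(2)[unfolded this] have "lead (x l') = l" .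
    thus "l = l'" unfolding ln(4) by (rule sym)
  qed
  fix l assume "l \<in> leads"
  hence "l \<in> {i. i < n \<and> lead (x i) = l}" by simp
  thus "0 < block_size l" by (subst card_gt_0_iff) auto
qed simp

interpretation B: root_blocks leads "roots a" "\<lambda>l. block_size l" by (rule blocks)

interpretation R: sorted_roots n k "roots a"
  using pattern_stratum_roots[OF a] k by unfold_locales

lemma monic_poly_blocks: "monic_poly_of a = B.blocks_poly"
proof -
  have "root_poly n (roots a) = (\<Prod>l\<in>leads. \<Prod>i\<in>{i. i \<in> {..<n} \<and> lead (x i) = l}. [:- roots a i, 1:])"
    unfolding root_poly_def
  proof (rule prod.group[symmetric])
    show "(\<lambda>i. lead (x i)) ` {..<n} \<subseteq> leads" using lead_props(1,3) by auto
  qed auto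
  also have "\<dots> = (\<Prod>l\<in>leads. [:- roots a l, 1:] ^ block_size l)"
  proof (rule prod.cong[OF refl])
    fix l assume l: "l \<in> leads"
    have "roots a i = roots a l" if "i < n" "lead (x i) = l" for i
    proof -
      have "x l = x i" using lead(2)[of i] that(2) by simp
      thus ?thesis using roots_eq[of i l] that l by simp
    qed
    hence "(\<Prod>i\<in>{i. i \<in> {..<n} \<and> lead (x i) = l}. [:- roots a i, 1:]) = (\<Prod>i\<in>{i. i \<in> {..<n} \<and> lead (x i) = l}. [:- roots a l, 1:])"
      by (intro prod.cong refl) auto
    thus "(\<Prod>i\<in>{i. i \<in> {..<n} \<and> lead (x i) = l}. [:- roots a i, 1:]) = [:- roots a l, 1:] ^ block_size l"
      by simp
  qed
  finally show ?thesis unfolding pattern_stratum_roots(3)[OF a] B.blocks_poly_def .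
qed

lemma stationary_iff:
  assumes "l \<in> leads"
  shows "poly ((pderiv ^^ k) B.blocks_poly) (roots a l) = 0 \<longleftrightarrow> l \<in> stationary"
proof -
  have l: "l < n" using assms by simp
  have "poly R.Pk (roots a l) = 0 \<longleftrightarrow> (\<exists>j<n-k. deriv_root k n (roots a) j = roots a l)" by (rule R.poly_Pk_eq_0_iff)
  also have "\<dots> \<longleftrightarrow> (\<exists>j<n-k. \<xi> j = x l)"
    using same_pattern_eq(2)[OF pattern_stratum_roots(4)[OF a] l] by blast
  finally show ?thesis using assms pattern_stratum_roots(3)[OF a] monic_poly_blocks by (simp add: stationary_def)
qed

lemma order_marked: "l \<in> marked \<Longrightarrow> order (roots a l) B.blocks_poly \<le> k"
proof -
  assume l: "l \<in> marked"
  have "{i. i < n \<and> roots a i = roots a l} = {i. i < n \<and> x i = x l}"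
    using roots_eq l by (auto simp: marked_def)
  hence "order (roots a l) R.P = order (x l) P" by (simp add: order_root_poly)
  thus "order (roots a l) B.blocks_poly \<le> k"
    using marked_order[OF l] pattern_stratum_roots(3)[OF a] monic_poly_blocks by simp
qed

definition nonstationary_part :: "real poly" where
  "nonstationary_part = (\<Prod>l\<in>leads - stationary. [:- roots a l, 1:])"

definition stationary_part :: "real poly" where
  "stationary_part = (\<Prod>l\<in>stationary. [:- roots a l, 1:])"

text \<open>The factor \<open>C\<close> in the identity \<open>D E = H C\<close>, where \<open>E\<close> is \<open>nonstationary_part\<close> and \<open>H\<close> is the radical.\<close>

definition deriv_quotient :: "real poly" where
  "deriv_quotient = (pderiv ^^ k) B.blocks_poly div stationary_part"

lemma deriv_factor: "(pderiv ^^ k) B.blocks_poly = stationary_part * deriv_quotient"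
proof -
  have "stationary_part dvd (pderiv ^^ k) B.blocks_poly"
    unfolding stationary_part_def
  proof (rule linear_factors_dvd)
    show "finite stationary" by (simp add: stationary_def)
    show "inj_on (roots a) stationary" by (rule inj_on_subset[OF B.inj_t]) (auto simp: stationary_def)
    show "poly ((pderiv ^^ k) B.blocks_poly) (roots a l) = 0" if "l \<in> stationary" for l
      using stationary_iff[of l] that by (auto simp: stationary_def)
  qed
  thus ?thesis by (simp add: deriv_quotient_def)
qed

lemma radical_factor: "B.radical = stationary_part * nonstationary_part"
  unfolding B.radical_def stationary_part_def nonstationary_part_def
  by (subst prod.subset_diff[of stationary leads]) (auto simp: stationary_def mult.commute)

lemma deriv_eq: "(pderiv ^^ k) B.blocks_poly * nonstationary_part = B.radical * deriv_quotient"
  unfolding deriv_factor radical_factor by (simp only: mult_ac)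

lemma nonstationary_part_degree: "degree nonstationary_part = card (leads - stationary)" "coeff nonstationary_part (card (leads - stationary)) = 1"
proof -
  show d: "degree nonstationary_part = card (leads - stationary)"
    unfolding nonstationary_part_def by (subst degree_prod_sum_eq) auto
  have "lead_coeff nonstationary_part = 1" unfolding nonstationary_part_def lead_coeff_prod by simp
  thus "coeff nonstationary_part (card (leads - stationary)) = 1" unfolding d .
qed

lemma deriv_quotient_degree: "degree deriv_quotient < Suc n"
proof -
  have "deriv_quotient \<noteq> 0" "stationary_part \<noteq> 0"
    using deriv_factor R.Pk_neq_0 pattern_stratum_roots(3)[OF a] monic_poly_blocks by auto
  hence "degree ((pderiv ^^ k) B.blocks_poly) = degree stationary_part + degree deriv_quotient"
    unfolding deriv_factor by (rule degree_mult_eq[rotated])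
  moreover have "degree ((pderiv ^^ k) B.blocks_poly) \<le> n"
  proof -
    obtain c where "R.Pk = smult c (root_poly (n - k) R.\<xi>)" using R.Pk_eq by blast
    hence "degree R.Pk \<le> n - k" using degree_smult_le[of c "root_poly (n - k) R.\<xi>"] by simp
    thus ?thesis using pattern_stratum_roots(3)[OF a] monic_poly_blocks by simp
  qed
  ultimately show ?thesis by simp
qed

lemma poly_nonstationary_part:
  "l \<in> leads - stationary \<Longrightarrow> poly nonstationary_part (roots a l) = 0"
  "l \<in> leads - stationary \<Longrightarrow> poly deriv_quotient (roots a l) \<noteq> 0"
  "l \<in> stationary \<Longrightarrow> poly nonstationary_part (roots a l) \<noteq> 0"
proof -
  show "l \<in> leads - stationary \<Longrightarrow> poly nonstationary_part (roots a l) = 0"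
    by (auto simp: nonstationary_part_def poly_prod)
  show "poly deriv_quotient (roots a l) \<noteq> 0" if "l \<in> leads - stationary"
    using stationary_iff[of l] that unfolding deriv_factor by auto
  show "poly nonstationary_part (roots a l) \<noteq> 0" if "l \<in> stationary"
    using that B.inj_t by (auto simp: nonstationary_part_def poly_prod stationary_def inj_on_def)
qed

end

text \<open>The factors of the two identities \<open>P' H = P W\<close> and \<open>D E = H C\<close> have regular coefficients: first \<open>H\<close> and \<open>W\<close>, because \<open>P\<close> has, and then \<open>E\<close> and
\<open>C\<close>, because \<open>H\<close> has.  Deriving both identities along \<open>v\<close> gives the hypotheses of \<open>tangent_poly_eq_0\<close>.\<close>

lemma tangent_eq_0:
  assumes a0: "a0 \<in> pattern_stratum" and v: "v \<in> tangent_space pattern_stratum a0"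
    and free: "\<And>l. l \<in> param_index \<Longrightarrow>
      poly (linear_part v div root_blocks.repeated_part leads (roots a0) (\<lambda>l. block_size l)) (roots a0 l) = 0"
  shows "v = 0"
proof -
  let ?S = "pattern_stratum"
  define H where "H a = root_blocks.radical leads (roots a)" for a :: "(real, 'n) vec"
  define W where "W a = root_blocks.log_deriv_num leads (roots a) (\<lambda>l. block_size l)" for a :: "(real, 'n) vec"
  have tv: "tangent_vector ?S a0 v"
    using a0 v unfolding tangent_space_def by unfold_locales blast+
  interpret T: tangent_vector ?S a0 v by (rule tv)
  interpret B: root_blocks leads "roots a0" "\<lambda>l. block_size l" by (rule blocks[OF a0])
  have P0: "monic_poly_of a0 = B.blocks_poly" by (rule monic_poly_blocks[OF a0])
  have eqW: "pderiv (monic_poly_of a) * H a = monic_poly_of a * W a" if "a \<in> ?S" for a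
  proof -
    interpret A: root_blocks leads "roots a" "\<lambda>l. block_size l" by (rule blocks[OF that])
    show ?thesis unfolding monic_poly_blocks[OF that] H_def W_def A.pderiv_blocks_poly
      by (subst A.blocks_poly_eq) (simp only: mult_ac)
  qed
  have H: "degree (H a) = card leads" "coeff (H a) (card leads) = 1" "degree (W a) < Suc (card leads)" if "a \<in> ?S" for a
  proof -
    interpret A: root_blocks leads "roots a" "\<lambda>l. block_size l" by (rule blocks[OF that])
    show "degree (H a) = card leads" "coeff (H a) (card leads) = 1" "degree (W a) < Suc (card leads)"
      unfolding H_def W_def using A.degree_radical A.coeff_radical A.degree_log_deriv_num by auto
  qed
  have inj: "card (roots a0 ` A) = card A" if "A \<subseteq> leads" for A
    using inj_on_subset[OF B.inj_t that] by (rule card_image)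
  have regHW: "\<And>i. regular ?S a0 (\<lambda>a. if a \<in> ?S then coeff (H a) i else 0)"
    "\<And>i. regular ?S a0 (\<lambda>a. if a \<in> ?S then coeff (W a) i else 0)"
  proof -
    have N: "monic_poly_of a0 \<noteq> 0" using B.nonzero(1) P0 by simp
    have R: "finite (roots a0 ` leads)" "card (roots a0 ` leads) = card leads" using inj[OF order_refl] by auto
    have R0: "poly (H a0) t = 0" "poly (W a0) t \<noteq> 0" if t: "t \<in> roots a0 ` leads" for t
    proof -
      obtain l where l: "l \<in> leads" "t = roots a0 l" using t by blast
      show "poly (H a0) t = 0" unfolding H_def l(2) by (rule B.poly_radical(1)[OF l(1)])
      show "poly (W a0) t \<noteq> 0"
        unfolding W_def l(2) B.poly_log_deriv_num[OF l(1)] mult_eq_0_iff of_nat_eq_0_iff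
        using B.poly_cofactor(1)[OF l(1)] gr_implies_not0[OF B.m_pos[OF l(1)]] by blast
    qed
    note syz1 = syzygy_regular[OF a0 poly_regular_pderiv[OF poly_regular_monic_poly_of] poly_regular_monic_poly_of eqW H N R R0]
    show "\<And>i. regular ?S a0 (\<lambda>a. if a \<in> ?S then coeff (H a) i else 0)"
      "\<And>i. regular ?S a0 (\<lambda>a. if a \<in> ?S then coeff (W a) i else 0)"
      by (rule syz1; assumption)+
  qed
  have eqE: "(pderiv ^^ k) (monic_poly_of a) * nonstationary_part a = (if a \<in> ?S then H a else 0) * deriv_quotient a" if "a \<in> ?S" for a
    using deriv_eq[OF that] that unfolding monic_poly_blocks[OF that] H_def by simp
  have "coeff (if a \<in> ?S then H a else 0) i = (if a \<in> ?S then coeff (H a) i else 0)" for a i by simp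
  hence regH: "poly_regular ?S a0 (\<lambda>a. if a \<in> ?S then H a else 0)"
    unfolding poly_regular_def using regHW(1) by simp
  have H0: "(if a0 \<in> ?S then H a0 else 0) \<noteq> 0" using B.nonzero(3) a0 by (simp add: H_def)
  have regEC: "\<And>i. regular ?S a0 (\<lambda>a. if a \<in> ?S then coeff (nonstationary_part a) i else 0)"
    "\<And>i. regular ?S a0 (\<lambda>a. if a \<in> ?S then coeff (deriv_quotient a) i else 0)"
  proof -
    have R: "finite (roots a0 ` (leads - stationary))" "card (roots a0 ` (leads - stationary)) = card (leads - stationary)"
      "\<And>t. t \<in> roots a0 ` (leads - stationary) \<Longrightarrow> poly (nonstationary_part a0) t = 0"
      "\<And>t. t \<in> roots a0 ` (leads - stationary) \<Longrightarrow> poly (deriv_quotient a0) t \<noteq> 0"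
      using inj[of "leads - stationary"] poly_nonstationary_part(1,2)[OF a0] by auto
    note syz2 = syzygy_regular[OF a0 poly_regular_pderiv_pow[OF poly_regular_monic_poly_of] regH eqE nonstationary_part_degree
        deriv_quotient_degree H0 R]
    show "\<And>i. regular ?S a0 (\<lambda>a. if a \<in> ?S then coeff (nonstationary_part a) i else 0)"
      "\<And>i. regular ?S a0 (\<lambda>a. if a \<in> ?S then coeff (deriv_quotient a) i else 0)"
      by (rule syz2; assumption)+
  qed
  obtain Hd where Hd: "T.ptv H Hd" using T.ptv_exists[OF regHW(1), of "Suc (card leads)"] H(1) by auto
  obtain Wd where Wd: "T.ptv W Wd" using T.ptv_exists[OF regHW(2)] H(3) by blast
  obtain Ed where Ed: "T.ptv nonstationary_part Ed" using T.ptv_exists[OF regEC(1), of "Suc (card (leads - stationary))"] nonstationary_part_degree(1) by auto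
  obtain Cd where Cd: "T.ptv deriv_quotient Cd" using T.ptv_exists[OF regEC(2)] deriv_quotient_degree by blast
  note PV = ptv_monic_poly_of[OF tv]
  have "pderiv (linear_part v) * H a0 + pderiv (monic_poly_of a0) * Hd = linear_part v * W a0 + monic_poly_of a0 * Wd"
    by (rule T.ptv_unique[OF T.ptv_mult[OF T.ptv_pderiv[OF PV] Hd] T.ptv_mult[OF PV Wd] eqW])
  hence e1: "pderiv (linear_part v) * B.radical + pderiv B.blocks_poly * Hd = linear_part v * B.log_deriv_num + B.blocks_poly * Wd"
    unfolding P0 H_def W_def .
  have "(pderiv ^^ k) (linear_part v) * nonstationary_part a0 + (pderiv ^^ k) (monic_poly_of a0) * Ed = Hd * deriv_quotient a0 + H a0 * Cd"
    by (rule T.ptv_unique[OF T.ptv_mult[OF T.ptv_pderiv_pow[OF PV] Ed] T.ptv_mult[OF Hd Cd]]) (use eqE in simp)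
  hence e2: "(pderiv ^^ k) (linear_part v) * nonstationary_part a0 + (pderiv ^^ k) B.blocks_poly * Ed = Hd * deriv_quotient a0 + B.radical * Cd"
    unfolding P0 H_def .
  have "linear_part v = 0"
  proof (rule B.tangent_poly_eq_0[OF e1 e2 deriv_eq[OF a0] _ k])
    show "B.blocks_poly = root_poly n (roots a0)" using pattern_stratum_roots(3)[OF a0] P0 by simp
    show "degree (linear_part v) < n" using degree_linear_part[of v] by (simp add: n_card[symmetric])
    show "marked \<subseteq> leads" by (auto simp: marked_def)
    show "leads - marked \<noteq> {}" using zero_in_param_index param_index_eq by blast
    fix l
    show "poly (linear_part v div B.repeated_part) (roots a0 l) = 0" if "l \<in> leads - marked"
      using free that param_index_eq by simp
    assume l: "l \<in> marked"
    hence ls: "l \<in> stationary" "l \<in> leads" using marked_subset by (auto simp: marked_def)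
    show "poly ((pderiv ^^ k) B.blocks_poly) (roots a0 l) = 0" using stationary_iff[OF a0 ls(2)] ls(1) by blast
    show "poly (nonstationary_part a0) (roots a0 l) \<noteq> 0" using poly_nonstationary_part(3)[OF a0 ls(1)] .
    show "order (roots a0 l) B.blocks_poly \<le> k" by (rule order_marked[OF a0 l])
  qed
  thus "v = 0" by (rule linear_part_eq_0)
qed

text \<open>The velocities of the unmarked roots form a linear map to the parameter space that is injective on tangent vectors.\<close>

lemma dim_tangent_space:
  assumes a0: "a0 \<in> pattern_stratum"
  shows "dim (tangent_space pattern_stratum a0) \<le> card param_index"
proof -
  let ?T = "tangent_space pattern_stratum a0"
  let ?G = "root_blocks.repeated_part leads (roots a0) (\<lambda>l. block_size l)"
  define \<Phi> where "\<Phi> v = (vec_of (\<lambda>l. if l \<in> param_index then poly (linear_part v div ?G) (roots a0 l) else 0) :: (real, 'n) vec)" for v :: "(real, 'n) vec"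
  have seq: "seq_of (\<Phi> v) m = (if m \<in> param_index then poly (linear_part v div ?G) (roots a0 m) else 0)" if "m < n" for v m
    unfolding \<Phi>_def using that[unfolded n_card] by (rule seq_of_vec_of)
  have lin: "linear \<Phi>"
  proof (rule linearI; rule vec_eqI_seq)
    fix u v :: "(real, 'n) vec" and c m assume "m < CARD('n)"
    hence m: "m < n" by (simp add: n_card[symmetric])
    show "seq_of (\<Phi> (u + v)) m = seq_of (\<Phi> u + \<Phi> v) m"
      using seq[OF m] by (simp add: linear_part_linear poly_div_add_left)
    show "seq_of (\<Phi> (c *\<^sub>R u)) m = seq_of (c *\<^sub>R \<Phi> u) m"
      using seq[OF m] by (simp add: linear_part_linear div_smult_left)
  qed
  have "v = 0" if v: "v \<in> ?T" "\<Phi> v = 0" for v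
  proof (rule tangent_eq_0[OF a0 v(1)])
    fix l assume l: "l \<in> param_index"
    hence "l < n" by (simp add: param_index_def)
    from seq[OF this, of v] l v(2) show "poly (linear_part v div ?G) (roots a0 l) = 0" by simp
  qed
  hence "inj_on \<Phi> ?T"
    using linear_injective_on_subspace_0[OF lin subspace_tangent_space] by blast
  hence "inj_on \<Phi> (span ?T)" using span_eq_iff subspace_tangent_space by metis
  hence "dim ?T = dim (\<Phi> ` ?T)" using dim_image_eq[OF lin] by simp
  also have "\<Phi> ` ?T \<subseteq> coord_space" using seq by (auto simp: coord_space_def)
  hence "dim (\<Phi> ` ?T) \<le> dim coord_space" by (rule dim_subset)
  finally show ?thesis by (simp add: dim_coord_space)
qed

lemma smooth_pattern_stratum: "smooth_real_algebraic_variety pattern_stratum"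
  unfolding smooth_real_algebraic_variety_def
proof (intro exI[of _ "n - card param_index"] ballI)
  fix a0 assume a0: "a0 \<in> pattern_stratum"
  have "card param_index \<le> card {..<n}" by (rule card_mono) (auto simp: param_index_def)
  hence le: "card param_index \<le> n" by simp
  note hom = stratum_homeomorphism
  show "smooth_algebraic_at (n - card param_index) pattern_stratum a0"
  proof (rule smooth_algebraic_at_tangent_space[OF _ _ subspace_coord_space openin_param_space])
    show "dim (tangent_space pattern_stratum a0) \<le> dim coord_space"
      using dim_tangent_space[OF a0] by (simp add: dim_coord_space)
    show "DIM((real, 'n) vec) = dim coord_space + (n - card param_index)"
      using le by (simp add: dim_coord_space n_card[symmetric])
    show "continuous_on param_space (coeffs_of_roots \<circ> chart)" using hom by (simp add: homeomorphism_def)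
    show "inj_on (coeffs_of_roots \<circ> chart) param_space"
      using hom unfolding homeomorphism_def by (metis inj_on_inverseI)
    show "(coeffs_of_roots \<circ> chart) ` param_space \<subseteq> pattern_stratum" "a0 \<in> (coeffs_of_roots \<circ> chart) ` param_space"
      using hom a0 unfolding homeomorphism_def by blast+
  qed
qed

end

theorem theorem7:
  fixes n k :: nat and S :: "(real ^ 'n::{finite,linorder}) set"
  assumes "n = CARD('n)" and "2 \<le> k" and "k \<le> n - 1"
    and "S \<in> strata k"
  shows "smooth_real_algebraic_variety S \<and> contractible S"
proof -
  obtain v a1 where v: "S = stratum k v" and a1: "a1 \<in> S"
    using assms(4) unfolding strata_def by blast
  have k: "0 < k" "k < n" using assms(2,3) by auto
  have hyp: "a \<in> hyperbolicity_domain \<longleftrightarrow> (\<exists>y. sorted_seq n y \<and> monic_poly_of a = root_poly n y)" for a :: "(real, 'n) vec"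
    unfolding hyperbolicity_domain_def mem_Collect_eq by (rule hyperbolic_iff) (simp add: assms(1))
  obtain x where x: "sorted_seq n x" "monic_poly_of a1 = root_poly n x"
    using a1 hyp unfolding v stratum_def by blast
  interpret stratum_chart n k x "TYPE('n)"
    by unfold_locales (use x(1) k assms(1) in auto)
  have cv: "cv_of k (root_poly n x) = v" using a1 x(2) unfolding v stratum_def by simp
  have "S = pattern_stratum"
  proof (intro equalityI subsetI)
    fix a assume "a \<in> S"
    hence a: "a \<in> hyperbolicity_domain" "cv_of k (monic_poly_of a) = v" unfolding v stratum_def by auto
    then obtain y where y: "sorted_seq n y" "monic_poly_of a = root_poly n y" using hyp by blast
    have "same_pattern k n y x" 
      by (rule cv_eq_imp_same_pattern[OF y(1) x(1) k]) (use a(2) y(2) cv in simp)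
    thus "a \<in> pattern_stratum" unfolding pattern_stratum_def using y by blast
  next
    fix a assume "a \<in> pattern_stratum"
    then obtain y where y: "sorted_seq n y" "monic_poly_of a = root_poly n y" "same_pattern k n y x"
      unfolding pattern_stratum_def by blast
    have "cv_of k (root_poly n y) = v" using same_pattern_imp_cv_eq[OF y(1) x(1) k y(3)] cv by simp
    thus "a \<in> S" unfolding v stratum_def using hyp y(1,2) by auto
  qed
  thus ?thesis using smooth_pattern_stratum contractible_pattern_stratum by simp
qed

end
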